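(* Let $\mathcal{C}$ be the analytic class of the plane branch $\Gamma$ with Puiseux parametrization $(t^6,\ t^7+t^{10}+t^{11})$. Denote $$\mathcal{C}'=\{\Gamma'\in\mathcal{C}:\ \Gamma\ \text{and}\ \Gamma'\ \text{are connected by a geodesic}\}.$$ Then $\mathcal{C}\setminus\mathcal{C}'$ contains a non-empty open set of $\mathcal{C}$ for the Krull topology. In particular $\mathcal{C}'$ is not dense in $\mathcal{C}$.
   Context: A plane branch is a reduced irreducible germ of analytic curve at $(0,0)\in\mathbb{C}^2$. $\mathrm{Diff}(\mathbb{C}^2,0)$ is the group of germs of biholomorphisms fixing the origin. The analytic class of $\Gamma$ is the set $\mathcal{C}=\{\varphi(\Gamma):\varphi\in\mathrm{Diff}(\mathbb{C}^2,0)\}$. A singular holomorphic vector field is a germ of holomorphic vector field at $(0,0)$ vanishing at $(0,0)$; $\exp(X)$ denotes its time $1$ flow. Two branches $\Gamma_1,\Gamma_2\in\mathcal{C}$ are connected by a geodesic if there is a singular holomorphic vector field $X$ with $\exp(X)(\Gamma_1)=\Gamma_2$. Krull topology: on $\mathrm{Diff}(\mathbb{C}^2,0)$ it is the topology with base of open sets $S_{k,\varphi}$, $\varphi\in\mathrm{Diff}(\mathbb{C}^2,0)$, $k\in\mathbb{N}$, where $S_{k,\varphi}$ is the set of elements whose $k$-jet at the origin coincides with that of $\varphi$. Let $\mathrm{Stab}(\Gamma)=\{\varphi\in\mathrm{Diff}(\mathbb{C}^2,0):\varphi(\Gamma)=\Gamma\}$. The class $\mathcal{C}$ is identified with the set of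 left cosets $\mathrm{Diff}(\mathbb{C}^2,0)/\mathrm{Stab}(\Gamma)$ via $\varphi\circ\mathrm{Stab}(\Gamma)\mapsto\varphi(\Gamma)$, and is given the corresponding quotient topology, called the Krull topology of $\mathcal{C}$. *)

theory Defs
  imports "HOL-Complex_Analysis.Complex_Analysis" "HOL-Algebra.Group_Action"
begin

type_synonym C2 = "complex \<times> complex"

subsection \<open>Holomorphic functions and maps in two complex variables\<close>

text \<open>Every complex linear form on the plane is \<open>(u, v) \<mapsto> a u + b v\<close>, so the derivative below is
  required to be complex linear and not merely real linear.\<close>

definition holomorphic_fun :: "(C2 \<Rightarrow> complex) \<Rightarrow> C2 set \<Rightarrow> bool" where
  "holomorphic_fun f U \<longleftrightarrow>
     open U \<and> (\<forall>p\<in>U. \<exists>a b. (f has_derivative (\<lambda>(u, v). a * u + b * v)) (at p))"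

definition holomorphic_map :: "(C2 \<Rightarrow> C2) \<Rightarrow> C2 set \<Rightarrow> bool" where
  "holomorphic_map f U \<longleftrightarrow>
     holomorphic_fun (\<lambda>p. fst (f p)) U \<and> holomorphic_fun (\<lambda>p. snd (f p)) U"

subsection \<open>Germs at the origin\<close>

text \<open>A germ is the class of all functions (all sets) that agree near the origin.\<close>

definition germ :: "(C2 \<Rightarrow> C2) \<Rightarrow> (C2 \<Rightarrow> C2) set" where
  "germ f = {g. \<forall>\<^sub>F p in nhds 0. g p = f p}"

definition set_germ :: "C2 set \<Rightarrow> C2 set set" where
  "set_germ A = {B. \<forall>\<^sub>F p in nhds 0. p \<in> B \<longleftrightarrow> p \<in> A}"

definition germ_comp :: "(C2 \<Rightarrow> C2) set \<Rightarrow> (C2 \<Rightarrow> C2) set \<Rightarrow> (C2 \<Rightarrow> C2) set" where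
  "germ_comp \<phi> \<psi> = (THE \<eta>. \<exists>f\<in>\<phi>. \<exists>g\<in>\<psi>. \<eta> = germ (f \<circ> g))"

subsection \<open>The group of germs of biholomorphisms fixing the origin\<close>

definition biholomorphic_near_0 :: "(C2 \<Rightarrow> C2) \<Rightarrow> C2 set \<Rightarrow> bool" where
  "biholomorphic_near_0 f U \<longleftrightarrow>
     0 \<in> U \<and> f 0 = 0 \<and> holomorphic_map f U \<and>
     (\<exists>g. holomorphic_map g (f ` U) \<and> (\<forall>p\<in>U. g (f p) = p))"

definition Diff :: "(C2 \<Rightarrow> C2) set monoid" where
  "Diff = \<lparr>carrier = {germ f |f. \<exists>U. biholomorphic_near_0 f U}, mult = germ_comp, one = germ id\<rparr>"

text \<open>The restriction to a neighbourhood \<open>U\<close> of biholomorphy matters: a representative may be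
  arbitrary far from the origin and could otherwise map distant points close to the origin.\<close>

definition image_germ :: "(C2 \<Rightarrow> C2) set \<Rightarrow> C2 set set \<Rightarrow> C2 set set" where
  "image_germ \<phi> \<Gamma> =
     (THE \<Delta>. \<exists>f\<in>\<phi>. \<exists>A\<in>\<Gamma>. \<exists>U. biholomorphic_near_0 f U \<and> \<Delta> = set_germ (f ` (A \<inter> U)))"

subsection \<open>Plane branches and analytic classes\<close>

text \<open>Units of the local ring of germs of holomorphic functions are the germs that do not vanish
  at the origin.\<close>

definition irreducible_at_0 :: "(C2 \<Rightarrow> complex) \<Rightarrow> bool" where
  "irreducible_at_0 f \<longleftrightarrow>
     (\<exists>U. 0 \<in> U \<and> holomorphic_fun f U) \<and> f 0 = 0 \<and> \<not> (\<forall>\<^sub>F p in nhds 0. f p = 0) \<and>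
     (\<forall>g h. (\<exists>U. 0 \<in> U \<and> holomorphic_fun g U) \<and> (\<exists>U. 0 \<in> U \<and> holomorphic_fun h U) \<and>
            (\<forall>\<^sub>F p in nhds 0. f p = g p * h p) \<longrightarrow> g 0 \<noteq> 0 \<or> h 0 \<noteq> 0)"

text \<open>A reduced germ of analytic curve is determined by its zero set.\<close>

definition plane_branch :: "C2 set set \<Rightarrow> bool" where
  "plane_branch \<Gamma> \<longleftrightarrow> (\<exists>f. irreducible_at_0 f \<and> \<Gamma> = set_germ {p. f p = 0})"

text \<open>\<open>\<Gamma>\<close> has the (primitive) Puiseux parametrization \<open>t \<mapsto> (t\<^sup>n, s(t))\<close>.\<close>

definition puiseux_parametrization :: "nat \<Rightarrow> (complex \<Rightarrow> complex) \<Rightarrow> C2 set set \<Rightarrow> bool" where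
  "puiseux_parametrization n s \<Gamma> \<longleftrightarrow>
     0 < n \<and> s 0 = 0 \<and>
     (\<exists>r>0. s holomorphic_on ball 0 r \<and> inj_on (\<lambda>t. (t ^ n, s t)) (ball 0 r) \<and>
            \<Gamma> = set_germ ((\<lambda>t. (t ^ n, s t)) ` ball 0 r))"

definition analytic_class :: "C2 set set \<Rightarrow> C2 set set set" where
  "analytic_class \<Gamma> = orbit Diff image_germ \<Gamma>"

definition Stab :: "C2 set set \<Rightarrow> (C2 \<Rightarrow> C2) set set" where
  "Stab \<Gamma> = stabilizer Diff image_germ \<Gamma>"

subsection \<open>The definitions by description are well-defined\<close>

lemma mem_germ [simp]: "f \<in> germ f"
  by (simp add: germ_def)

lemma mem_set_germ [simp]: "A \<in> set_germ A"
  by (simp add: set_germ_def)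

lemma germ_eq_iff: "germ f = germ g \<longleftrightarrow> (\<forall>\<^sub>F p in nhds 0. f p = g p)"
proof
  assume "germ f = germ g"
  then have "f \<in> germ g" by (metis mem_germ)
  then show "\<forall>\<^sub>F p in nhds 0. f p = g p" by (simp add: germ_def)
next
  assume *: "\<forall>\<^sub>F p in nhds 0. f p = g p"
  have "(\<forall>\<^sub>F p in nhds 0. h p = f p) \<longleftrightarrow> (\<forall>\<^sub>F p in nhds 0. h p = g p)" for h
    by (rule eventually_subst) (use * in \<open>eventually_elim, simp\<close>)
  then show "germ f = germ g"
    by (simp add: germ_def)
qed

lemma set_germ_eq_iff: "set_germ A = set_germ B \<longleftrightarrow> (\<forall>\<^sub>F p in nhds 0. p \<in> A \<longleftrightarrow> p \<in> B)"
proof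
  assume "set_germ A = set_germ B"
  then have "A \<in> set_germ B" by (metis mem_set_germ)
  then show "\<forall>\<^sub>F p in nhds 0. p \<in> A \<longleftrightarrow> p \<in> B" by (simp add: set_germ_def)
next
  assume *: "\<forall>\<^sub>F p in nhds 0. p \<in> A \<longleftrightarrow> p \<in> B"
  have "(\<forall>\<^sub>F p in nhds 0. p \<in> C \<longleftrightarrow> p \<in> A) \<longleftrightarrow> (\<forall>\<^sub>F p in nhds 0. p \<in> C \<longleftrightarrow> p \<in> B)" for C
    by (rule eventually_subst) (use * in \<open>eventually_elim, simp\<close>)
  then show "set_germ A = set_germ B"
    by (simp add: set_germ_def)
qed

lemma holomorphic_map_continuous:
  assumes "holomorphic_map f U"
  shows "continuous_on U f"
proof -
  have "continuous_on U (\<lambda>p. fst (f p))" "continuous_on U (\<lambda>p. snd (f p))"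
    using assms unfolding holomorphic_map_def holomorphic_fun_def
    by (meson continuous_at_imp_continuous_on has_derivative_continuous)+
  from continuous_on_Pair[OF this] show ?thesis by simp
qed

lemma holomorphic_fun_cong_subset:
  assumes "holomorphic_fun f U" "open V" "V \<subseteq> U"
  shows "holomorphic_fun f V"
  using assms unfolding holomorphic_fun_def by blast

lemma holomorphic_map_subset:
  assumes "holomorphic_map f U" "open V" "V \<subseteq> U"
  shows "holomorphic_map f V"
  using assms holomorphic_fun_cong_subset unfolding holomorphic_map_def by blast

lemma holomorphic_fun_comp:
  assumes f: "holomorphic_fun f U" and g: "holomorphic_map g V" and sub: "g ` V \<subseteq> U"
  shows "holomorphic_fun (\<lambda>p. f (g p)) V"
  unfolding holomorphic_fun_def
proof (intro conjI ballI)
  show "open V" using g by (simp add: holomorphic_map_def holomorphic_fun_def)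
  fix p assume p: "p \<in> V"
  obtain a b where 1: "(f has_derivative (\<lambda>(u, v). a * u + b * v)) (at (g p))"
    using f sub p unfolding holomorphic_fun_def by blast
  obtain c d where 2: "((\<lambda>p. fst (g p)) has_derivative (\<lambda>(u, v). c * u + d * v)) (at p)"
    using g p unfolding holomorphic_map_def holomorphic_fun_def by blast
  obtain e h where 3: "((\<lambda>p. snd (g p)) has_derivative (\<lambda>(u, v). e * u + h * v)) (at p)"
    using g p unfolding holomorphic_map_def holomorphic_fun_def by blast
  from has_derivative_Pair[OF 2 3]
  have "(g has_derivative (\<lambda>w. ((\<lambda>(u, v). c * u + d * v) w, (\<lambda>(u, v). e * u + h * v) w))) (at p)"
    by simp
  from has_derivative_compose[OF this 1]
  have "((\<lambda>p. f (g p)) has_derivative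
           (\<lambda>(u, v). (a * c + b * e) * u + (a * d + b * h) * v)) (at p)"
    by (rule has_derivative_eq_rhs) (auto simp: algebra_simps)
  then show "\<exists>a b. ((\<lambda>p. f (g p)) has_derivative (\<lambda>(u, v). a * u + b * v)) (at p)"
    by blast
qed

lemma holomorphic_map_comp:
  assumes "holomorphic_map f U" "holomorphic_map g V" "g ` V \<subseteq> U"
  shows "holomorphic_map (\<lambda>p. f (g p)) V"
  unfolding holomorphic_map_def
proof
  show "holomorphic_fun (\<lambda>p. fst (f (g p))) V"
    by (rule holomorphic_fun_comp[OF _ assms(2,3)]) (use assms(1) in \<open>simp add: holomorphic_map_def\<close>)
  show "holomorphic_fun (\<lambda>p. snd (f (g p))) V"
    by (rule holomorphic_fun_comp[OF _ assms(2,3)]) (use assms(1) in \<open>simp add: holomorphic_map_def\<close>)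
qed

lemma biholomorphicD:
  assumes "biholomorphic_near_0 f U"
  shows "0 \<in> U" "f 0 = 0" "open U" "inj_on f U" "holomorphic_map f U" "open (f ` U)"
    "continuous_on U f"
proof -
  show "0 \<in> U" "f 0 = 0" and h: "holomorphic_map f U"
    using assms by (auto simp: biholomorphic_near_0_def)
  then show "open U" "continuous_on U f"
    using holomorphic_map_continuous by (auto simp: holomorphic_map_def holomorphic_fun_def)
  obtain g where g: "holomorphic_map g (f ` U)" "\<forall>p\<in>U. g (f p) = p"
    using assms by (auto simp: biholomorphic_near_0_def)
  show "inj_on f U" using g(2) by (metis inj_onI)
  show "open (f ` U)" using g(1) by (auto simp: holomorphic_map_def holomorphic_fun_def)
qed

lemma biholomorphic_open_image:
  assumes "biholomorphic_near_0 f U" "open V" "V \<subseteq> U"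
  shows "open (f ` V)"
proof -
  obtain g where g: "holomorphic_map g (f ` U)" "\<forall>p\<in>U. g (f p) = p"
    using assms by (auto simp: biholomorphic_near_0_def)
  have "f ` V = g -` V \<inter> f ` U"
  proof (intro subset_antisym subsetI)
    fix q assume "q \<in> f ` V"
    then show "q \<in> g -` V \<inter> f ` U" using g(2) assms(3) by fastforce
  next
    fix q assume "q \<in> g -` V \<inter> f ` U"
    then obtain p where "p \<in> U" "q = f p" "g q \<in> V" by blast
    then show "q \<in> f ` V" using g(2) by (metis image_eqI)
  qed
  then show ?thesis
    using holomorphic_map_continuous[OF g(1)] biholomorphicD(6)[OF assms(1)] assms(2)
    by (metis continuous_on_open_vimage)
qed

lemma biholomorphic_subset:
  assumes "biholomorphic_near_0 f U" "open V" "0 \<in> V" "V \<subseteq> U"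
  shows "biholomorphic_near_0 f V"
proof -
  obtain g where g: "holomorphic_map g (f ` U)" "\<forall>p\<in>U. g (f p) = p"
    using assms(1) by (auto simp: biholomorphic_near_0_def)
  have "holomorphic_map g (f ` V)"
    by (rule holomorphic_map_subset[OF g(1) biholomorphic_open_image[OF assms(1,2,4)]])
      (rule image_mono[OF assms(4)])
  moreover have "holomorphic_map f V"
    by (rule holomorphic_map_subset[OF biholomorphicD(5)[OF assms(1)] assms(2,4)])
  moreover have "\<forall>p\<in>V. g (f p) = p" using g(2) assms(4) by blast
  ultimately show ?thesis
    using assms(3) biholomorphicD(2)[OF assms(1)] unfolding biholomorphic_near_0_def by blast
qed

lemma biholomorphic_comp:
  assumes f: "biholomorphic_near_0 f U" and g: "biholomorphic_near_0 g V"
  shows "biholomorphic_near_0 (f \<circ> g) (V \<inter> g -` U)"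
proof -
  let ?W = "V \<inter> g -` U"
  have W: "open ?W"
    using biholomorphicD[OF f] biholomorphicD[OF g] by (metis continuous_on_open_vimage inf_commute)
  have gW: "open (g ` ?W)"
    by (rule biholomorphic_open_image[OF g W]) auto
  have fgW: "open ((f \<circ> g) ` ?W)"
    unfolding image_comp[symmetric] by (rule biholomorphic_open_image[OF f gW]) auto
  obtain f' where f': "holomorphic_map f' (f ` U)" "\<forall>p\<in>U. f' (f p) = p"
    using f by (auto simp: biholomorphic_near_0_def)
  obtain g' where g': "holomorphic_map g' (g ` V)" "\<forall>p\<in>V. g' (g p) = p"
    using g by (auto simp: biholomorphic_near_0_def)
  have "holomorphic_map (f \<circ> g) ?W"
    unfolding comp_def
    by (rule holomorphic_map_comp[OF biholomorphicD(5)[OF f] holomorphic_map_subset[OF biholomorphicD(5)[OF g] W]])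
      auto
  moreover have "holomorphic_map (\<lambda>p. g' (f' p)) ((f \<circ> g) ` ?W)"
  proof (rule holomorphic_map_comp[OF g'(1)])
    show "holomorphic_map f' ((f \<circ> g) ` ?W)"
      by (rule holomorphic_map_subset[OF f'(1) fgW]) auto
    show "f' ` (f \<circ> g) ` ?W \<subseteq> g ` V"
    proof
      fix q assume "q \<in> f' ` (f \<circ> g) ` ?W"
      then obtain p where "p \<in> V" "g p \<in> U" "q = f' (f (g p))" by (auto simp del: split_paired_All)
      then show "q \<in> g ` V" using f'(2) by (metis image_eqI)
    qed
  qed
  moreover have "\<forall>p\<in>?W. g' (f' ((f \<circ> g) p)) = p"
    using f'(2) g'(2) by simp
  moreover have "0 \<in> ?W" "(f \<circ> g) 0 = 0"
    using biholomorphicD[OF f] biholomorphicD[OF g] by simp_all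
  ultimately show ?thesis
    unfolding biholomorphic_near_0_def by blast
qed

lemma carrier_Diff: "carrier Diff = {germ f |f. \<exists>U. biholomorphic_near_0 f U}"
  and mult_Diff: "\<phi> \<otimes>\<^bsub>Diff\<^esub> \<psi> = germ_comp \<phi> \<psi>"
  and one_Diff: "\<one>\<^bsub>Diff\<^esub> = germ id"
  by (simp_all add: Diff_def)

lemma germ_in_Diff: "biholomorphic_near_0 f U \<Longrightarrow> germ f \<in> carrier Diff"
  by (auto simp: carrier_Diff)

lemma DiffE:
  assumes "\<phi> \<in> carrier Diff"
  obtains f U where "\<phi> = germ f" "biholomorphic_near_0 f U"
  using assms by (auto simp: carrier_Diff)

lemma biholomorphic_tendsto:
  assumes "biholomorphic_near_0 f U"
  shows "filterlim f (nhds 0) (nhds 0)"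
proof -
  have "isCont f 0"
    using biholomorphicD[OF assms] by (metis continuous_on_eq_continuous_at)
  then show ?thesis
    using biholomorphicD(2)[OF assms] by (metis isCont_def tendsto_at_iff_tendsto_nhds)
qed

lemma germ_comp_eq:
  assumes "biholomorphic_near_0 g V"
  shows "germ_comp (germ f) (germ g) = germ (f \<circ> g)"
  unfolding germ_comp_def
proof (rule the_equality)
  show "\<exists>f'\<in>germ f. \<exists>g'\<in>germ g. germ (f \<circ> g) = germ (f' \<circ> g')"
    by (intro bexI[of _ f] bexI[of _ g]) simp_all
next
  fix \<eta> assume "\<exists>f'\<in>germ f. \<exists>g'\<in>germ g. \<eta> = germ (f' \<circ> g')"
  then obtain f' g' where *: "\<forall>\<^sub>F p in nhds 0. f' p = f p" "\<forall>\<^sub>F p in nhds 0. g' p = g p"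
    "\<eta> = germ (f' \<circ> g')"
    by (auto simp: germ_def)
  have "\<forall>\<^sub>F p in nhds 0. f' (g p) = f (g p)"
    by (rule eventually_compose_filterlim[OF *(1) biholomorphic_tendsto[OF assms]])
  with *(2) have "\<forall>\<^sub>F p in nhds 0. (f' \<circ> g') p = (f \<circ> g) p"
    by eventually_elim simp
  with *(3) show "\<eta> = germ (f \<circ> g)" by (simp add: germ_eq_iff)
qed

lemma image_germ_eq:
  assumes f: "biholomorphic_near_0 f U"
  shows "image_germ (germ f) (set_germ A) = set_germ (f ` (A \<inter> U))"
  unfolding image_germ_def
proof (rule the_equality)
  show "\<exists>f'\<in>germ f. \<exists>A'\<in>set_germ A. \<exists>U'. biholomorphic_near_0 f' U' \<and>
          set_germ (f ` (A \<inter> U)) = set_germ (f' ` (A' \<inter> U'))"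
    by (intro bexI[of _ f] bexI[of _ A] exI[of _ U]) (simp_all add: f)
next
  fix \<Delta> assume "\<exists>f'\<in>germ f. \<exists>A'\<in>set_germ A. \<exists>U'. biholomorphic_near_0 f' U' \<and>
          \<Delta> = set_germ (f' ` (A' \<inter> U'))"
  then obtain f' A' U' where *: "\<forall>\<^sub>F p in nhds 0. f' p = f p"
      "\<forall>\<^sub>F p in nhds 0. p \<in> A' \<longleftrightarrow> p \<in> A" and f': "biholomorphic_near_0 f' U'"
      and \<Delta>: "\<Delta> = set_germ (f' ` (A' \<inter> U'))"
    by (auto simp: germ_def set_germ_def)
  obtain W0 where W0: "open W0" "0 \<in> W0" "\<forall>p\<in>W0. f' p = f p \<and> (p \<in> A' \<longleftrightarrow> p \<in> A)"
    using eventually_conj[OF *] unfolding eventually_nhds by blast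
  define W where "W = W0 \<inter> U \<inter> U'"
  have W: "open W" "0 \<in> W" "W \<subseteq> U" "W \<subseteq> U'"
      "\<And>p. p \<in> W \<Longrightarrow> f' p = f p" "\<And>p. p \<in> W \<Longrightarrow> p \<in> A' \<longleftrightarrow> p \<in> A"
    using W0 biholomorphicD(1,3)[OF f] biholomorphicD(1,3)[OF f'] unfolding W_def by (blast intro: open_Int)+
  have "open (f ` W)" "0 \<in> f ` W"
    using biholomorphic_open_image[OF f W(1,3)] W(2) biholomorphicD(2)[OF f] by (simp, metis image_eqI)
  moreover have "q \<in> f' ` (A' \<inter> U') \<longleftrightarrow> q \<in> f ` (A \<inter> U)" if "q \<in> f ` W" for q
  proof -
    obtain w where w: "w \<in> W" "q = f w" using \<open>q \<in> f ` W\<close> by blast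
    have "q \<in> f ` (A \<inter> U) \<longleftrightarrow> w \<in> A"
    proof
      assume "q \<in> f ` (A \<inter> U)"
      then obtain v where v: "v \<in> A" "v \<in> U" "q = f v" by blast
      have "v = w"
        by (rule inj_onD[OF biholomorphicD(4)[OF f]]) (use v w W(3) in auto)
      then show "w \<in> A" using v(1) by simp
    next
      assume "w \<in> A"
      then show "q \<in> f ` (A \<inter> U)" using w W(3) by blast
    qed
    moreover have "q \<in> f' ` (A' \<inter> U') \<longleftrightarrow> w \<in> A'"
    proof
      assume "q \<in> f' ` (A' \<inter> U')"
      then obtain v where v: "v \<in> A'" "v \<in> U'" "q = f' v" by blast
      have "v = w"
        by (rule inj_onD[OF biholomorphicD(4)[OF f']]) (use v w W(4) W(5)[OF w(1)] in auto)
      then show "w \<in> A'" using v(1) by simp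
    next
      assume "w \<in> A'"
      moreover have "q = f' w" using w(2) W(5)[OF w(1)] by simp
      ultimately show "q \<in> f' ` (A' \<inter> U')" using w(1) W(4) by blast
    qed
    ultimately show ?thesis using W(6)[OF w(1)] by simp
  qed
  ultimately show "\<Delta> = set_germ (f ` (A \<inter> U))"
    unfolding \<Delta> set_germ_eq_iff eventually_nhds by (intro exI[of _ "f ` W"]) simp
qed

lemma biholomorphic_id: "biholomorphic_near_0 id UNIV"
proof -
  have 1: "(fst has_derivative (\<lambda>(u :: complex, v :: complex). 1 * u + 0 * v)) (at p)" for p :: C2
    by (rule has_derivative_eq_rhs[OF has_derivative_fst[OF has_derivative_ident]]) auto
  have 2: "(snd has_derivative (\<lambda>(u :: complex, v :: complex). 0 * u + 1 * v)) (at p)" for p :: C2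
    by (rule has_derivative_eq_rhs[OF has_derivative_snd[OF has_derivative_ident]]) auto
  have "holomorphic_map id UNIV"
    unfolding holomorphic_map_def holomorphic_fun_def id_def using 1 2 by blast
  then show ?thesis unfolding biholomorphic_near_0_def by auto
qed

lemma group_Diff: "group Diff"
proof (rule groupI)
  fix \<phi> \<psi> assume "\<phi> \<in> carrier Diff" "\<psi> \<in> carrier Diff"
  then show "\<phi> \<otimes>\<^bsub>Diff\<^esub> \<psi> \<in> carrier Diff"
    by (elim DiffE) (simp add: mult_Diff germ_comp_eq germ_in_Diff[OF biholomorphic_comp])
next
  show "\<one>\<^bsub>Diff\<^esub> \<in> carrier Diff"
    using germ_in_Diff[OF biholomorphic_id] by (simp add: one_Diff)
next
  fix \<phi>1 \<phi>2 \<phi>3 assume "\<phi>1 \<in> carrier Diff" "\<phi>2 \<in> carrier Diff" "\<phi>3 \<in> carrier Diff"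
  then show "\<phi>1 \<otimes>\<^bsub>Diff\<^esub> \<phi>2 \<otimes>\<^bsub>Diff\<^esub> \<phi>3 = \<phi>1 \<otimes>\<^bsub>Diff\<^esub> (\<phi>2 \<otimes>\<^bsub>Diff\<^esub> \<phi>3)"
    by (elim DiffE) (simp add: mult_Diff germ_comp_eq germ_comp_eq[OF biholomorphic_comp] comp_assoc)
next
  fix \<phi> assume "\<phi> \<in> carrier Diff"
  then show "\<one>\<^bsub>Diff\<^esub> \<otimes>\<^bsub>Diff\<^esub> \<phi> = \<phi>"
    by (elim DiffE) (simp add: mult_Diff one_Diff germ_comp_eq)
next
  fix \<phi> assume "\<phi> \<in> carrier Diff"
  then obtain f U where f: "\<phi> = germ f" "biholomorphic_near_0 f U" by (rule DiffE)
  obtain g where g: "holomorphic_map g (f ` U)" "\<forall>p\<in>U. g (f p) = p"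
    using f(2) by (auto simp: biholomorphic_near_0_def)
  have gfU: "g ` f ` U = U" using g(2) by (simp add: image_image)
  have "biholomorphic_near_0 g (f ` U)"
    unfolding biholomorphic_near_0_def gfU
  proof (intro conjI exI[of _ f] ballI)
    show "0 \<in> f ` U" "g 0 = 0"
      using biholomorphicD(1,2)[OF f(2)] g(2) by (metis image_eqI)+
    show "holomorphic_map g (f ` U)" "holomorphic_map f U"
      using g(1) biholomorphicD(5)[OF f(2)] by blast+
    show "f (g q) = q" if "q \<in> f ` U" for q using that g(2) by force
  qed
  then have "germ g \<in> carrier Diff" by (rule germ_in_Diff)
  moreover have "\<forall>\<^sub>F p in nhds 0. p \<in> U"
    using biholomorphicD[OF f(2)] by (metis eventually_nhds)
  then have "germ (g \<circ> f) = germ id"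
    unfolding germ_eq_iff by eventually_elim (use g(2) in auto)
  ultimately show "\<exists>\<psi>\<in>carrier Diff. \<psi> \<otimes>\<^bsub>Diff\<^esub> \<phi> = \<one>\<^bsub>Diff\<^esub>"
    unfolding mult_Diff one_Diff f(1) 
    by (intro bexI[of _ "germ g"]) (simp_all add: germ_comp_eq[OF f(2)])
qed

lemma image_germ_mult:
  assumes "\<phi> \<in> carrier Diff" "\<psi> \<in> carrier Diff"
  shows "image_germ (\<phi> \<otimes>\<^bsub>Diff\<^esub> \<psi>) (set_germ A) = image_germ \<phi> (image_germ \<psi> (set_germ A))"
proof -
  obtain f U where f: "\<phi> = germ f" "biholomorphic_near_0 f U" using assms(1) by (rule DiffE)
  obtain g V where g: "\<psi> = germ g" "biholomorphic_near_0 g V" using assms(2) by (rule DiffE)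
  have "(f \<circ> g) ` (A \<inter> (V \<inter> g -` U)) = f ` (g ` (A \<inter> V) \<inter> U)" by auto
  then show ?thesis
    unfolding mult_Diff f(1) g(1) germ_comp_eq[OF g(2)]
      image_germ_eq[OF biholomorphic_comp[OF f(2) g(2)]] image_germ_eq[OF f(2)] image_germ_eq[OF g(2)]
    by (rule arg_cong)
qed

lemma image_germ_one: "image_germ \<one>\<^bsub>Diff\<^esub> (set_germ A) = set_germ A"
  using image_germ_eq[OF biholomorphic_id, of A] by (simp add: one_Diff)

subsection \<open>Vector fields and geodesics\<close>

definition singular_vector_field :: "(C2 \<Rightarrow> C2) \<Rightarrow> bool" where
  "singular_vector_field X \<longleftrightarrow> (\<exists>U. 0 \<in> U \<and> holomorphic_map X U) \<and> X 0 = 0"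

text \<open>\<open>\<phi> = exp(X)\<close>: near the origin, \<open>\<phi>\<close> maps \<open>p\<close> to \<open>u(1)\<close>, where \<open>u\<close> is the integral curve of
  \<open>X\<close> with \<open>u(0) = p\<close>. The curves have to stay in a domain \<open>U\<close> where the representative \<open>X\<close> is
  holomorphic, which makes them unique.\<close>

definition is_exp :: "(C2 \<Rightarrow> C2) \<Rightarrow> (C2 \<Rightarrow> C2) set \<Rightarrow> bool" where
  "is_exp X \<phi> \<longleftrightarrow>
     (\<exists>f\<in>\<phi>. \<exists>U. 0 \<in> U \<and> holomorphic_map X U \<and>
        (\<forall>\<^sub>F p in nhds 0. \<exists>u :: real \<Rightarrow> C2. u 0 = p \<and> u 1 = f p \<and>
           (\<forall>s\<in>{0..1}. u s \<in> U \<and> (u has_vector_derivative X (u s)) (at s within {0..1}))))"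

definition connected_by_geodesic :: "C2 set set \<Rightarrow> C2 set set \<Rightarrow> bool" where
  "connected_by_geodesic \<Gamma>\<^sub>1 \<Gamma>\<^sub>2 \<longleftrightarrow>
     (\<exists>X. singular_vector_field X \<and> (\<exists>\<phi>\<in>carrier Diff. is_exp X \<phi> \<and> image_germ \<phi> \<Gamma>\<^sub>1 = \<Gamma>\<^sub>2))"

subsection \<open>The Krull topology\<close>

definition jet :: "nat \<Rightarrow> (C2 \<Rightarrow> complex) \<Rightarrow> nat \<times> nat \<Rightarrow> complex" where
  "jet k f = (\<lambda>(i, j). if i + j \<le> k
     then (deriv ^^ i) (\<lambda>x. (deriv ^^ j) (\<lambda>y. f (x, y)) 0) 0 else 0)"

definition same_jet :: "nat \<Rightarrow> (C2 \<Rightarrow> C2) \<Rightarrow> (C2 \<Rightarrow> C2) \<Rightarrow> bool" where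
  "same_jet k f g \<longleftrightarrow>
     jet k (\<lambda>p. fst (f p)) = jet k (\<lambda>p. fst (g p)) \<and> jet k (\<lambda>p. snd (f p)) = jet k (\<lambda>p. snd (g p))"

definition krull_basic :: "nat \<Rightarrow> (C2 \<Rightarrow> C2) set \<Rightarrow> (C2 \<Rightarrow> C2) set set" where
  "krull_basic k \<phi> = {\<psi> \<in> carrier Diff. \<exists>f\<in>\<phi>. \<exists>g\<in>\<psi>. same_jet k f g}"

definition krull_Diff :: "(C2 \<Rightarrow> C2) set topology" where
  "krull_Diff = topology_generated_by {krull_basic k \<phi> |k \<phi>. \<phi> \<in> carrier Diff}"

definition quotient_topology :: "'a topology \<Rightarrow> ('a \<Rightarrow> 'b) \<Rightarrow> 'b topology" where
  "quotient_topology T q =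
     topology (\<lambda>V. V \<subseteq> q ` topspace T \<and> openin T {x \<in> topspace T. q x \<in> V})"

lemma istopology_quotient:
  "istopology (\<lambda>V. V \<subseteq> q ` topspace T \<and> openin T {x \<in> topspace T. q x \<in> V})"
proof -
  have 1: "{x \<in> topspace T. q x \<in> S \<inter> V} = {x \<in> topspace T. q x \<in> S} \<inter> {x \<in> topspace T. q x \<in> V}"
    for S V by blast
  have 2: "{x \<in> topspace T. q x \<in> \<Union>K} = (\<Union>V\<in>K. {x \<in> topspace T. q x \<in> V})" for K
    by blast
  show ?thesis
    unfolding istopology_def 1 2 by blast
qed

lemma openin_quotient_topology:
  "openin (quotient_topology T q) V \<longleftrightarrow>
     V \<subseteq> q ` topspace T \<and> openin T {x \<in> topspace T. q x \<in> V}"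
  unfolding quotient_topology_def topology_inverse'[OF istopology_quotient] ..

lemma quotient_map_quotient_topology: "quotient_map T (quotient_topology T q) q"
proof -
  have "{x \<in> topspace T. q x \<in> q ` topspace T} = topspace T" by blast
  then have "openin (quotient_topology T q) (q ` topspace T)"
    by (simp add: openin_quotient_topology)
  then have "topspace (quotient_topology T q) = q ` topspace T"
    by (metis openin_quotient_topology openin_subset openin_topspace subset_antisym)
  then show ?thesis
    by (auto simp: quotient_map_def openin_quotient_topology)
qed

lemma topspace_quotient_topology: "topspace (quotient_topology T q) = q ` topspace T"
  using quotient_map_quotient_topology by (metis quotient_imp_surjective_map)

lemma topspace_krull_Diff: "topspace krull_Diff = carrier Diff"
proof -
  have "\<phi> \<in> krull_basic 0 \<phi>" if "\<phi> \<in> carrier Diff" for \<phi>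
  proof -
    obtain f where "\<phi> = germ f" using \<open>\<phi> \<in> carrier Diff\<close> by (rule DiffE)
    then have "f \<in> \<phi>" by simp
    then show ?thesis using that unfolding krull_basic_def same_jet_def by blast
  qed
  moreover have "krull_basic k \<phi> \<subseteq> carrier Diff" for k \<phi>
    unfolding krull_basic_def by blast
  ultimately show ?thesis
    unfolding krull_Diff_def topology_generated_by_topspace by blast
qed

definition krull_cosets :: "C2 set set \<Rightarrow> (C2 \<Rightarrow> C2) set set topology" where
  "krull_cosets \<Gamma> = quotient_topology krull_Diff (\<lambda>\<phi>. \<phi> <#\<^bsub>Diff\<^esub> Stab \<Gamma>)"

text \<open>The identification \<open>\<phi> \<circ> Stab(\<Gamma>) \<mapsto> \<phi>(\<Gamma>)\<close> of left cosets with branches.\<close>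

definition coset_branch :: "C2 set set \<Rightarrow> (C2 \<Rightarrow> C2) set set \<Rightarrow> C2 set set" where
  "coset_branch \<Gamma> c = (THE \<Delta>. \<exists>\<phi>\<in>carrier Diff. c = \<phi> <#\<^bsub>Diff\<^esub> Stab \<Gamma> \<and> \<Delta> = image_germ \<phi> \<Gamma>)"

text \<open>Since \<open>coset_branch \<Gamma>\<close> is injective on cosets, the quotient topology along it is the topology
  of the coset space carried over to the analytic class.\<close>

definition krull_class :: "C2 set set \<Rightarrow> C2 set set topology" where
  "krull_class \<Gamma> = quotient_topology (krull_cosets \<Gamma>) (coset_branch \<Gamma>)"

lemma coset_eq_iff:
  assumes "\<Gamma> = set_germ A" "\<phi> \<in> carrier Diff" "\<psi> \<in> carrier Diff"
  shows "\<phi> <#\<^bsub>Diff\<^esub> Stab \<Gamma> = \<psi> <#\<^bsub>Diff\<^esub> Stab \<Gamma> \<longleftrightarrow> image_germ \<phi> \<Gamma> = image_germ \<psi> \<Gamma>"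
proof -
  interpret group Diff by (rule group_Diff)
  have act: "image_germ (\<alpha> \<otimes>\<^bsub>Diff\<^esub> \<beta>) \<Gamma> = image_germ \<alpha> (image_germ \<beta> \<Gamma>)"
    if "\<alpha> \<in> carrier Diff" "\<beta> \<in> carrier Diff" for \<alpha> \<beta>
    unfolding assms(1) using that by (rule image_germ_mult)
  have stab: "\<sigma> \<in> Stab \<Gamma> \<longleftrightarrow> \<sigma> \<in> carrier Diff \<and> image_germ \<sigma> \<Gamma> = \<Gamma>" for \<sigma>
    by (simp add: Stab_def stabilizer_def)
  have mem: "\<alpha> \<in> \<beta> <#\<^bsub>Diff\<^esub> Stab \<Gamma> \<longleftrightarrow> \<alpha> \<in> carrier Diff \<and> image_germ \<alpha> \<Gamma> = image_germ \<beta> \<Gamma>"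
    if \<beta>: "\<beta> \<in> carrier Diff" for \<alpha> \<beta>
  proof
    assume "\<alpha> \<in> \<beta> <#\<^bsub>Diff\<^esub> Stab \<Gamma>"
    then obtain \<sigma> where "\<sigma> \<in> Stab \<Gamma>" "\<alpha> = \<beta> \<otimes>\<^bsub>Diff\<^esub> \<sigma>" by (auto simp: l_coset_def)
    then show "\<alpha> \<in> carrier Diff \<and> image_germ \<alpha> \<Gamma> = image_germ \<beta> \<Gamma>"
      using \<beta> by (simp add: stab act)
  next
    assume \<alpha>: "\<alpha> \<in> carrier Diff \<and> image_germ \<alpha> \<Gamma> = image_germ \<beta> \<Gamma>"
    let ?\<sigma> = "inv\<^bsub>Diff\<^esub> \<beta> \<otimes>\<^bsub>Diff\<^esub> \<alpha>"
    have "image_germ ?\<sigma> \<Gamma> = image_germ (inv\<^bsub>Diff\<^esub> \<beta> \<otimes>\<^bsub>Diff\<^esub> \<beta>) \<Gamma>"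
      using \<alpha> \<beta> by (simp only: act inv_closed)
    also have "\<dots> = \<Gamma>" using \<beta> by (simp add: assms(1) image_germ_one)
    finally have "?\<sigma> \<in> Stab \<Gamma>" using \<alpha> \<beta> by (simp add: stab)
    moreover have "\<alpha> = \<beta> \<otimes>\<^bsub>Diff\<^esub> ?\<sigma>" using \<alpha> \<beta> by (simp add: m_assoc[symmetric])
    ultimately show "\<alpha> \<in> \<beta> <#\<^bsub>Diff\<^esub> Stab \<Gamma>" by (auto simp: l_coset_def)
  qed
  have cos: "\<beta> <#\<^bsub>Diff\<^esub> Stab \<Gamma> = {\<alpha> \<in> carrier Diff. image_germ \<alpha> \<Gamma> = image_germ \<beta> \<Gamma>}"
    if "\<beta> \<in> carrier Diff" for \<beta>
    by (simp add: set_eq_iff mem[OF that])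
  show ?thesis
  proof
    assume "\<phi> <#\<^bsub>Diff\<^esub> Stab \<Gamma> = \<psi> <#\<^bsub>Diff\<^esub> Stab \<Gamma>"
    then show "image_germ \<phi> \<Gamma> = image_germ \<psi> \<Gamma>"
      using mem[OF assms(2), of \<phi>] mem[OF assms(3), of \<phi>] assms(2) by simp
  next
    assume "image_germ \<phi> \<Gamma> = image_germ \<psi> \<Gamma>"
    then show "\<phi> <#\<^bsub>Diff\<^esub> Stab \<Gamma> = \<psi> <#\<^bsub>Diff\<^esub> Stab \<Gamma>"
      using cos[OF assms(2)] cos[OF assms(3)] by simp
  qed
qed

lemma coset_branch_eq:
  assumes "\<Gamma> = set_germ A" "\<phi> \<in> carrier Diff"
  shows "coset_branch \<Gamma> (\<phi> <#\<^bsub>Diff\<^esub> Stab \<Gamma>) = image_germ \<phi> \<Gamma>"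
  unfolding coset_branch_def
proof (rule the_equality)
  show "\<exists>\<psi>\<in>carrier Diff. \<phi> <#\<^bsub>Diff\<^esub> Stab \<Gamma> = \<psi> <#\<^bsub>Diff\<^esub> Stab \<Gamma> \<and>
          image_germ \<phi> \<Gamma> = image_germ \<psi> \<Gamma>"
    by (rule bexI[OF _ assms(2)]) simp
next
  fix \<Delta>
  assume "\<exists>\<psi>\<in>carrier Diff. \<phi> <#\<^bsub>Diff\<^esub> Stab \<Gamma> = \<psi> <#\<^bsub>Diff\<^esub> Stab \<Gamma> \<and>
          \<Delta> = image_germ \<psi> \<Gamma>"
  then obtain \<psi> where "\<psi> \<in> carrier Diff" "\<Delta> = image_germ \<psi> \<Gamma>"
    "\<phi> <#\<^bsub>Diff\<^esub> Stab \<Gamma> = \<psi> <#\<^bsub>Diff\<^esub> Stab \<Gamma>" by (elim bexE conjE)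
  then show "\<Delta> = image_germ \<phi> \<Gamma>"
    using coset_eq_iff[OF assms(1,2)] by simp
qed

lemma topspace_krull_class:
  assumes "\<Gamma> = set_germ A"
  shows "topspace (krull_class \<Gamma>) = analytic_class \<Gamma>"
proof -
  have "topspace (krull_class \<Gamma>) = (\<lambda>\<phi>. coset_branch \<Gamma> (\<phi> <#\<^bsub>Diff\<^esub> Stab \<Gamma>)) ` carrier Diff"
    by (simp add: krull_class_def krull_cosets_def topspace_quotient_topology topspace_krull_Diff
        image_image)
  also have "\<dots> = (\<lambda>\<phi>. image_germ \<phi> \<Gamma>) ` carrier Diff"
    by (rule image_cong) (simp_all add: coset_branch_eq[OF assms])
  finally show ?thesis by (simp add: analytic_class_def orbit_def Setcompr_eq_image)
qed

end

theory Submission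
  imports Defs
begin

text \<open>
  Let \<open>\<alpha>\<close> be a primitive cube root of unity and \<open>\<beta> = \<alpha>\<^sup>2\<close>, so that both monomials in
  \<open>(\<alpha> x + p y\<^sup>2, \<beta> y + q x\<^sup>2)\<close> are resonant: \<open>\<beta>\<^sup>2 = \<alpha>\<close> and \<open>\<alpha>\<^sup>2 = \<beta>\<close>. A germ with such a 2-jet and
  \<open>p, q \<noteq> 0\<close> is not the exponential of a vector field. The linear part of the field would be diagonal
  with eigenvalues \<open>a, b\<close> satisfying \<open>e\<^sup>a = \<alpha>\<close> and \<open>e\<^sup>b = \<beta>\<close>, and its flow can produce the monomials
  \<open>y\<^sup>2\<close> and \<open>x\<^sup>2\<close> only if \<open>a = 2 b\<close> and \<open>b = 2 a\<close>, whence \<open>a = 0\<close> and \<open>\<alpha> = 1\<close>.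

  On the other hand, the branch \<open>(t\<^sup>6, t\<^sup>7 + t\<^sup>1\<^sup>0 + t\<^sup>1\<^sup>1)\<close> is so rigid that a germ mapping it to itself is
  tangent to the identity and does not involve \<open>y\<^sup>2\<close> in its first, nor \<open>x\<^sup>2\<close> in its second component:
  this is visible from the coefficients up to \<open>t\<^sup>1\<^sup>5\<close>. Hence \<open>\<alpha>, \<beta>, p, q\<close> are determined by the image
  of the branch, and the images under germs with \<open>p, q \<noteq> 0\<close> form an open set, as the
  condition concerns the 2-jet only.
\<close>

subsection \<open>Asymptotic expansions at the origin\<close>

text \<open>Why this branch: write a change of parameter as \<tau> = t w, with L the limit of w. The
  gaps 3 and 4 from t^7 to t^10 and t^11 force L^3 = L^4 = 1, hence L = 1. It then turns out that w
  - 1 = O(t^6). In the second component x^2 sits at t^12 = t^7 t^5, before w - 1 can interfere; in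
  the first component y^2 sits at t^14 = t^6 t^8, where it does interfere and has to be eliminated
  between the two components. Why a cube root of unity: the resonances hold for the multipliers
  \<alpha>, \<beta> but not for their logarithms a, b. After division by e^(a s), the forcing of x
  by y^2 is a multiple of e^((2 b - a) s), and e^(2 b - a) = 1. Unless 2 b = a, it runs through
  whole periods in unit time and integrates to 0. The obstacle is that 2-jets must be read off from
  germs of sets and from integral curves, neither of which comes with an expansion. Both halves
  therefore use estimates in place of power series: \<tau> is only known to be comparable to t, and
  integral curves are followed from h times a fixed point, with errors of order a power of h uniform
  in time.\<close>

lemma power_bigo_at_0: "n \<le> m \<Longrightarrow> (\<lambda>t::complex. t ^ m) \<in> O[at 0](\<lambda>t. t ^ n)"
proof -
  assume "n \<le> m"
  have "eventually (\<lambda>t::complex. norm t < 1) (at 0)"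
    using eventually_at[of "\<lambda>t::complex. norm t < 1" 0 UNIV] by (auto intro!: exI[of _ 1])
  then show ?thesis
    by (intro bigoI[of _ 1])
      (auto elim!: eventually_mono simp: norm_power intro!: power_decreasing[OF \<open>n \<le> m\<close>])
qed

lemma bigo_power_mono:
  "f \<in> O[at 0](\<lambda>t::complex. t ^ m) \<Longrightarrow> n \<le> m \<Longrightarrow> f \<in> O[at 0](\<lambda>t. t ^ n)"
  using landau_o.big_trans power_bigo_at_0 by blast

lemma power_mult_bigo:
  assumes "g \<in> O[at 0](\<lambda>t::complex. t ^ k)" "n \<le> m + k"
  shows "(\<lambda>t. t ^ m * g t) \<in> O[at 0](\<lambda>t. t ^ n)"
proof -
  have "(\<lambda>t. t ^ m * g t) \<in> O[at 0](\<lambda>t. t ^ m * t ^ k)"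
    by (intro landau_o.big.mult) (use assms in auto)
  then show ?thesis
    using bigo_power_mono[OF _ assms(2)] by (simp add: power_add)
qed

text \<open>Equations between coefficients are read off from asymptotic relations in this way. Once
  the constant coefficient is seen to vanish in the limit, one factor t is cancelled and the
  induction applies.\<close>

lemma poly_bigo_imp_coeff_0:
  fixes p :: "complex poly"
  assumes "(\<lambda>t. poly p t) \<in> O[at 0](\<lambda>t. t ^ n)" "k < n"
  shows "coeff p k = 0"
  using assms
proof (induction n arbitrary: p k)
  case 0
  then show ?case by blast
next
  case (Suc n)
  obtain a q where p: "p = pCons a q" by (cases p)
  have "(\<lambda>t::complex. t ^ Suc n) \<in> o[at 0](\<lambda>_. 1)"
    by (intro smalloI_tendsto) (auto intro!: tendsto_eq_intros)
  with Suc.prems(1) have "(\<lambda>t. poly p t) \<in> o[at 0](\<lambda>_. 1)"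
    using landau_o.big_small_trans by blast
  then have "(poly p \<longlongrightarrow> 0) (at 0)"
    using smalloD_tendsto by fastforce
  moreover have "(poly p \<longlongrightarrow> poly p 0) (at 0)"
    using poly_isCont[of 0 p] by (simp add: isCont_def)
  ultimately have "poly p 0 = 0"
    using tendsto_unique trivial_limit_at by blast
  then have a: "a = 0" by (simp add: p)
  have "eventually (\<lambda>t::complex. t \<noteq> 0) (at 0)"
    by (simp add: eventually_at_filter)
  moreover have "(\<lambda>t. t * poly q t) \<in> O[at 0](\<lambda>t. t * t ^ n)"
    using Suc.prems(1) unfolding p a by (simp only: poly_pCons power_Suc add_0)
  ultimately have q: "(\<lambda>t. poly q t) \<in> O[at 0](\<lambda>t. t ^ n)"
    by (subst (asm) landau_o.big.mult_cancel_left) auto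
  show ?case
    unfolding p a using Suc.IH[OF q] Suc.prems(2) by (cases k) simp_all
qed

lemma bigo_poly_imp_coeff_0:
  assumes "f \<in> O[at 0](\<lambda>t::complex. t ^ n)" "\<And>t. f t = poly p t" "k < n"
  shows "coeff p k = 0"
proof -
  have "f = poly p" using assms(2) by blast
  with poly_bigo_imp_coeff_0[of p n k] assms(1,3) show ?thesis by blast
qed

text \<open>First and second order binomial expansions, measured in an arbitrary scale
  \<open>g\<close>. Boundedness of \<open>d\<close> absorbs the factor 1 + d in the induction
  step.\<close>

lemma one_plus_power_bigo:
  assumes "d \<in> O[F](\<lambda>x. g x :: complex)" "d \<in> O[F](\<lambda>_. 1)"
  shows "(\<lambda>x. (1 + d x) ^ n - 1) \<in> O[F](g)"
    and "(\<lambda>x. (1 + d x) ^ n - 1 - of_nat n * d x) \<in> O[F](\<lambda>x. g x * g x)"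
proof -
  have *: "(\<lambda>x. 1 + d x) \<in> O[F](\<lambda>_. 1)"
    using assms(2) by (intro sum_in_bigo) auto
  show 1: "(\<lambda>x. (1 + d x) ^ n - 1) \<in> O[F](g)" for n
  proof (induction n)
    case (Suc n)
    have "(\<lambda>x. ((1 + d x) ^ n - 1) * (1 + d x) + d x) \<in> O[F](g)"
      using landau_o.big.mult[OF Suc *] assms(1) by (intro sum_in_bigo) auto
    then show ?case by (simp add: algebra_simps)
  qed simp
  show "(\<lambda>x. (1 + d x) ^ n - 1 - of_nat n * d x) \<in> O[F](\<lambda>x. g x * g x)"
  proof (induction n)
    case (Suc n)
    have "(\<lambda>x. ((1 + d x) ^ n - 1 - of_nat n * d x) * (1 + d x) + of_nat n * (d x * d x)) \<in> O[F](\<lambda>x. g x * g x)"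
      using landau_o.big.mult[OF Suc *] landau_o.big.mult[OF assms(1,1)]
      by (intro sum_in_bigo) auto
    then show ?case by (simp add: algebra_simps)
  qed simp
qed

text \<open>In (1 + d)^n - 1 = d (1 + (1 + d) + ... + (1 + d)^(n-1)) the second factor tends to n,
  which is nonzero, so it can be divided out.\<close>

lemma one_plus_power_bigoD:
  assumes "(d \<longlongrightarrow> (0::complex)) F" "0 < n" "(\<lambda>x. (1 + d x) ^ n - 1) \<in> O[F](g)"
  shows "d \<in> O[F](g)"
proof -
  define S where "S x = (\<Sum>k<n. (1 + d x) ^ k)" for x
  have lim: "(S \<longlongrightarrow> (\<Sum>k<n. (1 + 0) ^ k)) F"
    unfolding S_def by (intro tendsto_intros assms)
  have "((\<lambda>x. inverse (S x)) \<longlongrightarrow> inverse (\<Sum>k<n. (1 + 0) ^ k)) F"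
    by (rule tendsto_inverse[OF lim]) (use assms(2) in simp)
  then have "(\<lambda>x. inverse (S x)) \<in> O[F](\<lambda>_. 1)"
    by (intro bigoI_tendsto) auto
  from landau_o.big.mult[OF assms(3) this]
  have *: "(\<lambda>x. ((1 + d x) ^ n - 1) * inverse (S x)) \<in> O[F](g)" by simp
 have "eventually (\<lambda>x. S x \<noteq> 0) F"
    by (rule tendsto_imp_eventually_ne[OF lim]) (use assms(2) in simp)
  then have "eventually (\<lambda>x. ((1 + d x) ^ n - 1) * inverse (S x) = d x) F"
    by eventually_elim (simp add: power_diff_1_eq S_def)
  from landau_o.big.in_cong[OF this] * show ?thesis by blast
qed

text \<open>Splits a goal into a known relation \<open>f\<close> and a tail \<open>r\<close> that is
  visibly of the right order, and leaves one polynomial identity to the simplifier.\<close>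

lemma bigo_cong_diff:
  assumes "f \<in> O[F](g)" "r \<in> O[F](g)" "\<And>t. h t = f t - (r t :: complex)"
  shows "h \<in> O[F](g)"
proof -
  have "h = (\<lambda>t. f t - r t)" using assms(3) by blast
  with sum_in_bigo(2)[OF assms(1,2)] show ?thesis by (simp only:)
qed

lemma bigo_1_intros:
  fixes f g :: "complex \<Rightarrow> complex"
  shows "(\<lambda>_. c) \<in> O[at 0](\<lambda>_::complex. 1 :: complex)"
    and "(\<lambda>t. t) \<in> O[at 0](\<lambda>_::complex. 1 :: complex)"
    and "f \<in> O[at 0](\<lambda>_. 1) \<Longrightarrow> g \<in> O[at 0](\<lambda>_. 1) \<Longrightarrow> (\<lambda>t. f t + g t) \<in> O[at 0](\<lambda>_. 1)"
    and "f \<in> O[at 0](\<lambda>_. 1) \<Longrightarrow> g \<in> O[at 0](\<lambda>_. 1) \<Longrightarrow> (\<lambda>t. f t - g t) \<in> O[at 0](\<lambda>_. 1)"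
    and "f \<in> O[at 0](\<lambda>_. 1) \<Longrightarrow> g \<in> O[at 0](\<lambda>_. 1) \<Longrightarrow> (\<lambda>t. f t * g t) \<in> O[at 0](\<lambda>_. 1)"
    and "f \<in> O[at 0](\<lambda>_. 1) \<Longrightarrow> (\<lambda>t. f t ^ n) \<in> O[at 0](\<lambda>_. 1)"
proof -
  show "(\<lambda>_. c) \<in> O[at 0](\<lambda>_::complex. 1 :: complex)" by simp
  show "(\<lambda>t. t) \<in> O[at 0](\<lambda>_::complex. 1 :: complex)"
    using power_bigo_at_0[of 0 1] by simp
next
  assume "f \<in> O[at 0](\<lambda>_. 1)" "g \<in> O[at 0](\<lambda>_. 1)"
  then show "(\<lambda>t. f t + g t) \<in> O[at 0](\<lambda>_. 1)" "(\<lambda>t. f t - g t) \<in> O[at 0](\<lambda>_. 1)"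
    by (rule sum_in_bigo)+
next
  assume "f \<in> O[at 0](\<lambda>_. 1)" "g \<in> O[at 0](\<lambda>_. 1)"
  from landau_o.big.mult[OF this] show "(\<lambda>t. f t * g t) \<in> O[at 0](\<lambda>_. 1)" by simp
next
  assume "f \<in> O[at 0](\<lambda>_. 1)"
  from landau_o.big_power[OF this, of n] show "(\<lambda>t. f t ^ n) \<in> O[at 0](\<lambda>_. 1)"
    by (simp only: power_one)
qed

lemma bigo_power_times_bounded:
  assumes "g \<in> O[at 0](\<lambda>_::complex. 1)" "n \<le> m"
  shows "(\<lambda>t. t ^ m * g t) \<in> O[at 0](\<lambda>t. t ^ n)"
  by (rule power_mult_bigo[where k = 0]) (use assms in \<open>simp_all only: power_0 add_0_right\<close>)

lemma bigo_power_tendsto_0: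
  assumes "f \<in> O[at 0](\<lambda>t::complex. t ^ n)" "0 < n"
  shows "(f \<longlongrightarrow> (0::complex)) (at 0)"
proof -
  have "(\<lambda>t::complex. t ^ n) \<in> o[at 0](\<lambda>_. 1)"
    using assms(2) by (intro smalloI_tendsto) (auto intro!: tendsto_eq_intros)
  with assms(1) have "f \<in> o[at 0](\<lambda>_. 1)"
    by (rule landau_o.big_small_trans)
  from smalloD_tendsto[OF this] show ?thesis by simp
qed

lemma bigo_cmult_cancel:
  assumes "(\<lambda>t. c * f t) \<in> O[F](g)" "c \<noteq> (0::complex)"
  shows "f \<in> O[F](g)"
  using assms(1) unfolding landau_o.big.cmult_in_iff[OF assms(2)] .

subsection \<open>Rigidity of the branch\<close>

text \<open>Here \<open>w = \<tau> / t\<close>; the two assumptions are the components of \<open>f (curve \<tau>) = g (curve t)\<close>, divided by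
  \<open>t\<^sup>6\<close>.\<close>

lemma rescaled_curve_coefficients:
  fixes w :: "complex \<Rightarrow> complex"
  assumes nz: "\<alpha> \<noteq> 0" "\<beta> \<noteq> 0"
    and w: "w \<in> O[at 0](\<lambda>_. 1)" and v: "(\<lambda>_. 1) \<in> O[at 0](w)"
    and e1: "(\<lambda>t. \<alpha> * w t ^ 6 + f20 * t ^ 6 * w t ^ 12 + f11 * t ^ 7 * w t ^ 13 + f02 * t ^ 8 * w t ^ 14
        - (A10 + A01 * (t + t ^ 4 + t ^ 5) + A20 * t ^ 6 + A11 * t ^ 7 + A02 * t ^ 8)) \<in> O[at 0](\<lambda>t. t ^ 9)"
    and e2: "(\<lambda>t. t * (\<beta> * (w t ^ 7 + t ^ 3 * w t ^ 10 + t ^ 4 * w t ^ 11)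
          + g20 * t ^ 5 * w t ^ 12 + g11 * t ^ 6 * w t ^ 13 + g02 * t ^ 7 * w t ^ 14)
        - (B10 + t * (B01 * (1 + t ^ 3 + t ^ 4) + B20 * t ^ 5 + B11 * t ^ 6 + B02 * t ^ 7)))
        \<in> O[at 0](\<lambda>t. t ^ 10)"
  shows "A10 = \<alpha>" "A01 = 0" "A02 = f02" "B10 = 0" "B01 = \<beta>" "B20 = g20"
proof -
  note bd = bigo_1_intros w
  have "(\<lambda>t. B10) \<in> O[at 0](\<lambda>t. t ^ 1)"
  proof (rule bigo_cong_diff)
    show "(\<lambda>t. t ^ 1 * (\<beta> * (w t ^ 7 + t ^ 3 * w t ^ 10 + t ^ 4 * w t ^ 11)
          + g20 * t ^ 5 * w t ^ 12 + g11 * t ^ 6 * w t ^ 13 + g02 * t ^ 7 * w t ^ 14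
          - (B01 * (1 + t ^ 3 + t ^ 4) + B20 * t ^ 5 + B11 * t ^ 6 + B02 * t ^ 7))) \<in> O[at 0](\<lambda>t. t ^ 1)"
      by (rule bigo_power_times_bounded) (intro bd order.refl)+
    show "\<And>t. B10 = (t ^ 1 * (\<beta> * (w t ^ 7 + t ^ 3 * w t ^ 10 + t ^ 4 * w t ^ 11)
          + g20 * t ^ 5 * w t ^ 12 + g11 * t ^ 6 * w t ^ 13 + g02 * t ^ 7 * w t ^ 14
          - (B01 * (1 + t ^ 3 + t ^ 4) + B20 * t ^ 5 + B11 * t ^ 6 + B02 * t ^ 7)))
       - (t * (\<beta> * (w t ^ 7 + t ^ 3 * w t ^ 10 + t ^ 4 * w t ^ 11)
          + g20 * t ^ 5 * w t ^ 12 + g11 * t ^ 6 * w t ^ 13 + g02 * t ^ 7 * w t ^ 14)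
        - (B10 + t * (B01 * (1 + t ^ 3 + t ^ 4) + B20 * t ^ 5 + B11 * t ^ 6 + B02 * t ^ 7)))"
      by (simp add: algebra_simps)
  qed (rule bigo_power_mono[OF e2], simp)
  from bigo_poly_imp_coeff_0[OF this, of "[:B10:]" 0] show B10: "B10 = 0" by simp

  let ?e1 = "\<lambda>t. \<alpha> * w t ^ 6 + f20 * t ^ 6 * w t ^ 12 + f11 * t ^ 7 * w t ^ 13 + f02 * t ^ 8 * w t ^ 14
        - (A10 + A01 * (t + t ^ 4 + t ^ 5) + A20 * t ^ 6 + A11 * t ^ 7 + A02 * t ^ 8)"
  let ?e2 = "\<lambda>t. \<beta> * (w t ^ 7 + t ^ 3 * w t ^ 10 + t ^ 4 * w t ^ 11)
          + g20 * t ^ 5 * w t ^ 12 + g11 * t ^ 6 * w t ^ 13 + g02 * t ^ 7 * w t ^ 14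
        - (B01 * (1 + t ^ 3 + t ^ 4) + B20 * t ^ 5 + B11 * t ^ 6 + B02 * t ^ 7)"
  \<comment> \<open>With \<open>B10 = 0\<close> the second relation is divisible by t, which brings
    both relations to the precision t^9.\<close>
  have "(\<lambda>t. t * ?e2 t) \<in> O[at 0](\<lambda>t. t * t ^ 9)"
  proof -
    have "(\<lambda>t. t * ?e2 t) \<in> O[at 0](\<lambda>t. t ^ 10)"
      by (rule bigo_cong_diff[OF e2, of "\<lambda>_. 0"]) (simp_all add: B10 algebra_simps)
    then show ?thesis by (simp only: flip: power_Suc) (simp only: numeral_eq_Suc pred_numeral_simps BitM.simps)
  qed
  moreover have "eventually (\<lambda>t::complex. t \<noteq> 0) (at 0)"
    by (simp add: eventually_at_filter)
  ultimately have e2': "?e2 \<in> O[at 0](\<lambda>t. t ^ 9)"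
    by (subst (asm) landau_o.big.mult_cancel_left) (rule bigthetaI_cong, simp, assumption+)

  have w6: "(\<lambda>t. \<alpha> * w t ^ 6 - A10) \<in> O[at 0](\<lambda>t. t ^ 1)"
  proof (rule bigo_cong_diff)
    show "?e1 \<in> O[at 0](\<lambda>t. t ^ 1)" by (rule bigo_power_mono[OF e1]) simp
    show "(\<lambda>t. t ^ 1 * (f20 * t ^ 5 * w t ^ 12 + f11 * t ^ 6 * w t ^ 13 + f02 * t ^ 7 * w t ^ 14
        - (A01 * (1 + t ^ 3 + t ^ 4) + A20 * t ^ 5 + A11 * t ^ 6 + A02 * t ^ 7))) \<in> O[at 0](\<lambda>t. t ^ 1)"
      by (rule bigo_power_times_bounded) (intro bd order.refl)+
  qed (simp add: algebra_simps power_numeral_reduce)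
  have w7: "(\<lambda>t. \<beta> * w t ^ 7 - B01) \<in> O[at 0](\<lambda>t. t ^ 1)"
  proof (rule bigo_cong_diff)
    show "?e2 \<in> O[at 0](\<lambda>t. t ^ 1)" by (rule bigo_power_mono[OF e2']) simp
    show "(\<lambda>t. t ^ 1 * (\<beta> * (t ^ 2 * w t ^ 10 + t ^ 3 * w t ^ 11) + g20 * t ^ 4 * w t ^ 12 + g11 * t ^ 5 * w t ^ 13 + g02 * t ^ 6 * w t ^ 14
        - (B01 * (t ^ 2 + t ^ 3) + B20 * t ^ 4 + B11 * t ^ 5 + B02 * t ^ 6))) \<in> O[at 0](\<lambda>t. t ^ 1)"
      by (rule bigo_power_times_bounded) (intro bd order.refl)+
  qed (simp add: algebra_simps power_numeral_reduce)
  \<comment> \<open>The lower bound \<open>v\<close> keeps powers of w away from 0, so their limits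
    are nonzero.\<close>
  have nzw: "c \<noteq> 0" if "(\<lambda>t. a * w t ^ n - c) \<in> O[at 0](\<lambda>t. t ^ 1)" "a \<noteq> 0" for a c n
  proof
    assume "c = 0"
    with that(1) have "(\<lambda>t. a * w t ^ n) \<in> O[at 0](\<lambda>t. t ^ 1)"
      by (simp only: diff_0_right)
    then have "(\<lambda>t. w t ^ n) \<in> O[at 0](\<lambda>t. t ^ 1)"
      by (rule bigo_cmult_cancel[OF _ that(2)])
    moreover have "(\<lambda>_. 1) \<in> O[at 0](\<lambda>t. w t ^ n)"
      using landau_o.big_power[OF v, of n] by (simp only: power_one)
    ultimately have "(\<lambda>_. 1) \<in> O[at 0](\<lambda>t::complex. t ^ 1)"
      using landau_o.big_trans by blast
    from bigo_poly_imp_coeff_0[OF this, of "[:1:]" 0] show False by simp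
  qed
  have A10: "A10 \<noteq> 0" and B01: "B01 \<noteq> 0"
    using nzw[OF w6] nzw[OF w7] nz by blast+
  \<comment> \<open>The limit of w has to be that of w^7 / w^6. Taking this quotient avoids the
    choice of a sixth root, which w need not follow continuously.\<close>
  define L where "L = \<alpha> * B01 / (\<beta> * A10)"
  have L: "L \<noteq> 0" using A10 B01 nz by (simp add: L_def)
  define d where "d t = w t / L - 1" for t
  have wd: "w t = L * (1 + d t)" for t using L by (simp add: d_def)
  \<comment> \<open>In the difference of \<alpha> times the relation for w^7 and \<beta> w times
    that for w^6 the power w^7 cancels; the result is linear in w.\<close>
  have d1: "d \<in> O[at 0](\<lambda>t. t ^ 1)"
  proof (rule bigo_cmult_cancel)
    show "(\<lambda>t. \<beta> * A10 * L * d t) \<in> O[at 0](\<lambda>t. t ^ 1)"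
    proof (rule bigo_cong_diff)
      show "(\<lambda>t. \<alpha> * (\<beta> * w t ^ 7 - B01)) \<in> O[at 0](\<lambda>t. t ^ 1)"
        using landau_o.big.mult[OF bigo_1_intros(1) w7, of \<alpha>] by (simp only: mult_1)
      show "(\<lambda>t. \<beta> * w t * (\<alpha> * w t ^ 6 - A10)) \<in> O[at 0](\<lambda>t. t ^ 1)"
        using landau_o.big.mult[OF bigo_1_intros(5)[OF bigo_1_intros(1) w] w6, of \<beta>] by (simp only: mult_1)
      show "\<beta> * A10 * L * d t = \<alpha> * (\<beta> * w t ^ 7 - B01) - \<beta> * w t * (\<alpha> * w t ^ 6 - A10)" for t
        using nz A10 L by (simp add: d_def field_simps power_numeral_reduce) (simp add: L_def)
    qed
  qed (use nz A10 L in simp)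
  have dlim: "(d \<longlongrightarrow> 0) (at 0)" by (rule bigo_power_tendsto_0[OF d1]) simp
  have lim: "c = a * L ^ n" if "(\<lambda>t. a * w t ^ n - c) \<in> O[at 0](\<lambda>t. t ^ 1)" for a c n
  proof -
    have "((\<lambda>t. a * w t ^ n - c) \<longlongrightarrow> a * (L * (1 + 0)) ^ n - c) (at 0)"
      unfolding wd by (intro tendsto_intros dlim)
    moreover have "((\<lambda>t. a * w t ^ n - c) \<longlongrightarrow> 0) (at 0)"
      by (rule bigo_power_tendsto_0[OF that]) simp
    ultimately have "a * (L * (1 + 0)) ^ n - c = 0"
      using tendsto_unique trivial_limit_at by blast
    then show ?thesis by simp
  qed
  have A10L: "A10 = \<alpha> * L ^ 6" and B01L: "B01 = \<beta> * L ^ 7" using lim[OF w6] lim[OF w7] by blast+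

  have pw: "(\<lambda>t. w t ^ n - L ^ n) \<in> O[at 0](\<lambda>t. t ^ k)" if "d \<in> O[at 0](\<lambda>t. t ^ k)" for n k
  proof -
    have "d \<in> O[at 0](\<lambda>_. 1)" using bigo_power_mono[OF d1, of 0] by (simp only: power_0)
    from landau_o.big.mult[OF bigo_1_intros(1) one_plus_power_bigo(1)[OF that this, of n], of "L ^ n"]
    have "(\<lambda>t. L ^ n * ((1 + d t) ^ n - 1)) \<in> O[at 0](\<lambda>t. t ^ k)" by (simp only: mult_1)
    moreover have "L ^ n * ((1 + d t) ^ n - 1) = w t ^ n - L ^ n" for t
      by (simp only: wd power_mult_distrib right_diff_distrib mult_1_right mult.assoc)
    ultimately show ?thesis by (simp only:)
  qed
  have pwD: "d \<in> O[at 0](\<lambda>t. t ^ k)" if "(\<lambda>t. c * w t ^ n - c * L ^ n) \<in> O[at 0](\<lambda>t. t ^ k)" "0 < n" "c \<noteq> 0" for c n k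
  proof (rule one_plus_power_bigoD[OF dlim that(2)], rule bigo_cmult_cancel)
    show "c * L ^ n \<noteq> 0" using L that(3) by simp
    have "c * L ^ n * ((1 + d t) ^ n - 1) = c * w t ^ n - c * L ^ n" for t
      by (simp only: wd power_mult_distrib right_diff_distrib mult_1_right mult.assoc)
    with that(1) show "(\<lambda>t. c * L ^ n * ((1 + d t) ^ n - 1)) \<in> O[at 0](\<lambda>t. t ^ k)" by (simp only:)
  qed

  \<comment> \<open>The order of d is raised in stages. The second component has a gap from t^7 to
    t^10, so d = O(t^3). This exposes the term \<open>A01 * t\<close> of the first relation, which
    must vanish, and then the first relation yields d = O(t^6).\<close>
  have "d \<in> O[at 0](\<lambda>t. t ^ 3)"
  proof (rule pwD[where c = \<beta> and n = 7], rule bigo_cong_diff)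
    show "?e2 \<in> O[at 0](\<lambda>t. t ^ 3)" by (rule bigo_power_mono[OF e2']) simp
    show "(\<lambda>t. t ^ 3 * (\<beta> * (w t ^ 10 + t * w t ^ 11) + g20 * t ^ 2 * w t ^ 12 + g11 * t ^ 3 * w t ^ 13 + g02 * t ^ 4 * w t ^ 14
        - (B01 * (1 + t) + B20 * t ^ 2 + B11 * t ^ 3 + B02 * t ^ 4))) \<in> O[at 0](\<lambda>t. t ^ 3)"
      by (rule bigo_power_times_bounded) (intro bd order.refl)+
  qed (use nz in \<open>simp_all add: B01L algebra_simps power_numeral_reduce\<close>)
  have "(\<lambda>t. A01 * t) \<in> O[at 0](\<lambda>t. t ^ 3)"
  proof (rule bigo_cong_diff)
    show "(\<lambda>t. \<alpha> * (w t ^ 6 - L ^ 6)) \<in> O[at 0](\<lambda>t. t ^ 3)"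
      using landau_o.big.mult[OF bigo_1_intros(1) pw[OF \<open>d \<in> O[at 0](\<lambda>t. t ^ 3)\<close>], of \<alpha>] by (simp only: mult_1)
    show "(\<lambda>t. ?e1 t - t ^ 3 * (f20 * t ^ 3 * w t ^ 12 + f11 * t ^ 4 * w t ^ 13 + f02 * t ^ 5 * w t ^ 14
        - (A01 * (t + t ^ 2) + A20 * t ^ 3 + A11 * t ^ 4 + A02 * t ^ 5))) \<in> O[at 0](\<lambda>t. t ^ 3)"
      by (rule sum_in_bigo(2)[OF bigo_power_mono[OF e1]], simp, rule bigo_power_times_bounded)
        (intro bd order.refl)+
  qed (simp add: A10L algebra_simps power_numeral_reduce)
  from bigo_poly_imp_coeff_0[OF this, of "[:0, A01:]" 1] show A01: "A01 = 0" by simp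
  have d6: "d \<in> O[at 0](\<lambda>t. t ^ 6)"
  proof (rule pwD[where c = \<alpha> and n = 6], rule bigo_cong_diff)
    show "?e1 \<in> O[at 0](\<lambda>t. t ^ 6)" by (rule bigo_power_mono[OF e1]) simp
    show "(\<lambda>t. t ^ 6 * (f20 * w t ^ 12 + f11 * t * w t ^ 13 + f02 * t ^ 2 * w t ^ 14
        - (A20 + A11 * t + A02 * t ^ 2))) \<in> O[at 0](\<lambda>t. t ^ 6)"
      by (rule bigo_power_times_bounded) (intro bd order.refl)+
  qed (use nz in \<open>simp_all add: A10L A01 algebra_simps power_numeral_reduce\<close>)
  have p6: "(\<lambda>t. g t * (w t ^ n - L ^ n)) \<in> O[at 0](\<lambda>t. t ^ 6)" if "g \<in> O[at 0](\<lambda>_. 1)" for g n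
    using landau_o.big.mult[OF that pw[OF d6]] by (simp only: mult_1)
  \<comment> \<open>Since d = O(t^6), powers of w are constants up to t^5. Coefficients 3 and 4 come
    from the gaps of the branch and determine L; coefficient 5 is that of x^2.\<close>
  define c where "c = [:\<beta> * L ^ 7 - B01, 0, 0, \<beta> * L ^ 10 - B01, \<beta> * L ^ 11 - B01, g20 * L ^ 12 - B20:]"
  have "poly c \<in> O[at 0](\<lambda>t. t ^ 6)"
  proof (rule bigo_cong_diff)
    show "?e2 \<in> O[at 0](\<lambda>t. t ^ 6)" by (rule bigo_power_mono[OF e2']) simp
    show "(\<lambda>t. \<beta> * (w t ^ 7 - L ^ 7) + \<beta> * t ^ 3 * (w t ^ 10 - L ^ 10) + \<beta> * t ^ 4 * (w t ^ 11 - L ^ 11)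
       + g20 * t ^ 5 * (w t ^ 12 - L ^ 12) + t ^ 6 * (g11 * w t ^ 13 + g02 * t * w t ^ 14
        - (B11 + B02 * t))) \<in> O[at 0](\<lambda>t. t ^ 6)"
      by (intro sum_in_bigo p6 bigo_power_times_bounded bd order.refl)
  qed (simp add: c_def algebra_simps power_numeral_reduce)
  then have c: "coeff c k = 0" if "k < 6" for k
    using poly_bigo_imp_coeff_0 that by blast
  have "\<beta> * L ^ 10 = \<beta> * L ^ 7" "\<beta> * L ^ 11 = \<beta> * L ^ 7" "g20 * L ^ 12 = B20"
    using c[of 0] c[of 3] c[of 4] c[of 5] by (simp_all add: c_def numeral_eq_Suc)
  then have "L ^ 10 = L ^ 7" "L ^ 11 = L ^ 10"
    using nz by simp_all
  then have "L ^ 10 * (L - 1) = 0" by (simp add: algebra_simps power_numeral_reduce)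
  then have L1: "L = 1" using L by simp
  show "A10 = \<alpha>" "B01 = \<beta>" "B20 = g20"
    using A10L B01L \<open>g20 * L ^ 12 = B20\<close> by (simp_all add: L1)

  have lin: "(\<lambda>t. w t ^ n - 1 - of_nat n * d t) \<in> O[at 0](\<lambda>t. t ^ 9)" for n
  proof -
    have "d \<in> O[at 0](\<lambda>_. 1)" using bigo_power_mono[OF d1, of 0] by (simp only: power_0)
    from one_plus_power_bigo(2)[OF d6 this, of n]
    have "(\<lambda>t. w t ^ n - 1 - of_nat n * d t) \<in> O[at 0](\<lambda>t. t ^ 12)"
      by (simp only: wd L1 mult_1 flip: power_add) simp
    then show ?thesis by (rule bigo_power_mono) simp
  qed
  \<comment> \<open>Here 3 + 6 = 9: a term with a factor t^3 feels d only beyond the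
    precision.\<close>
  have p9: "(\<lambda>t. c * t ^ k * (w t ^ n - 1)) \<in> O[at 0](\<lambda>t. t ^ 9)" if "3 \<le> k" for c k n
  proof -
    have "(\<lambda>t. t ^ k * (c * (w t ^ n - L ^ n))) \<in> O[at 0](\<lambda>t. t ^ 9)"
      by (rule power_mult_bigo[OF p6[OF bigo_1_intros(1)]]) (use that in simp)
    then show ?thesis by (simp only: L1 power_one mult_ac)
  qed
  have q9: "(\<lambda>t. c * (w t ^ n - 1 - of_nat n * d t)) \<in> O[at 0](\<lambda>t. t ^ 9)" for c n
    using landau_o.big.mult[OF bigo_1_intros(1) lin, of c] by (simp only: mult_1)
  \<comment> \<open>The combination \<open>7 \<beta> e1 - 6 \<alpha> e2\<close> eliminates \<open>d\<close>, which is still unknown in degree \<open>8\<close>.\<close>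
  define e where "e = [:0, 0, 0, 0, 0, 0, 7 * \<beta> * (f20 - A20) - 6 * \<alpha> * (g11 - B11),
      7 * \<beta> * (f11 - A11) - 6 * \<alpha> * (g02 - B02), 7 * \<beta> * (f02 - A02):]"
  have "poly e \<in> O[at 0](\<lambda>t. t ^ 9)"
  proof (rule bigo_cong_diff)
    show "(\<lambda>t. 7 * \<beta> * ?e1 t - 6 * \<alpha> * ?e2 t) \<in> O[at 0](\<lambda>t. t ^ 9)"
      using landau_o.big.mult[OF bigo_1_intros(1) e1, of "7 * \<beta>"] landau_o.big.mult[OF bigo_1_intros(1) e2', of "6 * \<alpha>"]
      unfolding mult_1 by (rule sum_in_bigo)
    show "(\<lambda>t. 7 * \<beta> * \<alpha> * (w t ^ 6 - 1 - of_nat 6 * d t) + 7 * \<beta> * f20 * t ^ 6 * (w t ^ 12 - 1)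
        + 7 * \<beta> * f11 * t ^ 7 * (w t ^ 13 - 1) + 7 * \<beta> * f02 * t ^ 8 * (w t ^ 14 - 1)
        - (6 * \<alpha> * \<beta> * (w t ^ 7 - 1 - of_nat 7 * d t) + 6 * \<alpha> * \<beta> * t ^ 3 * (w t ^ 10 - 1)
         + 6 * \<alpha> * \<beta> * t ^ 4 * (w t ^ 11 - 1) + 6 * \<alpha> * g20 * t ^ 5 * (w t ^ 12 - 1)
         + 6 * \<alpha> * g11 * t ^ 6 * (w t ^ 13 - 1) + 6 * \<alpha> * g02 * t ^ 7 * (w t ^ 14 - 1)))
        \<in> O[at 0](\<lambda>t. t ^ 9)"
      by (intro sum_in_bigo p9 q9) simp_all
  qed (simp add: e_def A01 A10L B01L L1 \<open>B20 = g20\<close> algebra_simps power_numeral_reduce)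
  then have "coeff e 8 = 0" by (rule poly_bigo_imp_coeff_0) simp
  then show "A02 = f02" using nz by (simp add: e_def numeral_eq_Suc)
qed

subsection \<open>2-jets\<close>

text \<open>The coefficients are Taylor coefficients, whereas the values of \<open>jet\<close> are
  derivatives; the two differ by factorials.\<close>

definition quad_poly :: "(nat \<times> nat \<Rightarrow> complex) \<Rightarrow> C2 \<Rightarrow> complex" where
  "quad_poly c p = c (0, 0) + c (1, 0) * fst p + c (0, 1) * snd p
     + c (2, 0) * fst p ^ 2 + c (1, 1) * fst p * snd p + c (0, 2) * snd p ^ 2"

text \<open>An estimate instead of derivatives passes easily to other representatives of a germ and
  can be evaluated along curves. The filter \<open>nhds 0\<close> includes the origin itself, so the
  constant coefficient is the exact value there.\<close>

definition has_2jet :: "(C2 \<Rightarrow> complex) \<Rightarrow> (nat \<times> nat \<Rightarrow> complex) \<Rightarrow> bool" where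
  "has_2jet f c \<longleftrightarrow> (\<exists>K. \<forall>\<^sub>F p in nhds 0. norm (f p - quad_poly c p) \<le> K * norm p ^ 3)"

lemma has_2jet_cong:
  assumes "\<forall>\<^sub>F p in nhds 0. f p = g p" "has_2jet f c"
  shows "has_2jet g c"
proof -
  obtain K where "\<forall>\<^sub>F p in nhds 0. norm (f p - quad_poly c p) \<le> K * norm p ^ 3"
    using assms(2) by (auto simp: has_2jet_def)
  with assms(1) have "\<forall>\<^sub>F p in nhds 0. norm (g p - quad_poly c p) \<le> K * norm p ^ 3"
    by eventually_elim simp
  then show ?thesis by (auto simp: has_2jet_def)
qed

lemma has_2jet_at_0:
  assumes "has_2jet f c"
  shows "f 0 = c (0, 0)"
proof -
  obtain K where "\<forall>\<^sub>F p in nhds 0. norm (f p - quad_poly c p) \<le> K * norm p ^ 3"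
    using assms by (auto simp: has_2jet_def)
  from eventually_nhds_x_imp_x[OF this] show ?thesis by (simp add: quad_poly_def)
qed

text \<open>Applied with m = 1 to lines through the origin and with m = 6 to the branch.\<close>

lemma has_2jet_along:
  assumes f: "has_2jet f c" and h: "\<forall>\<^sub>F t in at 0. norm (h t) \<le> C * norm t ^ m" and m: "0 < m"
  shows "(\<lambda>t::complex. f (h t) - quad_poly c (h t)) \<in> O[at 0](\<lambda>t. t ^ (3 * m))"
proof -
  obtain K where K: "\<forall>\<^sub>F p in nhds 0. norm (f p - quad_poly c p) \<le> K * norm p ^ 3"
    using f by (auto simp: has_2jet_def)
  have "((\<lambda>t::complex. C * norm t ^ m) \<longlongrightarrow> C * norm (0::complex) ^ m) (at 0)"
    by (intro tendsto_intros)
  then have "(h \<longlongrightarrow> 0) (at 0)"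
    using m by (intro Lim_null_comparison[OF h]) (simp add: power_0_left)
  from eventually_compose_filterlim[OF K this] h
  have "\<forall>\<^sub>F t in at 0. norm (f (h t) - quad_poly c (h t)) \<le> (\<bar>K\<bar> * \<bar>C\<bar> ^ 3) * norm (t ^ (3 * m))"
  proof eventually_elim
    case (elim t)
    have "norm (h t) \<le> \<bar>C\<bar> * norm t ^ m"
      using elim(2) by (rule order.trans) (intro mult_right_mono, auto)
    then have "norm (h t) ^ 3 \<le> (\<bar>C\<bar> * norm t ^ m) ^ 3"
      by (intro power_mono) auto
    also have "\<dots> = \<bar>C\<bar> ^ 3 * norm (t ^ (3 * m))"
      by (simp add: power_mult_distrib norm_power mult.commute flip: power_mult)
    finally have "K * norm (h t) ^ 3 \<le> \<bar>K\<bar> * (\<bar>C\<bar> ^ 3 * norm (t ^ (3 * m)))"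
      by (intro mult_mono) auto
    with elim(1) show ?case by (simp add: mult.assoc)
  qed
  then show ?thesis by (rule bigoI)
qed

text \<open>On a line through the origin the difference of two candidates is a quadratic polynomial
  in t of order O(t^3), hence zero. The directions (1, 0), (0, 1) and (1, 1) separate the six
  coefficients.\<close>

lemma has_2jet_unique:
  assumes "has_2jet f c" "has_2jet f c'" "i + j \<le> 2"
  shows "c (i, j) = c' (i, j)"
proof -
  define e where "e i j = c (i, j) - c' (i, j)" for i j
  have *: "e 0 0 = 0 \<and> e 1 0 * x + e 0 1 * y = 0 \<and> e 2 0 * x ^ 2 + e 1 1 * x * y + e 0 2 * y ^ 2 = 0" for x y
  proof -
    define p where "p = [:e 0 0, e 1 0 * x + e 0 1 * y, e 2 0 * x ^ 2 + e 1 1 * x * y + e 0 2 * y ^ 2:]"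
    have "\<forall>\<^sub>F t::complex in at 0. norm (t * x, t * y) \<le> (norm x + norm y) * norm t ^ 1"
      using norm_Pair_le[of "_ * x" "_ * y"] by (intro always_eventually) (simp add: norm_mult algebra_simps)
    note along = has_2jet_along[OF _ this]
    have "(\<lambda>t. (f (t * x, t * y) - quad_poly c' (t * x, t * y)) - (f (t * x, t * y) - quad_poly c (t * x, t * y)))
        \<in> O[at 0](\<lambda>t. t ^ (3 * 1))"
      by (rule sum_in_bigo(2)[OF along[OF assms(2)] along[OF assms(1)]]) simp_all
    then have "coeff p k = 0" if "k < 3" for k
      by (rule bigo_poly_imp_coeff_0) (use that in \<open>simp_all add: p_def quad_poly_def e_def algebra_simps power2_eq_square\<close>)
    from this[of 0] this[of 1] this[of 2] show ?thesis by (simp add: p_def numeral_eq_Suc)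
  qed
  from *[of 1 0] *[of 0 1] *[of 1 1]
  have "e 0 0 = 0" "e 1 0 = 0" "e 0 1 = 0" "e 2 0 = 0" "e 1 1 = 0" "e 0 2 = 0" by simp_all
  moreover have "(i, j) \<in> {(0, 0), (1, 0), (0, 1), (2, 0), (1, 1), (0, 2)}"
    using assms(3) by auto
  ultimately show ?thesis by (auto simp: e_def)
qed

section \<open>2-jets along the branch\<close>

abbreviation curve :: "complex \<Rightarrow> C2" where
  "curve t \<equiv> (t ^ 6, t ^ 7 + t ^ 10 + t ^ 11)"

lemma norm_curve_ge: "norm t ^ 6 \<le> norm (curve t)"
  using norm_fst_le[of "t ^ 6" "t ^ 7 + t ^ 10 + t ^ 11"] by (simp add: norm_power)

lemma norm_curve_le:
  assumes "norm t \<le> 1"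
  shows "norm (curve t) \<le> 4 * norm t ^ 6"
proof -
  have "norm (t ^ k) \<le> norm t ^ 6" if "6 \<le> k" for k
    unfolding norm_power by (rule power_decreasing) (use assms that in auto)
  from this[of 7] this[of 10] this[of 11]
  have "norm (t ^ 7 + t ^ 10 + t ^ 11) \<le> 3 * norm t ^ 6"
    by (intro norm_triangle_le) (smt (verit) norm_triangle_ineq numeral_le_iff semiring_norm)
  then show ?thesis
    using norm_Pair_le[of "t ^ 6" "t ^ 7 + t ^ 10 + t ^ 11"] by (simp add: norm_power)
qed

lemma eventually_norm_le_1: "\<forall>\<^sub>F t::complex in at 0. norm t \<le> 1"
  unfolding eventually_at by (auto intro!: exI[of _ 1])

lemma has_2jet_along_curve:
  assumes "has_2jet f c"
  shows "(\<lambda>t. f (curve t) - (c (0, 0) + c (1, 0) * t ^ 6 + c (0, 1) * (t ^ 7 + t ^ 10 + t ^ 11)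
           + c (2, 0) * t ^ 12 + c (1, 1) * t ^ 13 + c (0, 2) * t ^ 14)) \<in> O[at 0](\<lambda>t. t ^ 16)"
proof (rule bigo_cong_diff)
  have "\<forall>\<^sub>F t in at 0. norm (curve t) \<le> 4 * norm t ^ 6"
    using eventually_norm_le_1 by eventually_elim (rule norm_curve_le)
  from has_2jet_along[OF assms this]
  show "(\<lambda>t. f (curve t) - quad_poly c (curve t)) \<in> O[at 0](\<lambda>t. t ^ 16)"
    by (rule bigo_power_mono) simp_all
  \<comment> \<open>The cubic error is already O(t^18). The cut at 16 comes from the tails of xy =
    t^13 + t^16 + t^17 and y^2 = t^14 + 2 t^17 + ...\<close>
  show "(\<lambda>t. t ^ 16 * (- c (1, 1) * (1 + t) - c (0, 2) * (2 * t + 2 * t ^ 2 + t ^ 4 + 2 * t ^ 5 + t ^ 6))) \<in> O[at 0](\<lambda>t. t ^ 16)"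
    by (rule bigo_power_times_bounded) (intro bigo_1_intros order.refl)+
qed (simp add: quad_poly_def algebra_simps power_numeral_reduce)

text \<open>Substituting \<tau> = t w and dividing by t^6 reduces this to
  \<open>rescaled_curve_coefficients\<close>; errors O(t^16) leave the precision t^10. The two
  bounds on \<tau> become bounds on w from above and below.\<close>

lemma curve_matching:
  assumes jets: "has_2jet f\<^sub>1 a" "has_2jet f\<^sub>2 b" "has_2jet g\<^sub>1 c" "has_2jet g\<^sub>2 d"
    and f: "a (0, 0) = 0" "a (0, 1) = 0" "b (0, 0) = 0" "b (1, 0) = 0" "a (1, 0) \<noteq> 0" "b (0, 1) \<noteq> 0"
    and g: "c (0, 0) = 0" "d (0, 0) = 0"
    and tau: "\<tau> \<in> O[at 0](\<lambda>t. t)" "(\<lambda>t. t) \<in> O[at 0](\<tau>)"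
    and eq: "\<forall>\<^sub>F t in at 0. f\<^sub>1 (curve (\<tau> t)) = g\<^sub>1 (curve t)" "\<forall>\<^sub>F t in at 0. f\<^sub>2 (curve (\<tau> t)) = g\<^sub>2 (curve t)"
  shows "c (1, 0) = a (1, 0)" "c (0, 1) = 0" "c (0, 2) = a (0, 2)"
    "d (1, 0) = 0" "d (0, 1) = b (0, 1)" "d (2, 0) = b (2, 0)"
proof -
  define w where "w t = \<tau> t / t" for t
  have nz: "\<forall>\<^sub>F t::complex in at 0. t \<noteq> 0"
    by (simp add: eventually_at_filter)
  obtain C where C: "\<forall>\<^sub>F t in at 0. norm (\<tau> t) \<le> C * norm t" using tau(1) by (rule landau_o.bigE)
  obtain C' where C': "C' > 0" "\<forall>\<^sub>F t in at 0. norm t \<le> C' * norm (\<tau> t)" using tau(2) by (rule landau_o.bigE)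
  have w: "w \<in> O[at 0](\<lambda>_. 1)"
    by (rule bigoI[of _ C]) (use C nz in \<open>eventually_elim, simp add: w_def norm_divide divide_simps\<close>)
  have v: "(\<lambda>_. 1) \<in> O[at 0](w)"
    by (rule bigoI[of _ C']) (use C'(2) nz in \<open>eventually_elim, simp add: w_def norm_divide divide_simps\<close>)
  have "(\<tau> \<longlongrightarrow> 0) (at 0)"
    by (rule Lim_null_comparison[OF C]) (auto intro!: tendsto_eq_intros)
  moreover have "\<forall>\<^sub>F t in at 0. \<tau> t \<noteq> 0"
    using C'(2) nz by eventually_elim auto
  \<comment> \<open>Estimates at the punctured origin can be composed with \<tau> only if \<tau> t
    \<noteq> 0 near 0, which the lower bound supplies.\<close>
  ultimately have lim: "filterlim \<tau> (at 0) (at 0)"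
    by (simp add: filterlim_at)
  have tau16: "(\<lambda>t. \<tau> t ^ 16) \<in> O[at 0](\<lambda>t. t ^ 16)"
    by (rule landau_o.big_power[OF tau(1)])
  have expand: "(\<lambda>t. (e (1, 0) * w t ^ 6 + e (0, 1) * (t * w t ^ 7 + t ^ 4 * w t ^ 10 + t ^ 5 * w t ^ 11)
        + e (2, 0) * t ^ 6 * w t ^ 12 + e (1, 1) * t ^ 7 * w t ^ 13 + e (0, 2) * t ^ 8 * w t ^ 14)
      - (k (1, 0) + k (0, 1) * (t + t ^ 4 + t ^ 5)
        + k (2, 0) * t ^ 6 + k (1, 1) * t ^ 7 + k (0, 2) * t ^ 8)) \<in> O[at 0](\<lambda>t. t ^ 10)"
    (is "?R \<in> _")
    if jf: "has_2jet f e" and jg: "has_2jet g k" and z: "e (0, 0) = 0" "k (0, 0) = 0"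
      and ev: "\<forall>\<^sub>F t in at 0. f (curve (\<tau> t)) = g (curve t)" for f g e k
  proof -
    let ?P = "\<lambda>e t. e (0, 0) + e (1, 0) * t ^ 6 + e (0, 1) * (t ^ 7 + t ^ 10 + t ^ 11)
           + e (2, 0) * t ^ 12 + e (1, 1) * t ^ 13 + e (0, 2) * t ^ 14"
    have 1: "(\<lambda>t. f (curve (\<tau> t)) - ?P e (\<tau> t)) \<in> O[at 0](\<lambda>t. t ^ 16)"
      by (rule landau_o.big_trans[OF landau_o.big.compose[OF has_2jet_along_curve[OF jf] lim] tau16])
    have 2: "(\<lambda>t. g (curve t) - ?P k t) \<in> O[at 0](\<lambda>t. t ^ 16)"
      by (rule has_2jet_along_curve[OF jg])
    have 3: "(\<lambda>t. (g (curve t) - ?P k t) - (f (curve (\<tau> t)) - ?P e (\<tau> t))) \<in> O[at 0](\<lambda>t. t ^ 16)"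
      by (rule sum_in_bigo(2)[OF 2 1])
    have "\<forall>\<^sub>F t in at 0. (g (curve t) - ?P k t) - (f (curve (\<tau> t)) - ?P e (\<tau> t)) = t ^ 6 * ?R t"
      using ev nz
    proof eventually_elim
      case (elim t)
      then have \<tau>: "\<tau> t = t * w t" by (simp add: w_def)
      show ?case
        unfolding elim(1) unfolding \<tau> by (simp add: z algebra_simps power_numeral_reduce)
    qed
    from landau_o.big.in_cong[OF this] 3
    have "(\<lambda>t. t ^ 6 * ?R t) \<in> O[at 0](\<lambda>t. t ^ (6 + 10))" by simp
    then have "(\<lambda>t. t ^ 6 * ?R t) \<in> O[at 0](\<lambda>t. t ^ 6 * t ^ 10)" by (simp only: power_add)
    moreover have "\<forall>\<^sub>F t::complex in at 0. t ^ 6 \<noteq> 0" using nz by eventually_elim simp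
    ultimately show ?thesis
      by (subst (asm) landau_o.big.mult_cancel_left) (rule bigthetaI_cong, simp, assumption+)
  qed
  note e1 = expand[OF jets(1,3) f(1) g(1) eq(1)] and e2 = expand[OF jets(2,4) f(3) g(2) eq(2)]
  have z: "(\<lambda>_. 0) \<in> O[at 0](\<lambda>t. t ^ 10)" by simp
  have e1': "(\<lambda>t. a (1, 0) * w t ^ 6 + a (2, 0) * t ^ 6 * w t ^ 12 + a (1, 1) * t ^ 7 * w t ^ 13
        + a (0, 2) * t ^ 8 * w t ^ 14
        - (c (1, 0) + c (0, 1) * (t + t ^ 4 + t ^ 5) + c (2, 0) * t ^ 6 + c (1, 1) * t ^ 7 + c (0, 2) * t ^ 8))
        \<in> O[at 0](\<lambda>t. t ^ 9)"
    by (rule bigo_power_mono[OF bigo_cong_diff[OF e1 z]]) (simp_all add: f del: One_nat_def)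
  have e2': "(\<lambda>t. t * (b (0, 1) * (w t ^ 7 + t ^ 3 * w t ^ 10 + t ^ 4 * w t ^ 11)
          + b (2, 0) * t ^ 5 * w t ^ 12 + b (1, 1) * t ^ 6 * w t ^ 13 + b (0, 2) * t ^ 7 * w t ^ 14)
        - (d (1, 0) + t * (d (0, 1) * (1 + t ^ 3 + t ^ 4) + d (2, 0) * t ^ 5 + d (1, 1) * t ^ 6 + d (0, 2) * t ^ 7)))
        \<in> O[at 0](\<lambda>t. t ^ 10)"
    by (rule bigo_cong_diff[OF e2 z]) (simp add: f algebra_simps power_numeral_reduce del: One_nat_def)
  note rescaled_curve_coefficients[OF f(5,6) w v e1' e2']
  then show "c (1, 0) = a (1, 0)" "c (0, 1) = 0" "c (0, 2) = a (0, 2)"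
    "d (1, 0) = 0" "d (0, 1) = b (0, 1)" "d (2, 0) = b (2, 0)" by blast+
qed

section \<open>Size of germs and the change of parameter\<close>

lemma holomorphic_map_linear_bound:
  assumes "holomorphic_map f U" "0 \<in> U" "f 0 = 0"
  shows "\<exists>K>0. \<forall>\<^sub>F p in nhds 0. norm (f p) \<le> K * norm p"
proof -
  obtain a b where 1: "((\<lambda>p. fst (f p)) has_derivative (\<lambda>(u, v). a * u + b * v)) (at 0)"
    using assms by (auto simp: holomorphic_map_def holomorphic_fun_def)
  obtain c d where 2: "((\<lambda>p. snd (f p)) has_derivative (\<lambda>(u, v). c * u + d * v)) (at 0)"
    using assms by (auto simp: holomorphic_map_def holomorphic_fun_def)
  from has_derivative_Pair[OF 1 2] obtain f' where f': "(f has_derivative f') (at 0)"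
    by auto
  then have bl: "bounded_linear f'" by (rule has_derivative_bounded_linear)
  obtain d where d: "d > 0" "\<And>y. norm y < d \<Longrightarrow> norm (f y - f' y) \<le> norm y"
    using has_derivative_within_alt[THEN iffD1, OF f', THEN conjunct2, rule_format, of 1]
    by (auto simp: assms(3))
  have "\<forall>\<^sub>F p in nhds 0. norm (f p) \<le> (1 + onorm f') * norm p"
    unfolding eventually_nhds_metric
  proof (intro exI[of _ d] conjI allI impI d(1))
    fix p :: C2 assume "dist p 0 < d"
    then have "norm (f p - f' p) \<le> norm p" using d(2) by simp
    moreover have "norm (f' p) \<le> onorm f' * norm p" using onorm[OF bl] .
    ultimately show "norm (f p) \<le> (1 + onorm f') * norm p"
      using norm_triangle_ineq2[of "f p" "f' p"] by (simp add: algebra_simps)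
  qed
  moreover have "1 + onorm f' > 0" using onorm_pos_le[OF bl] by simp
  ultimately show ?thesis by blast
qed

text \<open>The lower bound is the linear upper bound for the local inverse. It is conditioned on f
  p being small, not p: a preimage of a point near 0 is not known beforehand to be near 0.\<close>

lemma biholomorphic_two_sided_bound:
  assumes "biholomorphic_near_0 f U"
  shows "\<exists>K>0. \<exists>e>0. ball 0 e \<subseteq> U \<and> (\<forall>p. norm p < e \<longrightarrow> norm (f p) \<le> K * norm p) \<and>
    (\<forall>p\<in>U. norm (f p) < e \<longrightarrow> norm p \<le> K * norm (f p))"
proof -
  note f = biholomorphicD[OF assms]
  obtain h where h: "holomorphic_map h (f ` U)" "\<forall>p\<in>U. h (f p) = p"
    using assms by (auto simp: biholomorphic_near_0_def)
  have h0: "h 0 = 0" "0 \<in> f ` U" using h(2) f(1,2) by (metis, metis imageI)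
  obtain K where K: "K > 0" "\<forall>\<^sub>F p in nhds 0. norm (f p) \<le> K * norm p"
    using holomorphic_map_linear_bound[OF f(5,1,2)] by blast
  obtain K' where K': "K' > 0" "\<forall>\<^sub>F p in nhds 0. norm (h p) \<le> K' * norm p"
    using holomorphic_map_linear_bound[OF h(1) h0(2,1)] by blast
  have "\<forall>\<^sub>F p in nhds 0. p \<in> U" using f(1,3) by (metis eventually_nhds)
  with K(2) K'(2) have "\<forall>\<^sub>F p in nhds 0. p \<in> U \<and> norm (f p) \<le> K * norm p \<and> norm (h p) \<le> K' * norm p"
    by eventually_elim simp
  then obtain e where e: "e > 0"
    "\<And>p. norm p < e \<Longrightarrow> p \<in> U \<and> norm (f p) \<le> K * norm p \<and> norm (h p) \<le> K' * norm p"
    unfolding eventually_nhds_metric by auto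
  have "norm (f p) \<le> max K K' * norm p" if "norm p < e" for p
    using e(2)[OF that] mult_right_mono[of K "max K K'" "norm p"] by auto
  moreover have "norm p \<le> max K K' * norm (f p)" if "p \<in> U" "norm (f p) < e" for p
  proof -
    have "norm (h (f p)) \<le> K' * norm (f p)" using e(2)[OF that(2)] by blast
    then show ?thesis using h(2) that(1) mult_right_mono[of K' "max K K'" "norm (f p)"] by auto
  qed
  moreover have "ball 0 e \<subseteq> U" using e(2) by auto
  ultimately show ?thesis using e(1) K(1) by (intro exI[of _ "max K K'"] conjI exI[of _ e]) auto
qed

lemma power_le_imp_le_mult:
  fixes x y :: real
  assumes "x ^ n \<le> C * y ^ n" "0 \<le> y" "1 \<le> C" "0 < n"
  shows "x \<le> C * y"
proof (rule power_le_imp_le_base)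
  have "C * y ^ n \<le> C ^ n * y ^ n"
    using assms by (intro mult_right_mono self_le_power) auto
  with assms(1) show "x ^ Suc (n - 1) \<le> (C * y) ^ Suc (n - 1)"
    using assms(4) by (simp add: power_mult_distrib)
qed (use assms in simp)

text \<open>Only the size of \<open>\<tau>\<close> matters below: its expansion is read off the equations that it satisfies,
  so \<open>\<tau>\<close> need not even be continuous.\<close>

lemma reparametrization:
  assumes f: "biholomorphic_near_0 f U" and g: "biholomorphic_near_0 g V" and r: "0 < r"
    and eq: "image_germ (germ f) (set_germ (curve ` ball 0 r)) = image_germ (germ g) (set_germ (curve ` ball 0 r))"
  shows "\<exists>\<tau>. \<tau> \<in> O[at 0](\<lambda>t. t) \<and> (\<lambda>t. t) \<in> O[at 0](\<tau>) \<and> (\<forall>\<^sub>F t in at 0. f (curve (\<tau> t)) = g (curve t))"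
proof -
  obtain K e where K: "K > 0" "e > 0" "ball 0 e \<subseteq> U" "\<And>p. norm p < e \<Longrightarrow> norm (f p) \<le> K * norm p"
    "\<And>p. p \<in> U \<Longrightarrow> norm (f p) < e \<Longrightarrow> norm p \<le> K * norm (f p)"
    using biholomorphic_two_sided_bound[OF f] by blast
  obtain M d where M: "M > 0" "d > 0" "ball 0 d \<subseteq> V" "\<And>p. norm p < d \<Longrightarrow> norm (g p) \<le> M * norm p"
    "\<And>p. p \<in> V \<Longrightarrow> norm (g p) < d \<Longrightarrow> norm p \<le> M * norm (g p)"
    using biholomorphic_two_sided_bound[OF g] by blast
  let ?A = "curve ` ball 0 r"
  have "\<forall>\<^sub>F q in nhds 0. q \<in> f ` (?A \<inter> U) \<longleftrightarrow> q \<in> g ` (?A \<inter> V)"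
    using eq unfolding image_germ_eq[OF f] image_germ_eq[OF g] set_germ_eq_iff .
  then obtain \<rho> where \<rho>: "\<rho> > 0" "\<And>q. norm q < \<rho> \<Longrightarrow> q \<in> f ` (?A \<inter> U) \<longleftrightarrow> q \<in> g ` (?A \<inter> V)"
    unfolding eventually_nhds_metric by auto
  \<comment> \<open>The chain is |s|^6 \<le> |curve s| \<le> K M |curve t| \<le> 4 K M |t|^6, and
    likewise with s and t exchanged; the 4 is that of \<open>norm_curve_le\<close>. C \<ge> 1 allows
    taking sixth roots by \<open>power_le_imp_le_mult\<close>.\<close>
  define C where "C = max 1 (4 * (K * M))"
  define P where "P t s \<longleftrightarrow> f (curve s) = g (curve t) \<and> norm s \<le> C * norm t \<and> norm t \<le> C * norm s" for t s
  have small: "\<forall>\<^sub>F t::complex in at 0. b * norm t < c" if "c > 0" for b c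
  proof -
    have "((\<lambda>t::complex. b * norm t) \<longlongrightarrow> b * norm (0::complex)) (at 0)" by (intro tendsto_intros)
    then show ?thesis using that by (auto dest: order_tendstoD(2))
  qed
  have c6: "norm t ^ 6 \<le> norm t" if "norm t \<le> 1" for t :: complex
    using power_decreasing[of 1 6 "norm t"] that by simp
  have "\<forall>\<^sub>F t in at 0. \<exists>s. P t s"
    using eventually_norm_le_1 small[OF r, of 1] small[OF \<open>d > 0\<close>, of 4] small[OF \<open>\<rho> > 0\<close>, of "4 * M"]
      small[OF \<open>e > 0\<close>, of "4 * M"] small[OF \<open>d > 0\<close>, of "4 * M"]
      small[OF \<open>e > 0\<close>, of "4 * K * M"] small[OF zero_less_one, of "4 * K * M"]
  proof eventually_elim
    case (elim t)
    have ct: "norm (curve t) \<le> 4 * norm t ^ 6" by (rule norm_curve_le) (use elim in simp)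
    also have "\<dots> \<le> 4 * norm t" using c6 elim by simp
    finally have ct': "norm (curve t) \<le> 4 * norm t" .
    have V: "curve t \<in> V" using ct' elim M(3) by (auto simp: subset_eq)
    have gt: "norm (g (curve t)) \<le> M * norm (curve t)" using M(4) ct' elim by simp
    also have "\<dots> \<le> M * (4 * norm t)" using ct' M(1) by (intro mult_left_mono) auto
    finally have gt': "norm (g (curve t)) \<le> 4 * M * norm t" by simp
    have "g (curve t) \<in> g ` (?A \<inter> V)" using V elim by auto
    then have "g (curve t) \<in> f ` (?A \<inter> U)" using \<rho>(2) gt' elim by simp
    then obtain s where s: "curve s \<in> U" "g (curve t) = f (curve s)" by auto
    have "norm (curve s) \<le> K * norm (g (curve t))"
      using K(5)[OF s(1)] s(2) gt' elim by simp
    also have "\<dots> \<le> K * (M * norm (curve t))" using gt K(1) by (intro mult_left_mono) auto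
    finally have cs: "norm (curve s) \<le> K * M * norm (curve t)" by simp
    also have "\<dots> \<le> K * M * (4 * norm t ^ 6)" using ct K(1) M(1) by (intro mult_left_mono) auto
    finally have cs6: "norm (curve s) \<le> 4 * (K * M) * norm t ^ 6" by simp
    also have "\<dots> \<le> 4 * (K * M) * norm t" using c6[of t] elim K(1) M(1) by (intro mult_left_mono) auto
    finally have cs1: "norm (curve s) \<le> 4 * K * M * norm t" by simp
    have "norm s ^ 6 \<le> 4 * (K * M) * norm t ^ 6" using norm_curve_ge[of s] cs6 by linarith
    also have "\<dots> \<le> C * norm t ^ 6" by (intro mult_right_mono) (simp_all add: C_def)
    finally have A: "norm s \<le> C * norm t"
      by (rule power_le_imp_le_mult) (simp_all add: C_def)
    \<comment> \<open>\<open>norm_curve_le\<close> holds in the unit disc, so s has to be located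
      there before the reverse chain starts.\<close>
    have s1: "norm s \<le> 1"
    proof (rule ccontr)
      assume "\<not> norm s \<le> 1"
      then have "1 \<le> norm s ^ 6" by simp
      with norm_curve_ge[of s] cs1 elim show False by linarith
    qed
    have "norm (curve t) \<le> M * norm (f (curve s))"
      using M(5)[OF V] s(2) gt' elim by simp
    also have "\<dots> \<le> M * (K * norm (curve s))" using K(4)[of "curve s"] cs1 elim M(1) by (intro mult_left_mono) auto
    also have "\<dots> \<le> M * (K * (4 * norm s ^ 6))"
      using norm_curve_le[OF s1] K(1) M(1) by (intro mult_left_mono) auto
    finally have "norm t ^ 6 \<le> 4 * (K * M) * norm s ^ 6" using norm_curve_ge[of t] by (simp add: mult_ac)
    also have "\<dots> \<le> C * norm s ^ 6" by (intro mult_right_mono) (simp_all add: C_def)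
    finally have B: "norm t \<le> C * norm s"
      by (rule power_le_imp_le_mult) (simp_all add: C_def)
    show ?case using A B s(2) by (auto simp: P_def)
  qed
  then have *: "\<forall>\<^sub>F t in at 0. P t (SOME s. P t s)"
    by eventually_elim (rule someI_ex)
  show ?thesis
  proof (intro exI conjI)
    show "(\<lambda>t. SOME s. P t s) \<in> O[at 0](\<lambda>t. t)"
      by (rule bigoI[of _ C]) (use * in \<open>eventually_elim, simp add: P_def\<close>)
    show "(\<lambda>t. t) \<in> O[at 0](\<lambda>t. SOME s. P t s)"
      by (rule bigoI[of _ C]) (use * in \<open>eventually_elim, simp add: P_def\<close>)
    show "\<forall>\<^sub>F t in at 0. f (curve (SOME s. P t s)) = g (curve t)"
      using * by eventually_elim (simp add: P_def)
  qed
qed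

subsection \<open>Integral curves and resonances\<close>

text \<open>Gronwall's estimate with an escape argument: the linear bound on X is available inside
  the ball of radius r, so a first exit time has to be excluded.\<close>

lemma integral_curve_bound:
  fixes u :: "real \<Rightarrow> 'a::real_inner"
  assumes der: "\<And>s. s \<in> {0..1} \<Longrightarrow> (u has_vector_derivative X (u s)) (at s within {0..1})"
    and X: "\<And>q. norm q < r \<Longrightarrow> norm (X q) \<le> L * norm q"
    and small: "norm (u 0) * exp L < r" and s: "s \<in> {0..1}" and L: "0 \<le> L"
  shows "norm (u s) \<le> norm (u 0) * exp L"
proof -
  have cont: "continuous_on {0..1} u"
    unfolding continuous_on_eq_continuous_within using der has_vector_derivative_continuous by blast
  \<comment> \<open>This weighted square of the norm cannot increase while the curve stays in the
    ball.\<close>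
  define g where "g s = (u s \<bullet> u s) * exp (- 2 * L * s)" for s
  have bound: "norm (u b) \<le> norm (u 0) * exp L" if b: "b \<in> {0..1}" and in_ball: "\<And>s. 0 \<le> s \<Longrightarrow> s < b \<Longrightarrow> norm (u s) < r" for b
  proof -
    have "g b \<le> g 0"
    proof (cases "b = 0")
      case False
      show ?thesis
      proof (rule DERIV_nonpos_imp_decreasing_open[of 0 b g])
        show "0 \<le> b" using b by simp
        show "continuous_on {0..b} g"
          unfolding g_def by (intro continuous_intros continuous_on_subset[OF cont]) (use b in auto)
        fix x assume x: "0 < x" "x < b"
        then have "(u has_vector_derivative X (u x)) (at x within {0<..<1})"
          using b by (intro has_vector_derivative_within_subset[OF der]) auto
        then have "(u has_vector_derivative X (u x)) (at x)"
          using x b by (subst (asm) at_within_open) auto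
        then have "(u has_derivative (\<lambda>h. h *\<^sub>R X (u x))) (at x)"
          by (simp add: has_vector_derivative_def)
        from has_derivative_inner[OF this this]
        have "((\<lambda>s. u s \<bullet> u s) has_real_derivative 2 * (u x \<bullet> X (u x))) (at x)"
          by (simp add: has_field_derivative_def inner_commute algebra_simps mult_commute_abs)
        then have g: "(g has_real_derivative (2 * (u x \<bullet> X (u x)) - 2 * L * (u x \<bullet> u x)) * exp (- 2 * L * x)) (at x)"
          unfolding g_def by (auto intro!: derivative_eq_intros simp: algebra_simps)
        have le: "u x \<bullet> X (u x) \<le> L * (u x \<bullet> u x)"
        proof -
          have "u x \<bullet> X (u x) \<le> norm (u x) * norm (X (u x))" by (rule norm_cauchy_schwarz)
          also have "\<dots> \<le> norm (u x) * (L * norm (u x))"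
            using X in_ball x by (intro mult_left_mono) auto
          also have "\<dots> = L * (u x \<bullet> u x)" by (simp add: dot_square_norm power2_eq_square)
          finally show ?thesis .
        qed
        show "\<exists>y. (g has_real_derivative y) (at x) \<and> y \<le> 0"
          by (rule exI, rule conjI, rule g) (use le in \<open>simp add: mult_nonpos_nonneg\<close>)
      qed
    qed simp
    then have "norm (u b) ^ 2 * exp (- 2 * L * b) \<le> norm (u 0) ^ 2"
      by (simp add: g_def dot_square_norm)
    then have "norm (u b) ^ 2 \<le> norm (u 0) ^ 2 * exp (2 * L * b)"
      by (simp add: exp_minus field_simps)
    also have "\<dots> \<le> norm (u 0) ^ 2 * exp (2 * L)"
      using b L by (intro mult_left_mono) (auto simp: mult_left_le)
    also have "\<dots> = (norm (u 0) * exp L) ^ 2"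
      by (simp add: power_mult_distrib exp_double)
    finally show ?thesis by (rule power2_le_imp_le) simp
  qed
  have "norm (u x) < r" if "x \<in> {0..1}" for x
  proof (rule ccontr)
    assume "\<not> norm (u x) < r"
    \<comment> \<open>S is closed, so there is a first exit time. As \<open>bound\<close> asks for
      the ball on s < b, it reaches the exit time itself and shows that the norm there is below
      r.\<close>
    define S where "S = {s \<in> {0..1}. r \<le> norm (u s)}"
    have "closed S"
      unfolding S_def by (intro continuous_on_closed_Collect_le continuous_intros cont closed_atLeastAtMost)
    moreover have "S \<noteq> {}" using \<open>\<not> norm (u x) < r\<close> that by (auto simp: S_def)
    moreover have bb: "bdd_below S" by (auto simp: S_def intro!: bdd_belowI[of _ 0])
    ultimately have mem: "Inf S \<in> S" by (intro closed_contains_Inf)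
    then have "norm (u s) < r" if "0 \<le> s" "s < Inf S" for s
      using cInf_lower[OF _ bb, of s] that by (force simp: S_def)
    then have "norm (u (Inf S)) \<le> norm (u 0) * exp L"
      using mem by (intro bound) (auto simp: S_def)
    with mem small show False by (simp add: S_def)
  qed
  then show ?thesis by (intro bound[OF s]) (use s in auto)
qed

text \<open>Order h^n uniformly in the time s, where h scales the starting point of an integral
  curve.\<close>

definition small_family :: "nat \<Rightarrow> (complex \<Rightarrow> real \<Rightarrow> complex) \<Rightarrow> bool" where
  "small_family n z \<longleftrightarrow> (\<exists>K. \<forall>\<^sub>F h in at 0. \<forall>s\<in>{0..1}. norm (z h s) \<le> K * norm h ^ n)"

lemma small_familyI:
  "\<forall>\<^sub>F h in at 0. \<forall>s\<in>{0..1}. norm (z h s) \<le> K * norm h ^ n \<Longrightarrow> small_family n z"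
  by (auto simp: small_family_def)

lemma small_familyE:
  assumes "small_family n z"
  obtains K where "K \<ge> 0" "\<forall>\<^sub>F h in at 0. \<forall>s\<in>{0..1}. norm (z h s) \<le> K * norm h ^ n"
proof -
  obtain K where "\<forall>\<^sub>F h in at 0. \<forall>s\<in>{0..1}. norm (z h s) \<le> K * norm h ^ n"
    using assms by (auto simp: small_family_def)
  then have "\<forall>\<^sub>F h in at 0. \<forall>s\<in>{0..1}. norm (z h s) \<le> \<bar>K\<bar> * norm h ^ n"
    by eventually_elim (meson abs_ge_self mult_right_mono norm_ge_zero order.trans zero_le_power)
  then show ?thesis using that[of "\<bar>K\<bar>"] by simp
qed

lemma small_family_add:
  assumes "small_family n z" "small_family n w"
  shows "small_family n (\<lambda>h s. z h s + w h s)"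
proof -
  obtain K where K: "\<forall>\<^sub>F h in at 0. \<forall>s\<in>{0..1}. norm (z h s) \<le> K * norm h ^ n"
    using assms(1) by (rule small_familyE)
  obtain L where L: "\<forall>\<^sub>F h in at 0. \<forall>s\<in>{0..1}. norm (w h s) \<le> L * norm h ^ n"
    using assms(2) by (rule small_familyE)
  show ?thesis
    by (rule small_familyI[of _ "K + L"], use K L in eventually_elim)
      (auto intro!: norm_triangle_le add_mono simp: distrib_right)
qed

lemma small_family_mult:
  assumes "small_family n z" "small_family m w"
  shows "small_family (n + m) (\<lambda>h s. z h s * w h s)"
proof -
  obtain K where K: "K \<ge> 0" "\<forall>\<^sub>F h in at 0. \<forall>s\<in>{0..1}. norm (z h s) \<le> K * norm h ^ n"
    using assms(1) by (rule small_familyE)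
  obtain L where L: "\<forall>\<^sub>F h in at 0. \<forall>s\<in>{0..1}. norm (w h s) \<le> L * norm h ^ m"
    using assms(2) by (rule small_familyE)
  show ?thesis
  proof (rule small_familyI[of _ "K * L"], use K(2) L in eventually_elim)
    case (elim h)
    have "norm (z h s) * norm (w h s) \<le> (K * norm h ^ n) * (L * norm h ^ m)" if "s \<in> {0..1}" for s
      by (rule mult_mono) (use elim that K(1) in auto)
    then show ?case by (simp add: norm_mult power_add mult_ac)
  qed
qed

lemma small_family_bounded:
  assumes "continuous_on {0..1} c"
  shows "small_family 0 (\<lambda>_. c)"
proof -
  have "bounded (c ` {0..1})"
    by (intro compact_imp_bounded compact_continuous_image assms) simp
  then obtain K where "\<forall>s\<in>{0..1}. norm (c s) \<le> K" by (auto simp: bounded_iff)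
  then show ?thesis by (intro small_familyI[of _ K]) simp
qed

lemma small_family_mono:
  assumes "small_family n z" "m \<le> n"
  shows "small_family m z"
proof -
  obtain K where K: "K \<ge> 0" "\<forall>\<^sub>F h in at 0. \<forall>s\<in>{0..1}. norm (z h s) \<le> K * norm h ^ n"
    using assms(1) by (rule small_familyE)
  show ?thesis
  proof (rule small_familyI[of _ K], use K(2) eventually_norm_le_1 in eventually_elim)
    case (elim h)
    then have "K * norm h ^ n \<le> K * norm h ^ m"
      using assms(2) K(1) by (intro mult_left_mono power_decreasing) auto
    with elim show ?case by (auto intro: order.trans)
  qed
qed

lemma small_family_scale:
  assumes "small_family n z" "continuous_on {0..1} c"
  shows "small_family n (\<lambda>h s. c s * z h s)"
  using small_family_mult[OF small_family_bounded[OF assms(2)] assms(1)] by simp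

lemma small_family_cmult: "small_family n z \<Longrightarrow> small_family n (\<lambda>h s. c * z h s)"
  by (erule small_family_scale) simp

lemma small_family_imp_bigo:
  assumes "small_family n z" "s \<in> {0..1}"
  shows "(\<lambda>h. z h s) \<in> O[at 0](\<lambda>h. h ^ n)"
proof -
  obtain K where "\<forall>\<^sub>F h in at 0. \<forall>s\<in>{0..1}. norm (z h s) \<le> K * norm h ^ n"
    using assms(1) by (rule small_familyE)
  then have "\<forall>\<^sub>F h in at 0. norm (z h s) \<le> K * norm (h ^ n)"
    by eventually_elim (use assms(2) in \<open>simp add: norm_power\<close>)
  then show ?thesis by (rule bigoI)
qed

text \<open>Multiplication by exp (- \<mu> s) removes the homogeneous part. What remains has
  derivative g up to order h^n, and the mean value inequality on the unit interval compares it with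
  G. An explicit primitive G takes the place of an integral.\<close>

lemma variation_of_constants:
  fixes \<mu> :: complex and z v g G :: "complex \<Rightarrow> real \<Rightarrow> complex"
  assumes der: "\<forall>\<^sub>F h in at 0. \<forall>s\<in>{0..1}. (z h has_vector_derivative \<mu> * z h s + v h s) (at s within {0..1})"
    and err: "small_family n (\<lambda>h s. v h s - exp (\<mu> * s) * g h s)"
    and G: "\<And>h s. (G h has_vector_derivative g h s) (at s within {0..1})"
  shows "small_family n (\<lambda>h s. exp (- \<mu> * s) * z h s - z h 0 - (G h s - G h 0))"
proof -
  have "small_family n (\<lambda>h s. exp (- \<mu> * s) * (v h s - exp (\<mu> * s) * g h s))"
    by (rule small_family_scale[OF err]) (intro continuous_intros)
  then obtain K where K: "K \<ge> 0"
    "\<forall>\<^sub>F h in at 0. \<forall>s\<in>{0..1}. norm (exp (- \<mu> * s) * (v h s - exp (\<mu> * s) * g h s)) \<le> K * norm h ^ n"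
    by (rule small_familyE)
  show ?thesis
  proof (rule small_familyI[of _ K], use der K(2) in eventually_elim)
    case (elim h)
    define w where "w s = exp (- \<mu> * s) * z h s - G h s" for s :: real
    have w: "(w has_vector_derivative exp (- \<mu> * s) * (v h s - exp (\<mu> * s) * g h s)) (at s within {0..1})"
      if "s \<in> {0..1}" for s
    proof -
      have 1: "((\<lambda>s. exp (- \<mu> * of_real s)) has_vector_derivative (exp (- \<mu> * s) * - \<mu>)) (at s within {0..1})"
      proof -
        have "((\<lambda>x. exp (- \<mu> * x)) has_field_derivative (exp (- \<mu> * of_real s) * - \<mu>)) (at (of_real s))"
          by (auto intro!: derivative_eq_intros)
        then show ?thesis
          by (rule has_vector_derivative_real_field)
      qed
      have 2: "(z h has_vector_derivative \<mu> * z h s + v h s) (at s within {0..1})"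
        using elim(1) that by blast
      have e: "exp (- \<mu> * s) * exp (\<mu> * s) = 1" by (simp flip: exp_add)
      have "exp (- \<mu> * s) * (v h s - exp (\<mu> * s) * g h s)
          = exp (- \<mu> * s) * v h s - (exp (- \<mu> * s) * exp (\<mu> * s)) * g h s"
        by (simp only: right_diff_distrib mult.assoc)
      also have "\<dots> = exp (- \<mu> * s) * (\<mu> * z h s + v h s) + exp (- \<mu> * s) * - \<mu> * z h s - g h s"
        unfolding e by (simp add: algebra_simps)
      finally show ?thesis
        unfolding w_def using has_vector_derivative_diff[OF has_vector_derivative_mult[OF 1 2] G]
        by (simp only:)
    qed
    show ?case
    proof
      fix s :: real assume s: "s \<in> {0..1}"
      have "norm (w s - w 0) \<le> K * norm h ^ n * norm (s - 0)"
      proof (rule differentiable_bound[of "{0..1}"])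
        show "(w has_derivative (\<lambda>x. x *\<^sub>R (exp (- \<mu> * t) * (v h t - exp (\<mu> * t) * g h t)))) (at t within {0..1})"
          if "t \<in> {0..1}" for t
          using w[OF that] by (simp add: has_vector_derivative_def)
        show "onorm (\<lambda>x. x *\<^sub>R (exp (- \<mu> * t) * (v h t - exp (\<mu> * t) * g h t))) \<le> K * norm h ^ n"
          if "t \<in> {0..1}" for t :: real
          by (rule onorm_le) (use elim(2) that in \<open>simp add: mult.commute mult_left_mono\<close>)
      qed (use s in auto)
      also have "\<dots> \<le> K * norm h ^ n * 1"
        using s K(1) by (intro mult_left_mono) auto
      finally show "norm (exp (- \<mu> * s) * z h s - z h 0 - (G h s - G h 0)) \<le> K * norm h ^ n"
        by (simp add: w_def algebra_simps)
    qed
  qed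
qed

lemma perturbed_exponential:
  fixes \<mu> :: complex
  assumes z: "\<forall>\<^sub>F h in at 0. \<forall>s\<in>{0..1}. (z h has_vector_derivative \<mu> * z h s + q h s) (at s within {0..1})"
    and q: "small_family n q"
  shows "small_family n (\<lambda>h s. z h s - exp (\<mu> * s) * z h 0)"
proof -
  have "small_family n (\<lambda>h s. exp (- \<mu> * s) * z h s - z h 0 - (0 - 0))"
    by (rule variation_of_constants[OF z, where g = "\<lambda>_ _. 0"]) (use q in \<open>simp_all\<close>)
  then have "small_family n (\<lambda>h s. exp (\<mu> * s) * (exp (- \<mu> * s) * z h s - z h 0 - (0 - 0)))"
    by (rule small_family_scale) (intro continuous_intros)
  moreover have "exp (\<mu> * s) * (exp (- \<mu> * s) * z h s - z h 0 - (0 - 0))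
      = (exp (\<mu> * s) * exp (- \<mu> * s)) * z h s - exp (\<mu> * s) * z h 0" for h and s :: real
    by (simp only: right_diff_distrib mult.assoc diff_self mult_zero_right diff_0_right)
  moreover have "exp (\<mu> * s) * exp (- \<mu> * s) = 1" for s :: real
    by (simp flip: exp_add)
  ultimately show ?thesis by (simp only: mult_1)
qed

text \<open>The forcing m has the same exponent \<mu>. After division by exp (\<mu> s) it is the
  constant m0 h to first order, so it contributes s m0 h, the secular term of a Jordan
  block.\<close>

lemma linear_resonance:
  fixes \<mu> :: complex
  assumes z: "\<forall>\<^sub>F h in at 0. \<forall>s\<in>{0..1}. (z h has_vector_derivative \<mu> * z h s + (m h s + r h s)) (at s within {0..1})"
    and m: "\<forall>\<^sub>F h in at 0. \<forall>s\<in>{0..1}. (m h has_vector_derivative \<mu> * m h s + q h s) (at s within {0..1})"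
    and small: "small_family 2 r" "small_family 2 q"
    and init: "\<And>h. z h 0 = z0 * h" "\<And>h. m h 0 = m0 * h"
    and final: "(\<lambda>h. z h 1 - z1 * h) \<in> O[at 0](\<lambda>h. h ^ 2)"
  shows "z1 = exp \<mu> * (z0 + m0)"
proof -
  have "small_family 2 (\<lambda>h s. r h s + (m h s - exp (\<mu> * s) * m h 0))"
    by (intro small_family_add small perturbed_exponential[OF m])
  then have r': "small_family 2 (\<lambda>h s. (m h s + r h s) - exp (\<mu> * s) * (m0 * h))"
    by (simp add: init algebra_simps)
  have "small_family 2 (\<lambda>h s. exp (- \<mu> * s) * z h s - z h 0 - (of_real s * (m0 * h) - of_real 0 * (m0 * h)))"
    by (rule variation_of_constants[OF z r'])
      (auto intro!: derivative_eq_intros has_vector_derivative_real_field)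
  from small_family_imp_bigo[OF this, of 1]
  have 1: "(\<lambda>h. exp (- \<mu>) * z h 1 - z0 * h - m0 * h) \<in> O[at 0](\<lambda>h. h ^ 2)"
    by (simp add: init)
  have 2: "(\<lambda>h. exp (- \<mu>) * (z h 1 - z1 * h)) \<in> O[at 0](\<lambda>h. h ^ 2)"
    using final by (simp only: landau_o.big.cmult_in_iff exp_not_eq_zero not_False_eq_True)
  have "coeff [:0, exp (- \<mu>) * z1 - z0 - m0:] 1 = 0"
    by (rule bigo_poly_imp_coeff_0[OF sum_in_bigo(2)[OF 1 2]]) (simp_all add: algebra_simps)
  then show ?thesis by (simp add: exp_minus field_simps)
qed

text \<open>With \<eta> = 2 \<nu> - \<mu>, division by exp (\<mu> s) turns the forcing into \<kappa>
  h^2 exp (\<eta> s). If \<eta> \<noteq> 0, its integral over unit time is \<kappa> h^2 (exp \<eta>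
  - 1) / \<eta> = 0, so no term in h^2 could be present at time 1.\<close>

lemma quadratic_resonance:
  fixes \<mu> \<nu> :: complex
  assumes z: "\<forall>\<^sub>F h in at 0. \<forall>s\<in>{0..1}. (z h has_vector_derivative \<mu> * z h s + (\<kappa> * v h s ^ 2 + r h s)) (at s within {0..1})"
    and v: "\<forall>\<^sub>F h in at 0. \<forall>s\<in>{0..1}. (v h has_vector_derivative \<nu> * v h s + q h s) (at s within {0..1})"
    and small: "small_family 3 r" "small_family 2 q"
    and init: "\<And>h. z h 0 = 0" "\<And>h. v h 0 = h"
    and final: "(\<lambda>h. z h 1 - \<gamma> * h ^ 2) \<in> O[at 0](\<lambda>h. h ^ 3)"
    and resonance: "exp (2 * \<nu>) = exp \<mu>" and "\<gamma> \<noteq> 0"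
  shows "\<mu> = 2 * \<nu>"
proof (rule ccontr)
  define \<eta> where "\<eta> = 2 * \<nu> - \<mu>"
  assume "\<mu> \<noteq> 2 * \<nu>"
  then have \<eta>: "\<eta> \<noteq> 0" by (simp add: \<eta>_def)
  have "exp \<eta> = 1" using resonance by (simp add: \<eta>_def exp_diff)
  have v': "small_family 2 (\<lambda>h s. v h s - exp (\<nu> * s) * h)"
    using perturbed_exponential[OF v small(2)] by (simp only: init)
  have h: "small_family 1 (\<lambda>h s. h)"
    by (rule small_familyI[of _ 1]) simp
  \<comment> \<open>This is v + exp (\<nu> s) h, rewritten to exhibit its order 1. Times
    \<open>v'\<close> it shows that v^2 - exp (2 \<nu> s) h^2 has order 3.\<close>
  have v1: "small_family 1 (\<lambda>h s. (v h s - exp (\<nu> * s) * h) + 2 * exp (\<nu> * s) * h)"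
    by (intro small_family_add small_family_mono[OF v'] small_family_scale[OF h] continuous_intros) simp_all
  have "small_family 3 (\<lambda>h s. \<kappa> * ((v h s - exp (\<nu> * s) * h) * ((v h s - exp (\<nu> * s) * h) + 2 * exp (\<nu> * s) * h)) + r h s)"
    using small_family_mult[OF v' v1] by (intro small_family_add small small_family_cmult) simp
  moreover have "\<kappa> * ((v h s - exp (\<nu> * s) * h) * ((v h s - exp (\<nu> * s) * h) + 2 * exp (\<nu> * s) * h)) + r h s
     = (\<kappa> * v h s ^ 2 + r h s) - exp (\<mu> * s) * (\<kappa> * h ^ 2 * exp (\<eta> * s))" for h s
  proof -
    have "exp (\<mu> * s) * exp (\<eta> * s) = exp (\<nu> * s) * exp (\<nu> * s)"
      by (simp add: \<eta>_def algebra_simps flip: exp_add)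
    then have "exp (\<mu> * s) * (\<kappa> * h ^ 2 * exp (\<eta> * s)) = \<kappa> * h ^ 2 * (exp (\<nu> * s) * exp (\<nu> * s))"
      by (simp add: mult_ac)
    then show ?thesis by (simp add: algebra_simps power2_eq_square)
  qed
  ultimately have r': "small_family 3 (\<lambda>h s. (\<kappa> * v h s ^ 2 + r h s) - exp (\<mu> * s) * (\<kappa> * h ^ 2 * exp (\<eta> * s)))"
    by (simp only:)
  have "small_family 3 (\<lambda>h s. exp (- \<mu> * s) * z h s - z h 0 - (\<kappa> * h ^ 2 / \<eta> * exp (\<eta> * s) - \<kappa> * h ^ 2 / \<eta> * exp (\<eta> * of_real 0)))"
  proof (rule variation_of_constants[OF z r'])
    show "((\<lambda>s. \<kappa> * h ^ 2 / \<eta> * exp (\<eta> * of_real s)) has_vector_derivative \<kappa> * h ^ 2 * exp (\<eta> * of_real s)) (at s within {0..1})" for h s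
      by (rule has_vector_derivative_real_field[where f = "\<lambda>x. \<kappa> * h ^ 2 / \<eta> * exp (\<eta> * x)"])
        (use \<eta> in \<open>auto intro!: derivative_eq_intros\<close>)
  qed
  from small_family_imp_bigo[OF this, of 1]
  have 1: "(\<lambda>h. exp (- \<mu>) * z h 1) \<in> O[at 0](\<lambda>h. h ^ 3)"
    by (simp add: init \<open>exp \<eta> = 1\<close>)
  have 2: "(\<lambda>h. exp (- \<mu>) * (z h 1 - \<gamma> * h ^ 2)) \<in> O[at 0](\<lambda>h. h ^ 3)"
    using final by (simp only: landau_o.big.cmult_in_iff exp_not_eq_zero not_False_eq_True)
  have "coeff [:0, 0, exp (- \<mu>) * \<gamma>:] 2 = 0"
    by (rule bigo_poly_imp_coeff_0[OF sum_in_bigo(2)[OF 1 2]]) (simp_all add: algebra_simps power2_eq_square)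
  then show False using \<open>\<gamma> \<noteq> 0\<close> by (simp add: numeral_eq_Suc)
qed

section \<open>2-jets of a time-one map\<close>

locale time_one_map =
  fixes X f :: "C2 \<Rightarrow> C2" and U :: "C2 set" and a b c d :: "nat \<times> nat \<Rightarrow> complex"
  assumes X: "holomorphic_map X U" "0 \<in> U" "X 0 = 0"
    and jets: "has_2jet (\<lambda>p. fst (X p)) a" "has_2jet (\<lambda>p. snd (X p)) b"
      "has_2jet (\<lambda>p. fst (f p)) c" "has_2jet (\<lambda>p. snd (f p)) d"
    and flow: "\<forall>\<^sub>F p in nhds 0. \<exists>u :: real \<Rightarrow> C2. u 0 = p \<and> u 1 = f p \<and>
      (\<forall>s\<in>{0..1}. (u has_vector_derivative X (u s)) (at s within {0..1}))"
    and f0: "f 0 = 0"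
begin

lemma constant_terms: "a (0, 0) = 0" "b (0, 0) = 0" "c (0, 0) = 0" "d (0, 0) = 0"
  using jets[THEN has_2jet_at_0] X(3) f0 by simp_all

text \<open>A line of starting points h (\<open>e\<^sub>1\<close>, \<open>e\<^sub>2\<close>) turns
  2-jets into expansions in the single variable h: those of the field, \<open>a\<close> and
  \<open>b\<close>, enter the differential equations, and those of the map, \<open>c\<close> and
  \<open>d\<close>, the values at time 1.\<close>

lemma trajectories:
  obtains x y r\<^sub>1 r\<^sub>2 :: "complex \<Rightarrow> real \<Rightarrow> complex" where
    "\<And>h. x h 0 = e\<^sub>1 * h" "\<And>h. y h 0 = e\<^sub>2 * h"
    "small_family 1 x" "small_family 1 y" "small_family 3 r\<^sub>1" "small_family 3 r\<^sub>2"
    "\<forall>\<^sub>F h in at 0. \<forall>s\<in>{0..1}. (x h has_vector_derivative a (1, 0) * x h s + a (0, 1) * y h s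
        + (a (2, 0) * x h s ^ 2 + a (1, 1) * (x h s * y h s) + a (0, 2) * y h s ^ 2 + r\<^sub>1 h s)) (at s within {0..1})"
    "\<forall>\<^sub>F h in at 0. \<forall>s\<in>{0..1}. (y h has_vector_derivative b (1, 0) * x h s + b (0, 1) * y h s
        + (b (2, 0) * x h s ^ 2 + b (1, 1) * (x h s * y h s) + b (0, 2) * y h s ^ 2 + r\<^sub>2 h s)) (at s within {0..1})"
    "(\<lambda>h. x h 1 - (poly [:0, c (1, 0) * e\<^sub>1 + c (0, 1) * e\<^sub>2,
        c (2, 0) * e\<^sub>1 ^ 2 + c (1, 1) * (e\<^sub>1 * e\<^sub>2) + c (0, 2) * e\<^sub>2 ^ 2:] h)) \<in> O[at 0](\<lambda>h. h ^ 3)"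
    "(\<lambda>h. y h 1 - (poly [:0, d (1, 0) * e\<^sub>1 + d (0, 1) * e\<^sub>2,
        d (2, 0) * e\<^sub>1 ^ 2 + d (1, 1) * (e\<^sub>1 * e\<^sub>2) + d (0, 2) * e\<^sub>2 ^ 2:] h)) \<in> O[at 0](\<lambda>h. h ^ 3)"
proof -
  obtain L where L: "L > 0" "\<forall>\<^sub>F p in nhds 0. norm (X p) \<le> L * norm p"
    using holomorphic_map_linear_bound[OF X] by blast
  then obtain r where r: "r > 0" "\<And>q. norm q < r \<Longrightarrow> norm (X q) \<le> L * norm q"
    unfolding eventually_nhds_metric by auto
  obtain K\<^sub>1 where "\<forall>\<^sub>F p in nhds 0. norm (fst (X p) - quad_poly a p) \<le> K\<^sub>1 * norm p ^ 3"
    using jets(1) by (auto simp: has_2jet_def)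
  moreover obtain K\<^sub>2 where "\<forall>\<^sub>F p in nhds 0. norm (snd (X p) - quad_poly b p) \<le> K\<^sub>2 * norm p ^ 3"
    using jets(2) by (auto simp: has_2jet_def)
  ultimately have "\<forall>\<^sub>F p in nhds 0. norm (fst (X p) - quad_poly a p) \<le> \<bar>K\<^sub>1\<bar> * norm p ^ 3 \<and>
      norm (snd (X p) - quad_poly b p) \<le> \<bar>K\<^sub>2\<bar> * norm p ^ 3"
    by eventually_elim (meson abs_ge_self mult_right_mono norm_ge_zero order.trans zero_le_power)
  then obtain \<rho> where \<rho>: "\<rho> > 0"
    "\<And>p. norm p < \<rho> \<Longrightarrow> norm (fst (X p) - quad_poly a p) \<le> \<bar>K\<^sub>1\<bar> * norm p ^ 3"
    "\<And>p. norm p < \<rho> \<Longrightarrow> norm (snd (X p) - quad_poly b p) \<le> \<bar>K\<^sub>2\<bar> * norm p ^ 3"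
    unfolding eventually_nhds_metric by auto
  define N where "N = norm e\<^sub>1 + norm e\<^sub>2"
  define M where "M = N * exp L"
  have M: "M \<ge> 0" by (simp add: M_def N_def)
  define p where "p h = (e\<^sub>1 * h, e\<^sub>2 * h)" for h
  have np: "norm (p h) \<le> N * norm h ^ 1" for h
    using norm_Pair_le[of "e\<^sub>1 * h" "e\<^sub>2 * h"] by (simp add: p_def N_def norm_mult distrib_right)
  have "((\<lambda>h. (e\<^sub>1 * h, e\<^sub>2 * h)) \<longlongrightarrow> (e\<^sub>1 * 0, e\<^sub>2 * 0)) (at 0)"
    by (intro tendsto_intros)
  then have "(p \<longlongrightarrow> 0) (at 0)" unfolding p_def by (simp add: zero_prod_def)
  note flow' = eventually_compose_filterlim[OF flow this]
  define P where "P h u \<longleftrightarrow> u 0 = p h \<and> u 1 = f (p h) \<and>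
      (\<forall>s\<in>{0..1}. (u has_vector_derivative X (u s)) (at s within {0..1}))" for h and u :: "real \<Rightarrow> C2"
  \<comment> \<open>The constant default makes the initial value correct for every h and not just
    eventually, as the \<open>init\<close> assumptions of the resonance lemmas demand.\<close>
  define u where "u h = (if \<exists>u. P h u then SOME u. P h u else (\<lambda>_. p h))" for h
  have u: "P h (u h)" if "\<exists>u. P h u" for h
    using someI_ex[OF that] that by (simp add: u_def)
  have u0: "u h 0 = p h" for h
  proof (cases "\<exists>u. P h u")
    case True
    then show ?thesis using u by (simp add: P_def)
  qed (simp add: u_def)
  have small: "\<forall>\<^sub>F h::complex in at 0. M * norm h < \<epsilon>" if "\<epsilon> > 0" for \<epsilon>
  proof -
    have "((\<lambda>t::complex. M * norm t) \<longlongrightarrow> M * norm (0::complex)) (at 0)" by (intro tendsto_intros)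
    then show ?thesis using that by (auto dest: order_tendstoD(2))
  qed
  have Pu: "\<forall>\<^sub>F h in at 0. P h (u h)"
    using flow' by eventually_elim (rule u, simp add: P_def)
  have bound: "\<forall>\<^sub>F h in at 0. \<forall>s\<in>{0..1}. norm (u h s) \<le> M * norm h"
    using Pu small[OF r(1)]
  proof eventually_elim
    case (elim h)
    have le: "norm (u h 0) * exp L \<le> M * norm h"
      using mult_right_mono[OF np[of h], of "exp L"] by (simp add: u0 M_def mult_ac)
    show ?case
    proof
      fix s :: real assume s: "s \<in> {0..1}"
      have "norm (u h s) \<le> norm (u h 0) * exp L"
        by (rule integral_curve_bound[where X = X and r = r]) (use elim r(2) le L(1) s in \<open>auto simp: P_def\<close>)
      with le show "norm (u h s) \<le> M * norm h" by simp
    qed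
  qed
  define x y where "x h s = fst (u h s)" and "y h s = snd (u h s)" for h s
  define r\<^sub>1 r\<^sub>2 where "r\<^sub>1 h s = fst (X (u h s)) - quad_poly a (u h s)"
    and "r\<^sub>2 h s = snd (X (u h s)) - quad_poly b (u h s)" for h s
  have sr: "small_family 3 (\<lambda>h s. g (u h s))"
    if "\<And>p. norm p < \<rho> \<Longrightarrow> norm (g p) \<le> \<bar>K\<bar> * norm p ^ 3" for g :: "C2 \<Rightarrow> complex" and K
  proof (rule small_familyI[of _ "\<bar>K\<bar> * M ^ 3"], use bound small[OF \<rho>(1)] in eventually_elim)
    case (elim h)
    show ?case
    proof
      fix s :: real assume s: "s \<in> {0..1}"
      have us: "norm (u h s) \<le> M * norm h" using elim(1) s by blast
      have "norm (g (u h s)) \<le> \<bar>K\<bar> * norm (u h s) ^ 3"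
        using us elim(2) by (intro that) simp
      also have "\<dots> \<le> \<bar>K\<bar> * (M * norm h) ^ 3"
        using us by (intro mult_left_mono power_mono) auto
      finally show "norm (g (u h s)) \<le> \<bar>K\<bar> * M ^ 3 * norm h ^ 3"
        by (simp add: power_mult_distrib mult_ac)
    qed
  qed
  have fin: "(\<lambda>h. g (p h) - quad_poly k (p h)) \<in> O[at 0](\<lambda>h. h ^ (3 * 1))" if "has_2jet g k" for g k
    by (rule has_2jet_along[OF that, of _ N]) (use np in simp_all)
  have u1: "\<forall>\<^sub>F h in at 0. u h 1 = f (p h)"
    using Pu by eventually_elim (simp add: P_def)
  have le: "norm (fst q) \<le> norm q" "norm (snd q) \<le> norm q" for q :: C2
    using norm_fst_le[of "fst q" "snd q"] norm_snd_le[of "snd q" "fst q"] by simp_all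
  show thesis
  proof (rule that)
    show "x h 0 = e\<^sub>1 * h" "y h 0 = e\<^sub>2 * h" for h by (simp_all add: x_def y_def u0 p_def)
    show "small_family 1 x"
      by (rule small_familyI[of _ M], use bound in eventually_elim)
        (auto simp: x_def intro: order.trans[OF le(1)])
    show "small_family 1 y"
      by (rule small_familyI[of _ M], use bound in eventually_elim)
        (auto simp: y_def intro: order.trans[OF le(2)])
    show "small_family 3 r\<^sub>1" "small_family 3 r\<^sub>2"
      using sr[OF \<rho>(2)] sr[OF \<rho>(3)] unfolding r\<^sub>1_def[abs_def] r\<^sub>2_def[abs_def] by blast+
    show "\<forall>\<^sub>F h in at 0. \<forall>s\<in>{0..1}. (x h has_vector_derivative a (1, 0) * x h s + a (0, 1) * y h s
        + (a (2, 0) * x h s ^ 2 + a (1, 1) * (x h s * y h s) + a (0, 2) * y h s ^ 2 + r\<^sub>1 h s)) (at s within {0..1})"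
      using Pu
    proof eventually_elim
      case (elim h)
      show ?case
      proof
        fix s :: real assume "s \<in> {0..1}"
        with elim have "(u h has_vector_derivative X (u h s)) (at s within {0..1})" by (simp add: P_def)
        from bounded_linear.has_vector_derivative[OF bounded_linear_fst this]
        show "(x h has_vector_derivative a (1, 0) * x h s + a (0, 1) * y h s
          + (a (2, 0) * x h s ^ 2 + a (1, 1) * (x h s * y h s) + a (0, 2) * y h s ^ 2 + r\<^sub>1 h s)) (at s within {0..1})"
          unfolding x_def[abs_def] y_def r\<^sub>1_def quad_poly_def by (simp add: constant_terms algebra_simps)
      qed
    qed
    show "\<forall>\<^sub>F h in at 0. \<forall>s\<in>{0..1}. (y h has_vector_derivative b (1, 0) * x h s + b (0, 1) * y h s
        + (b (2, 0) * x h s ^ 2 + b (1, 1) * (x h s * y h s) + b (0, 2) * y h s ^ 2 + r\<^sub>2 h s)) (at s within {0..1})"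
      using Pu
    proof eventually_elim
      case (elim h)
      show ?case
      proof
        fix s :: real assume "s \<in> {0..1}"
        with elim have "(u h has_vector_derivative X (u h s)) (at s within {0..1})" by (simp add: P_def)
        from bounded_linear.has_vector_derivative[OF bounded_linear_snd this]
        show "(y h has_vector_derivative b (1, 0) * x h s + b (0, 1) * y h s
          + (b (2, 0) * x h s ^ 2 + b (1, 1) * (x h s * y h s) + b (0, 2) * y h s ^ 2 + r\<^sub>2 h s)) (at s within {0..1})"
          unfolding x_def y_def[abs_def] r\<^sub>2_def quad_poly_def by (simp add: constant_terms algebra_simps)
      qed
    qed
    have cx: "quad_poly k (p h) = poly [:0, k (1, 0) * e\<^sub>1 + k (0, 1) * e\<^sub>2,
        k (2, 0) * e\<^sub>1 ^ 2 + k (1, 1) * (e\<^sub>1 * e\<^sub>2) + k (0, 2) * e\<^sub>2 ^ 2:] h" if "k (0, 0) = 0" for k h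
      using that by (simp add: quad_poly_def p_def algebra_simps power2_eq_square)
    have "\<forall>\<^sub>F h in at 0. fst (f (p h)) - quad_poly c (p h) = x h 1 - poly [:0, c (1, 0) * e\<^sub>1 + c (0, 1) * e\<^sub>2,
        c (2, 0) * e\<^sub>1 ^ 2 + c (1, 1) * (e\<^sub>1 * e\<^sub>2) + c (0, 2) * e\<^sub>2 ^ 2:] h"
      using u1 by eventually_elim (simp only: cx[of c, OF constant_terms(3)] x_def)
    from landau_o.big.in_cong[OF this] fin[OF jets(3)]
    show "(\<lambda>h. x h 1 - (poly [:0, c (1, 0) * e\<^sub>1 + c (0, 1) * e\<^sub>2,
        c (2, 0) * e\<^sub>1 ^ 2 + c (1, 1) * (e\<^sub>1 * e\<^sub>2) + c (0, 2) * e\<^sub>2 ^ 2:] h)) \<in> O[at 0](\<lambda>h. h ^ 3)"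
      by (simp only: mult_1_right)
    have "\<forall>\<^sub>F h in at 0. snd (f (p h)) - quad_poly d (p h) = y h 1 - poly [:0, d (1, 0) * e\<^sub>1 + d (0, 1) * e\<^sub>2,
        d (2, 0) * e\<^sub>1 ^ 2 + d (1, 1) * (e\<^sub>1 * e\<^sub>2) + d (0, 2) * e\<^sub>2 ^ 2:] h"
      using u1 by eventually_elim (simp only: cx[of d, OF constant_terms(4)] y_def)
    from landau_o.big.in_cong[OF this] fin[OF jets(4)]
    show "(\<lambda>h. y h 1 - (poly [:0, d (1, 0) * e\<^sub>1 + d (0, 1) * e\<^sub>2,
        d (2, 0) * e\<^sub>1 ^ 2 + d (1, 1) * (e\<^sub>1 * e\<^sub>2) + d (0, 2) * e\<^sub>2 ^ 2:] h)) \<in> O[at 0](\<lambda>h. h ^ 3)"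
      by (simp only: mult_1_right)
  qed
qed

text \<open>With \<open>m = 0\<close> this says that a left eigenvector of the linear part of \<open>X\<close> is one of the linear
  part of \<open>f\<close>; the case \<open>m \<noteq> 0\<close> serves to exclude Jordan blocks.\<close>

lemma linear_part:
  assumes l: "l\<^sub>1 * a (1, 0) + l\<^sub>2 * b (1, 0) = \<mu> * l\<^sub>1 + m\<^sub>1" "l\<^sub>1 * a (0, 1) + l\<^sub>2 * b (0, 1) = \<mu> * l\<^sub>2 + m\<^sub>2"
    and m: "m\<^sub>1 * a (1, 0) + m\<^sub>2 * b (1, 0) = \<mu> * m\<^sub>1" "m\<^sub>1 * a (0, 1) + m\<^sub>2 * b (0, 1) = \<mu> * m\<^sub>2"
  shows "l\<^sub>1 * (c (1, 0) * e\<^sub>1 + c (0, 1) * e\<^sub>2) + l\<^sub>2 * (d (1, 0) * e\<^sub>1 + d (0, 1) * e\<^sub>2)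
    = exp \<mu> * ((l\<^sub>1 * e\<^sub>1 + l\<^sub>2 * e\<^sub>2) + (m\<^sub>1 * e\<^sub>1 + m\<^sub>2 * e\<^sub>2))"
proof -
  obtain x y r\<^sub>1 r\<^sub>2 where u: "\<And>h. x h 0 = e\<^sub>1 * h" "\<And>h. y h 0 = e\<^sub>2 * h"
    "small_family 1 x" "small_family 1 y" "small_family 3 r\<^sub>1" "small_family 3 r\<^sub>2"
    and x: "\<forall>\<^sub>F h in at 0. \<forall>s\<in>{0..1}. (x h has_vector_derivative a (1, 0) * x h s + a (0, 1) * y h s
        + (a (2, 0) * x h s ^ 2 + a (1, 1) * (x h s * y h s) + a (0, 2) * y h s ^ 2 + r\<^sub>1 h s)) (at s within {0..1})"
    and y: "\<forall>\<^sub>F h in at 0. \<forall>s\<in>{0..1}. (y h has_vector_derivative b (1, 0) * x h s + b (0, 1) * y h s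
        + (b (2, 0) * x h s ^ 2 + b (1, 1) * (x h s * y h s) + b (0, 2) * y h s ^ 2 + r\<^sub>2 h s)) (at s within {0..1})"
    and x1: "(\<lambda>h. x h 1 - (poly [:0, c (1, 0) * e\<^sub>1 + c (0, 1) * e\<^sub>2,
        c (2, 0) * e\<^sub>1 ^ 2 + c (1, 1) * (e\<^sub>1 * e\<^sub>2) + c (0, 2) * e\<^sub>2 ^ 2:] h)) \<in> O[at 0](\<lambda>h. h ^ 3)"
    and y1: "(\<lambda>h. y h 1 - (poly [:0, d (1, 0) * e\<^sub>1 + d (0, 1) * e\<^sub>2,
        d (2, 0) * e\<^sub>1 ^ 2 + d (1, 1) * (e\<^sub>1 * e\<^sub>2) + d (0, 2) * e\<^sub>2 ^ 2:] h)) \<in> O[at 0](\<lambda>h. h ^ 3)"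
    by (rule trajectories[of e\<^sub>1 e\<^sub>2]) blast
  define Q where "Q k h s = k (2, 0) * x h s ^ 2 + k (1, 1) * (x h s * y h s) + k (0, 2) * y h s ^ 2" for k :: "nat \<times> nat \<Rightarrow> complex" and h s
  have Q: "small_family 2 (Q k)" for k
  proof -
    note small_family_mult[OF u(3) u(3)] small_family_mult[OF u(3) u(4)] small_family_mult[OF u(4) u(4)]
    then show ?thesis unfolding Q_def[abs_def] power2_eq_square
      by (intro small_family_add small_family_cmult) (simp_all add: numeral_2_eq_2)
  qed
  have R: "small_family 2 (\<lambda>h s. k\<^sub>1 * (Q a h s + r\<^sub>1 h s) + k\<^sub>2 * (Q b h s + r\<^sub>2 h s))" for k\<^sub>1 k\<^sub>2
    by (intro small_family_add small_family_cmult Q small_family_mono[OF u(5)] small_family_mono[OF u(6)]) simp_all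
  have der: "\<forall>\<^sub>F h in at 0. \<forall>s\<in>{0..1}. ((\<lambda>s. k\<^sub>1 * x h s + k\<^sub>2 * y h s) has_vector_derivative
      k\<^sub>1 * (a (1, 0) * x h s + a (0, 1) * y h s + (Q a h s + r\<^sub>1 h s))
      + k\<^sub>2 * (b (1, 0) * x h s + b (0, 1) * y h s + (Q b h s + r\<^sub>2 h s))) (at s within {0..1})" for k\<^sub>1 k\<^sub>2
    using x y unfolding Q_def
    by eventually_elim (auto intro!: has_vector_derivative_add has_vector_derivative_mult_right)
  show ?thesis
  proof (rule linear_resonance)
    show "\<forall>\<^sub>F h in at 0. \<forall>s\<in>{0..1}. ((\<lambda>s. l\<^sub>1 * x h s + l\<^sub>2 * y h s) has_vector_derivative
      \<mu> * (l\<^sub>1 * x h s + l\<^sub>2 * y h s) + ((m\<^sub>1 * x h s + m\<^sub>2 * y h s)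
        + (l\<^sub>1 * (Q a h s + r\<^sub>1 h s) + l\<^sub>2 * (Q b h s + r\<^sub>2 h s)))) (at s within {0..1})"
    proof -
      have "l\<^sub>1 * (a (1, 0) * x h s + a (0, 1) * y h s + (Q a h s + r\<^sub>1 h s))
        + l\<^sub>2 * (b (1, 0) * x h s + b (0, 1) * y h s + (Q b h s + r\<^sub>2 h s))
        = (l\<^sub>1 * a (1, 0) + l\<^sub>2 * b (1, 0)) * x h s + (l\<^sub>1 * a (0, 1) + l\<^sub>2 * b (0, 1)) * y h s
          + (l\<^sub>1 * (Q a h s + r\<^sub>1 h s) + l\<^sub>2 * (Q b h s + r\<^sub>2 h s))" for h s
        by (simp add: algebra_simps)
      also have "\<dots> h s = \<mu> * (l\<^sub>1 * x h s + l\<^sub>2 * y h s) + ((m\<^sub>1 * x h s + m\<^sub>2 * y h s)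
        + (l\<^sub>1 * (Q a h s + r\<^sub>1 h s) + l\<^sub>2 * (Q b h s + r\<^sub>2 h s)))" for h s
        unfolding l by (simp add: algebra_simps)
      finally show ?thesis using der[of l\<^sub>1 l\<^sub>2] by (simp only:)
    qed
    show "\<forall>\<^sub>F h in at 0. \<forall>s\<in>{0..1}. ((\<lambda>s. m\<^sub>1 * x h s + m\<^sub>2 * y h s) has_vector_derivative
      \<mu> * (m\<^sub>1 * x h s + m\<^sub>2 * y h s) + (m\<^sub>1 * (Q a h s + r\<^sub>1 h s) + m\<^sub>2 * (Q b h s + r\<^sub>2 h s))) (at s within {0..1})"
    proof -
      have "m\<^sub>1 * (a (1, 0) * x h s + a (0, 1) * y h s + (Q a h s + r\<^sub>1 h s))
        + m\<^sub>2 * (b (1, 0) * x h s + b (0, 1) * y h s + (Q b h s + r\<^sub>2 h s))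
        = (m\<^sub>1 * a (1, 0) + m\<^sub>2 * b (1, 0)) * x h s + (m\<^sub>1 * a (0, 1) + m\<^sub>2 * b (0, 1)) * y h s
          + (m\<^sub>1 * (Q a h s + r\<^sub>1 h s) + m\<^sub>2 * (Q b h s + r\<^sub>2 h s))" for h s
        by (simp add: algebra_simps)
      also have "\<dots> h s = \<mu> * (m\<^sub>1 * x h s + m\<^sub>2 * y h s)
        + (m\<^sub>1 * (Q a h s + r\<^sub>1 h s) + m\<^sub>2 * (Q b h s + r\<^sub>2 h s))" for h s
        unfolding m by (simp add: algebra_simps)
      finally show ?thesis using der[of m\<^sub>1 m\<^sub>2] by (simp only:)
    qed
    show "l\<^sub>1 * x h 0 + l\<^sub>2 * y h 0 = (l\<^sub>1 * e\<^sub>1 + l\<^sub>2 * e\<^sub>2) * h"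
      "m\<^sub>1 * x h 0 + m\<^sub>2 * y h 0 = (m\<^sub>1 * e\<^sub>1 + m\<^sub>2 * e\<^sub>2) * h" for h
      by (simp_all add: u algebra_simps)
    let ?px = "\<lambda>h. x h 1 - (poly [:0, c (1, 0) * e\<^sub>1 + c (0, 1) * e\<^sub>2,
        c (2, 0) * e\<^sub>1 ^ 2 + c (1, 1) * (e\<^sub>1 * e\<^sub>2) + c (0, 2) * e\<^sub>2 ^ 2:] h)"
    let ?py = "\<lambda>h. y h 1 - (poly [:0, d (1, 0) * e\<^sub>1 + d (0, 1) * e\<^sub>2,
        d (2, 0) * e\<^sub>1 ^ 2 + d (1, 1) * (e\<^sub>1 * e\<^sub>2) + d (0, 2) * e\<^sub>2 ^ 2:] h)"
    have sc: "(\<lambda>h. k * g h) \<in> O[at 0](\<lambda>h. h ^ 2)" if "g \<in> O[at 0](\<lambda>h. h ^ 3)" for k and g :: "complex \<Rightarrow> complex"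
      using landau_o.big.mult[OF bigo_1_intros(1) bigo_power_mono[OF that], of 2 k] by (simp only: mult_1)
    show "(\<lambda>h. (l\<^sub>1 * x h 1 + l\<^sub>2 * y h 1) - (l\<^sub>1 * (c (1, 0) * e\<^sub>1 + c (0, 1) * e\<^sub>2) + l\<^sub>2 * (d (1, 0) * e\<^sub>1 + d (0, 1) * e\<^sub>2)) * h)
        \<in> O[at 0](\<lambda>h. h ^ 2)"
    proof (rule bigo_cong_diff)
      show "(\<lambda>h. l\<^sub>1 * ?px h + l\<^sub>2 * ?py h) \<in> O[at 0](\<lambda>h. h ^ 2)"
        by (intro sum_in_bigo sc x1 y1)
      show "(\<lambda>h. h ^ 2 * (- l\<^sub>1 * (c (2, 0) * e\<^sub>1 ^ 2 + c (1, 1) * (e\<^sub>1 * e\<^sub>2) + c (0, 2) * e\<^sub>2 ^ 2)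
          - l\<^sub>2 * (d (2, 0) * e\<^sub>1 ^ 2 + d (1, 1) * (e\<^sub>1 * e\<^sub>2) + d (0, 2) * e\<^sub>2 ^ 2))) \<in> O[at 0](\<lambda>h. h ^ 2)"
        by (rule bigo_power_times_bounded) (intro bigo_1_intros order.refl)+
    qed (simp add: algebra_simps power2_eq_square)
  qed (rule R)+
qed

text \<open>By \<open>linear_part\<close>, left eigenvectors of the linear part of X are left
  eigenvectors of diag(\<alpha>, \<beta>), and since \<alpha> \<noteq> \<beta> these lie on the
  axes. This makes the linear part of X diagonal; integral curves starting on the two axes then
  yield the two resonances.\<close>

lemma resonance_obstruction:
  assumes lin: "c (1, 0) = \<alpha>" "c (0, 1) = 0" "d (1, 0) = 0" "d (0, 1) = \<beta>"
    and quad: "c (0, 2) \<noteq> 0" "d (2, 0) \<noteq> 0"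
    and res: "\<alpha> ^ 2 = \<beta>" "\<beta> ^ 2 = \<alpha>" and ne: "\<alpha> \<noteq> \<beta>"
  shows False
proof -
  define A B C D where "A = a (1, 0)" and "B = a (0, 1)" and "C = b (1, 0)" and "D = b (0, 1)"
  note ABCD = A_def[symmetric] B_def[symmetric] C_def[symmetric] D_def[symmetric]
  have *: "l\<^sub>1 * \<alpha> = exp \<mu> * (l\<^sub>1 + m\<^sub>1)" "l\<^sub>2 * \<beta> = exp \<mu> * (l\<^sub>2 + m\<^sub>2)"
    if "l\<^sub>1 * A + l\<^sub>2 * C = \<mu> * l\<^sub>1 + m\<^sub>1" "l\<^sub>1 * B + l\<^sub>2 * D = \<mu> * l\<^sub>2 + m\<^sub>2"
      "m\<^sub>1 * A + m\<^sub>2 * C = \<mu> * m\<^sub>1" "m\<^sub>1 * B + m\<^sub>2 * D = \<mu> * m\<^sub>2" for l\<^sub>1 l\<^sub>2 \<mu> m\<^sub>1 m\<^sub>2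
    using linear_part[OF that[folded ABCD, unfolded A_def B_def C_def D_def], of 1 0]
      linear_part[OF that[folded ABCD, unfolded A_def B_def C_def D_def], of 0 1] lin by simp_all
  have eig: "(l\<^sub>1 = 0 \<or> exp \<mu> = \<alpha>) \<and> (l\<^sub>2 = 0 \<or> exp \<mu> = \<beta>)"
    if "l\<^sub>1 * A + l\<^sub>2 * C = \<mu> * l\<^sub>1" "l\<^sub>1 * B + l\<^sub>2 * D = \<mu> * l\<^sub>2" for l\<^sub>1 l\<^sub>2 \<mu>
    using *[of l\<^sub>1 l\<^sub>2 \<mu> 0 0] that by auto
  define \<delta> where "\<delta> = csqrt ((A - D) ^ 2 + 4 * B * C)"
  define \<mu>\<^sub>1 \<mu>\<^sub>2 where "\<mu>\<^sub>1 = (A + D + \<delta>) / 2" and "\<mu>\<^sub>2 = (A + D - \<delta>) / 2"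
  have \<delta>: "\<delta> ^ 2 = (A - D) ^ 2 + 4 * B * C" by (simp add: \<delta>_def)
  have sum: "\<mu>\<^sub>1 + \<mu>\<^sub>2 = A + D" by (simp add: \<mu>\<^sub>1_def \<mu>\<^sub>2_def field_simps)
  have "4 * (\<mu>\<^sub>1 * \<mu>\<^sub>2) = (A + D) ^ 2 - \<delta> ^ 2" by (simp add: \<mu>\<^sub>1_def \<mu>\<^sub>2_def field_simps power2_eq_square)
  also have "\<dots> = 4 * (A * D - B * C)" unfolding \<delta> by (simp add: algebra_simps power2_eq_square)
  finally have prod: "\<mu>\<^sub>1 * \<mu>\<^sub>2 = A * D - B * C"
    unfolding mult_cancel_left by simp
  have rows: "(A = \<mu> \<or> exp \<nu> = \<alpha>) \<and> (B = 0 \<or> exp \<nu> = \<beta>)" "(C = 0 \<or> exp \<nu> = \<alpha>) \<and> (D = \<mu> \<or> exp \<nu> = \<beta>)"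
    if "\<mu> + \<nu> = A + D" "\<mu> * \<nu> = A * D - B * C" for \<mu> \<nu>
  proof -
    have \<nu>: "\<nu> = A + D - \<mu>" using that(1) by (simp add: algebra_simps)
    show "(A = \<mu> \<or> exp \<nu> = \<alpha>) \<and> (B = 0 \<or> exp \<nu> = \<beta>)"
      using eig[of "A - \<mu>" B \<nu>] that(2) by (simp add: \<nu> algebra_simps)
    show "(C = 0 \<or> exp \<nu> = \<alpha>) \<and> (D = \<mu> \<or> exp \<nu> = \<beta>)"
      using eig[of C "D - \<mu>" \<nu>] that(2) by (simp add: \<nu> algebra_simps)
  qed
  \<comment> \<open>By Cayley--Hamilton the rows of \<open>M - \<mu>\<close> are left eigenvectors of \<open>M\<close> for the other eigenvalue.\<close>
  note r12 = rows[of \<mu>\<^sub>1 \<mu>\<^sub>2] and r21 = rows[of \<mu>\<^sub>2 \<mu>\<^sub>1]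
  \<comment> \<open>If B \<noteq> 0, both rows (A - \<mu>, B) have a nonzero second entry, so both
    eigenvalues have exponential \<beta> \<noteq> \<alpha> and both first entries vanish. Then A is
    a double eigenvalue and C = 0, a Jordan block: l = (1, 0) and m = (0, B) give 0 = exp A *
    B.\<close>
  have B: "B = 0"
  proof (rule ccontr)
    assume "B \<noteq> 0"
    then have "A = \<mu>\<^sub>1" "A = \<mu>\<^sub>2" using r12 r21 sum prod ne by (auto simp: add.commute mult.commute)
    then have "D = A" "C = 0" using sum prod \<open>B \<noteq> 0\<close> by auto
    then have "0 = exp A * B"
      using *(2)[of 1 0 A 0 B] by simp
    then show False using \<open>B \<noteq> 0\<close> by simp
  qed
  have C: "C = 0"
  proof (rule ccontr)
    assume "C \<noteq> 0"
    then have "D = \<mu>\<^sub>1" "D = \<mu>\<^sub>2" using r12 r21 sum prod ne by (auto simp: add.commute mult.commute)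
    then have "A = D" using sum by auto
    then have "0 = exp A * C"
      using *(1)[of 0 1 A C 0] B by simp
    then show False using \<open>C \<noteq> 0\<close> by simp
  qed
  have exps: "exp A = \<alpha>" "exp D = \<beta>"
    using eig[of 1 0 A] eig[of 0 1 D] B C by simp_all

  \<comment> \<open>From the points (0, h) the value of x at time 1 is
    \<open>c (0, 2) * h ^ 2\<close> up to O(h^3), and exp (2 D) = \<beta>^2 = \<alpha> = exp
    A.\<close>
  have "A = 2 * D"
  proof -
    obtain x y r\<^sub>1 r\<^sub>2 where u: "\<And>h. x h 0 = 0 * h" "\<And>h. y h 0 = 1 * h"
      "small_family 1 x" "small_family 1 y" "small_family 3 r\<^sub>1" "small_family 3 r\<^sub>2"
      and x: "\<forall>\<^sub>F h in at 0. \<forall>s\<in>{0..1}. (x h has_vector_derivative a (1, 0) * x h s + a (0, 1) * y h s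
          + (a (2, 0) * x h s ^ 2 + a (1, 1) * (x h s * y h s) + a (0, 2) * y h s ^ 2 + r\<^sub>1 h s)) (at s within {0..1})"
      and y: "\<forall>\<^sub>F h in at 0. \<forall>s\<in>{0..1}. (y h has_vector_derivative b (1, 0) * x h s + b (0, 1) * y h s
          + (b (2, 0) * x h s ^ 2 + b (1, 1) * (x h s * y h s) + b (0, 2) * y h s ^ 2 + r\<^sub>2 h s)) (at s within {0..1})"
      and x1: "(\<lambda>h. x h 1 - (poly [:0, c (1, 0) * 0 + c (0, 1) * 1,
          c (2, 0) * 0 ^ 2 + c (1, 1) * (0 * 1) + c (0, 2) * 1 ^ 2:] h)) \<in> O[at 0](\<lambda>h. h ^ 3)"
      by (rule trajectories[of 0 1]) blast
    have q: "small_family 2 (\<lambda>h s. k\<^sub>1 * x h s ^ 2 + k\<^sub>2 * (x h s * y h s) + k\<^sub>3 * y h s ^ 2 + r h s)"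
      if "small_family 3 r" for k\<^sub>1 k\<^sub>2 k\<^sub>3 r
      using small_family_mult[OF u(3) u(3)] small_family_mult[OF u(3) u(4)] small_family_mult[OF u(4) u(4)]
      unfolding power2_eq_square
      by (intro small_family_add small_family_cmult small_family_mono[OF that]) (simp_all add: numeral_2_eq_2)
    have x': "\<forall>\<^sub>F h in at 0. \<forall>s\<in>{0..1}. (x h has_vector_derivative A * x h s
          + (a (2, 0) * x h s ^ 2 + a (1, 1) * (x h s * y h s) + a (0, 2) * y h s ^ 2 + r\<^sub>1 h s)) (at s within {0..1})"
      using x unfolding ABCD B by simp
    \<comment> \<open>x starts at 0 and its forcing is quadratic, so it has order 2. This moves x^2
      and x y to order 3 and leaves y^2 as the forcing of order 2.\<close>
    have x2: "small_family 2 x"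
      using perturbed_exponential[OF x' q[OF u(5)]] by (simp add: u)
    show ?thesis
    proof (rule quadratic_resonance)
      show "\<forall>\<^sub>F h in at 0. \<forall>s\<in>{0..1}. (x h has_vector_derivative A * x h s
          + (a (0, 2) * y h s ^ 2 + (a (2, 0) * (x h s * x h s) + a (1, 1) * (x h s * y h s) + r\<^sub>1 h s))) (at s within {0..1})"
        using x' by (simp add: algebra_simps power2_eq_square)
      show "\<forall>\<^sub>F h in at 0. \<forall>s\<in>{0..1}. (y h has_vector_derivative D * y h s
          + (b (2, 0) * x h s ^ 2 + b (1, 1) * (x h s * y h s) + b (0, 2) * y h s ^ 2 + r\<^sub>2 h s)) (at s within {0..1})"
        using y unfolding ABCD C by simp
      show "small_family 3 (\<lambda>h s. a (2, 0) * (x h s * x h s) + a (1, 1) * (x h s * y h s) + r\<^sub>1 h s)"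
        using small_family_mult[OF x2 u(3)] small_family_mult[OF x2 u(4)]
        by (intro small_family_add small_family_cmult u) simp_all
      have 0: "(\<lambda>_. 0) \<in> O[at 0](\<lambda>h::complex. h ^ 3 :: complex)" by simp
      show "(\<lambda>h. x h 1 - c (0, 2) * h ^ 2) \<in> O[at 0](\<lambda>h. h ^ 3)"
        by (rule bigo_cong_diff[OF x1 0]) (simp add: lin power2_eq_square del: One_nat_def)
    qed (use q[OF u(6)] u exps res quad in \<open>simp_all add: exp_double\<close>)
  qed
  moreover have "D = 2 * A"
  proof -
    obtain x y r\<^sub>1 r\<^sub>2 where u: "\<And>h. x h 0 = 1 * h" "\<And>h. y h 0 = 0 * h"
      "small_family 1 x" "small_family 1 y" "small_family 3 r\<^sub>1" "small_family 3 r\<^sub>2"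
      and x: "\<forall>\<^sub>F h in at 0. \<forall>s\<in>{0..1}. (x h has_vector_derivative a (1, 0) * x h s + a (0, 1) * y h s
          + (a (2, 0) * x h s ^ 2 + a (1, 1) * (x h s * y h s) + a (0, 2) * y h s ^ 2 + r\<^sub>1 h s)) (at s within {0..1})"
      and y: "\<forall>\<^sub>F h in at 0. \<forall>s\<in>{0..1}. (y h has_vector_derivative b (1, 0) * x h s + b (0, 1) * y h s
          + (b (2, 0) * x h s ^ 2 + b (1, 1) * (x h s * y h s) + b (0, 2) * y h s ^ 2 + r\<^sub>2 h s)) (at s within {0..1})"
      and y1: "(\<lambda>h. y h 1 - (poly [:0, d (1, 0) * 1 + d (0, 1) * 0,
          d (2, 0) * 1 ^ 2 + d (1, 1) * (1 * 0) + d (0, 2) * 0 ^ 2:] h)) \<in> O[at 0](\<lambda>h. h ^ 3)"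
      by (rule trajectories[of 1 0]) blast
    have q: "small_family 2 (\<lambda>h s. k\<^sub>1 * x h s ^ 2 + k\<^sub>2 * (x h s * y h s) + k\<^sub>3 * y h s ^ 2 + r h s)"
      if "small_family 3 r" for k\<^sub>1 k\<^sub>2 k\<^sub>3 r
      using small_family_mult[OF u(3) u(3)] small_family_mult[OF u(3) u(4)] small_family_mult[OF u(4) u(4)]
      unfolding power2_eq_square
      by (intro small_family_add small_family_cmult small_family_mono[OF that]) (simp_all add: numeral_2_eq_2)
    have y': "\<forall>\<^sub>F h in at 0. \<forall>s\<in>{0..1}. (y h has_vector_derivative D * y h s
          + (b (2, 0) * x h s ^ 2 + b (1, 1) * (x h s * y h s) + b (0, 2) * y h s ^ 2 + r\<^sub>2 h s)) (at s within {0..1})"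
      using y unfolding ABCD C by simp
    have y2: "small_family 2 y"
      using perturbed_exponential[OF y' q[OF u(6)]] by (simp add: u)
    show ?thesis
    proof (rule quadratic_resonance)
      show "\<forall>\<^sub>F h in at 0. \<forall>s\<in>{0..1}. (y h has_vector_derivative D * y h s
          + (b (2, 0) * x h s ^ 2 + (b (1, 1) * (y h s * x h s) + b (0, 2) * (y h s * y h s) + r\<^sub>2 h s))) (at s within {0..1})"
        using y' by (simp add: algebra_simps power2_eq_square)
      show "\<forall>\<^sub>F h in at 0. \<forall>s\<in>{0..1}. (x h has_vector_derivative A * x h s
          + (a (2, 0) * x h s ^ 2 + a (1, 1) * (x h s * y h s) + a (0, 2) * y h s ^ 2 + r\<^sub>1 h s)) (at s within {0..1})"
        using x unfolding ABCD B by simp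
      show "small_family 3 (\<lambda>h s. b (1, 1) * (y h s * x h s) + b (0, 2) * (y h s * y h s) + r\<^sub>2 h s)"
        using small_family_mult[OF y2 u(3)] small_family_mult[OF y2 u(4)]
        by (intro small_family_add small_family_cmult u) simp_all
      have 0: "(\<lambda>_. 0) \<in> O[at 0](\<lambda>h::complex. h ^ 3 :: complex)" by simp
      show "(\<lambda>h. y h 1 - d (2, 0) * h ^ 2) \<in> O[at 0](\<lambda>h. h ^ 3)"
        by (rule bigo_cong_diff[OF y1 0]) (simp add: lin power2_eq_square del: One_nat_def)
    qed (use q[OF u(5)] u exps res quad in \<open>simp_all add: exp_double\<close>)
  qed
  ultimately have "A = 0" "D = 0" by simp_all
  with exps ne show False by simp
qed

end

subsection \<open>Taylor expansion in two variables\<close>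

text \<open>Discs of radius r / 4 centred in the half ball stay inside the ball, so Cauchy's
  inequality bounds the remainder uniformly in w and z. The centre w is free because difference
  quotients are also expanded away from 0.\<close>

lemma Taylor_bound_ball:
  fixes f :: "complex \<Rightarrow> complex"
  assumes hol: "f holomorphic_on ball 0 r" and bound: "\<And>z. z \<in> ball 0 r \<Longrightarrow> norm (f z) \<le> M"
    and wz: "w \<in> ball 0 (r / 2)" "z \<in> ball 0 (r / 2)"
  shows "norm (f z - (\<Sum>i\<le>n. (deriv ^^ i) f w * (z - w) ^ i / fact i))
    \<le> (fact (Suc n) * M / (r / 4) ^ Suc n) * norm (z - w) ^ Suc n / fact n"
proof -
  have "norm ((deriv ^^ 0) f z - (\<Sum>i\<le>n. (deriv ^^ i) f w * (z - w) ^ i / fact i))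
    \<le> (fact (Suc n) * M / (r / 4) ^ Suc n) * norm (z - w) ^ Suc n / fact n"
  proof (rule complex_Taylor[of "ball 0 (r / 2)" n "\<lambda>i. (deriv ^^ i) f"])
  have r: "0 < r" using wz(1) norm_ge_zero[of w] by (simp del: norm_ge_zero)
  show "((deriv ^^ i) f has_field_derivative (deriv ^^ Suc i) f x) (at x within ball 0 (r / 2))"
    if "x \<in> ball 0 (r / 2)" for i x
    using has_field_derivative_higher_deriv[OF hol open_ball, of x i] that r
    by (auto intro: has_field_derivative_at_within)
  show "norm ((deriv ^^ Suc n) f x) \<le> fact (Suc n) * M / (r / 4) ^ Suc n" if "x \<in> ball 0 (r / 2)" for x
  proof (rule Cauchy_inequality)
    have sub: "cball x (r / 4) \<subseteq> ball 0 r"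
    proof
      fix y assume "y \<in> cball x (r / 4)"
      then show "y \<in> ball 0 r"
        using that r norm_triangle_ineq2[of y x] by (simp add: dist_norm norm_minus_commute)
    qed
    show "f holomorphic_on ball x (r / 4)"
      by (rule holomorphic_on_subset[OF hol]) (use sub in auto)
    show "continuous_on (cball x (r / 4)) f"
      by (rule continuous_on_subset[OF holomorphic_on_imp_continuous_on[OF hol] sub])
    show "norm (f y) \<le> M" if "norm (x - y) = r / 4" for y
      using bound[of y] sub that by (auto simp: dist_norm)
  qed (use r in auto)
  qed (use wz in auto)
  then show ?thesis by simp
qed

text \<open>The derivatives in \<open>jet\<close> are iterated in one variable at a time, hence the
  curried form. The common bound M makes Cauchy estimates uniform in the other variable.\<close>

definition separately_holomorphic :: "real \<Rightarrow> real \<Rightarrow> (complex \<Rightarrow> complex \<Rightarrow> complex) \<Rightarrow> bool" where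
  "separately_holomorphic r M g \<longleftrightarrow>
     (\<forall>x\<in>ball 0 r. g x holomorphic_on ball 0 r) \<and> (\<forall>y\<in>ball 0 r. (\<lambda>x. g x y) holomorphic_on ball 0 r) \<and>
     (\<forall>x\<in>ball 0 r. \<forall>y\<in>ball 0 r. norm (g x y) \<le> M)"

lemma separately_holomorphic_subset:
  assumes "separately_holomorphic r M g" "r' \<le> r"
  shows "separately_holomorphic r' M g"
proof -
  have sub: "ball (0::complex) r' \<subseteq> ball 0 r" using assms(2) by auto
  have "g x holomorphic_on ball 0 r'" "(\<lambda>z. g z x) holomorphic_on ball 0 r'" if "x \<in> ball 0 r'" for x
    using assms(1) that sub holomorphic_on_subset[OF _ sub] unfolding separately_holomorphic_def by blast+
  moreover have "\<forall>x\<in>ball 0 r'. \<forall>y\<in>ball 0 r'. norm (g x y) \<le> M"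
    using assms(1) sub unfolding separately_holomorphic_def by blast
  ultimately show ?thesis unfolding separately_holomorphic_def by blast
qed

text \<open>Stability under the y-derivative, at the price of a smaller radius and another bound,
  permits iteration. Holomorphy in x is the delicate point; it rests on a Taylor bound in y that is
  uniform in x.\<close>

lemma separately_holomorphic_deriv:
  assumes g: "separately_holomorphic r M g" and r: "0 < r"
  shows "separately_holomorphic (r / 2) (M / (r / 4)) (\<lambda>x. deriv (g x))"
proof -
  have sub: "ball (0::complex) (r / 2) \<subseteq> ball 0 r" using r by auto
  have sub': "cball (0::complex) (r / 2) \<subseteq> ball 0 r" using r by auto
  have hy: "g x holomorphic_on ball 0 r" if "x \<in> ball 0 r" for x
    using g that by (simp add: separately_holomorphic_def)
  have hx: "(\<lambda>x. g x y) holomorphic_on ball 0 r" if "y \<in> ball 0 r" for y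
    using g that by (simp add: separately_holomorphic_def)
  have M: "norm (g x y) \<le> M" if "x \<in> ball 0 r" "y \<in> ball 0 r" for x y
    using g that by (simp add: separately_holomorphic_def)
  have 1: "deriv (g x) holomorphic_on ball 0 (r / 2)" if "x \<in> ball 0 (r / 2)" for x
    using holomorphic_on_subset[OF holomorphic_deriv[OF hy open_ball] sub] that sub by blast
  have 2: "norm (deriv (g x) y) \<le> M / (r / 4)" if x: "x \<in> ball 0 (r / 2)" and y: "y \<in> ball 0 (r / 2)" for x y
  proof -
    have s: "cball y (r / 4) \<subseteq> ball 0 r"
    proof
      fix z assume "z \<in> cball y (r / 4)"
      then show "z \<in> ball 0 r"
        using y r norm_triangle_ineq2[of z y] by (simp add: dist_norm norm_minus_commute)
    qed
    have "norm ((deriv ^^ 1) (g x) y) \<le> fact 1 * M / (r / 4) ^ 1"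
    proof (rule Cauchy_inequality)
      have x': "x \<in> ball 0 r" using x sub by blast
      show "g x holomorphic_on ball y (r / 4)"
        by (rule holomorphic_on_subset[OF hy[OF x']]) (use s in auto)
      show "continuous_on (cball y (r / 4)) (g x)"
        by (rule continuous_on_subset[OF holomorphic_on_imp_continuous_on[OF hy[OF x']] s])
      show "norm (g x z) \<le> M" if "norm (y - z) = r / 4" for z
        by (rule M[OF x']) (use s that in \<open>auto simp: dist_norm\<close>)
    qed (use r in auto)
    then show ?thesis by simp
  qed
  have 3: "(\<lambda>x. deriv (g x) y) holomorphic_on ball 0 (r / 2)" if y: "y \<in> ball 0 (r / 2)" for y
  proof -
    define q where "q h x = (g x (y + h) - g x y) / h" for h x
    define C where "C = fact (Suc 1) * M / (r / 4) ^ Suc 1 / fact 1"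
    have near: "\<forall>\<^sub>F h in at 0. y + h \<in> ball 0 (r / 2)"
    proof -
      have "((\<lambda>h. y + h) \<longlongrightarrow> y + 0) (at 0)" by (intro tendsto_intros)
      then show ?thesis using topological_tendstoD[OF _ open_ball] y by fastforce
    qed
    have err: "norm (q h x - deriv (g x) y) \<le> C * norm h"
      if x: "x \<in> ball 0 r" and h: "y + h \<in> ball 0 (r / 2)" "h \<noteq> 0" for x h
    proof -
      have "norm (g x (y + h) - (\<Sum>i\<le>1. (deriv ^^ i) (g x) y * ((y + h) - y) ^ i / fact i))
        \<le> (fact (Suc 1) * M / (r / 4) ^ Suc 1) * norm ((y + h) - y) ^ Suc 1 / fact 1"
        by (rule Taylor_bound_ball[OF hy[OF x] M[OF x] y h(1)])
      then have "norm (g x (y + h) - g x y - deriv (g x) y * h) \<le> C * norm h * norm h"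
        by (simp add: C_def diff_diff_eq power2_eq_square)
      moreover have "g x (y + h) - g x y - deriv (g x) y * h = (q h x - deriv (g x) y) * h"
        using h(2) by (simp add: q_def field_simps)
      ultimately show ?thesis using h(2) by (simp add: norm_mult)
    qed
    have ev: "\<forall>\<^sub>F h in at 0. continuous_on (cball 0 (r / 2)) (q h) \<and> q h holomorphic_on ball 0 (r / 2)"
      using near
    proof eventually_elim
      case (elim h)
      have "q h holomorphic_on ball 0 r"
        unfolding q_def[abs_def] divide_inverse using y elim sub by (intro holomorphic_intros hx) blast+
      then show ?case
        using holomorphic_on_subset[OF _ sub] continuous_on_subset[OF holomorphic_on_imp_continuous_on sub'] by blast
    qed
    \<comment> \<open>The difference quotients in \<open>y\<close> are holomorphic in \<open>x\<close>, and so is their uniform limit.\<close>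
    have ul: "uniform_limit (cball 0 (r / 2)) q (\<lambda>x. deriv (g x) y) (at 0)"
    proof (rule uniform_limitI)
      fix e :: real assume e: "e > 0"
      have "((\<lambda>h::complex. C * norm h) \<longlongrightarrow> C * norm (0::complex)) (at 0)" by (intro tendsto_intros)
      then have "\<forall>\<^sub>F h::complex in at 0. C * norm h < e" using e by (auto dest: order_tendstoD(2))
      moreover have "\<forall>\<^sub>F h::complex in at 0. h \<noteq> 0" by (simp add: eventually_at_filter)
      ultimately show "\<forall>\<^sub>F h in at 0. \<forall>x\<in>cball 0 (r / 2). dist (q h x) (deriv (g x) y) < e"
        using near
      proof eventually_elim
        case (elim h)
        show ?case
        proof
          fix x :: complex assume "x \<in> cball 0 (r / 2)"
          then have "norm (q h x - deriv (g x) y) \<le> C * norm h" using err sub' elim by blast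
          with elim show "dist (q h x) (deriv (g x) y) < e" by (simp add: dist_norm)
        qed
      qed
    qed
    from holomorphic_uniform_limit[OF ev ul trivial_limit_at] show ?thesis by blast
  qed
  show ?thesis unfolding separately_holomorphic_def using 1 2 3 by blast
qed

text \<open>Expand to order 2 in y, then the coefficient of y^j to order 2 - j in x, so that every
  remainder has total degree 3.\<close>

lemma separately_holomorphic_Taylor2:
  assumes "separately_holomorphic R M g" "0 < R"
  shows "\<exists>K\<ge>0. \<exists>r>0. \<forall>x\<in>ball 0 r. \<forall>y\<in>ball 0 r.
    norm (g x y - (\<Sum>j\<le>2. \<Sum>i\<le>2 - j. (deriv ^^ i) (\<lambda>x. (deriv ^^ j) (g x) 0) 0 / (fact i * fact j) * x ^ i * y ^ j))
      \<le> K * (norm x + norm y) ^ 3"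
proof -
  define D where "D j x y = (deriv ^^ j) (g x) y" for j x y
  have D: "\<exists>M' r. 0 < r \<and> separately_holomorphic r M' (D j)" for j
  proof (induction j)
    case 0
    then show ?case using assms by (auto simp: D_def[abs_def])
  next
    case (Suc j)
    then obtain M' r where *: "0 < r" "separately_holomorphic r M' (D j)" by blast
    have "D (Suc j) = (\<lambda>x. deriv (D j x))" by (simp add: D_def[abs_def])
    with separately_holomorphic_deriv[OF *(2,1)] *(1) show ?case by (metis half_gt_zero)
  qed
  obtain M0 r0 where D0: "0 < r0" "separately_holomorphic r0 M0 (D 0)" using D by blast
  obtain M1 r1 where D1: "0 < r1" "separately_holomorphic r1 M1 (D 1)" using D by blast
  obtain M2 r2 where D2: "0 < r2" "separately_holomorphic r2 M2 (D 2)" using D by blast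
  define r where "r = min r0 (min r1 r2)"
  define M' where "M' = max M0 (max M1 M2)"
  have r: "0 < r" using D0 D1 D2 by (simp add: r_def)
  have mono: "separately_holomorphic r M' (D j)" if "separately_holomorphic s N (D j)" "r \<le> s" "N \<le> M'" for j s N
    using separately_holomorphic_subset[OF that(1,2)] that(3) unfolding separately_holomorphic_def
    by (meson order.trans)
  have S: "separately_holomorphic r M' (D j)" if "j \<le> 2" for j
  proof -
    have "j = 0 \<or> j = 1 \<or> j = 2" using that by auto
    moreover have "separately_holomorphic r M' (D 0)"
      by (rule mono[OF D0(2)]) (simp_all add: r_def M'_def)
    moreover have "separately_holomorphic r M' (D 1)"
      by (rule mono[OF D1(2)]) (simp_all add: r_def M'_def)
    moreover have "separately_holomorphic r M' (D 2)"
      by (rule mono[OF D2(2)]) (simp_all add: r_def M'_def)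
    ultimately show ?thesis by blast
  qed
  define K where "K n = fact (Suc n) * M' / (r / 4) ^ Suc n / fact n" for n
  have xT: "norm (D j x 0 - (\<Sum>i\<le>n. (deriv ^^ i) (\<lambda>x. D j x 0) 0 * x ^ i / fact i)) \<le> K n * norm x ^ Suc n"
    if "j \<le> 2" "x \<in> ball 0 (r / 2)" for j n x
    using Taylor_bound_ball[of "\<lambda>x. D j x 0" r M' 0 x n] S[OF that(1)] that(2) r
    by (simp add: separately_holomorphic_def K_def)
  have yT: "norm (g x y - (\<Sum>j\<le>2. D j x 0 * y ^ j / fact j)) \<le> K 2 * norm y ^ 3"
    if "x \<in> ball 0 (r / 2)" "y \<in> ball 0 (r / 2)" for x y
    using Taylor_bound_ball[of "g x" r M' 0 y 2] S[of 0] that r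
    by (simp add: separately_holomorphic_def K_def D_def[abs_def] numeral_3_eq_3 numeral_2_eq_2)
  define k where "k = \<bar>K 0\<bar> + \<bar>K 1\<bar> + \<bar>K 2\<bar>"
  have k: "K 0 \<le> k" "K 1 \<le> k" "K 2 \<le> k" "0 \<le> k" by (simp_all add: k_def)
  have "norm (g x y - (\<Sum>j\<le>2. \<Sum>i\<le>2 - j. (deriv ^^ i) (\<lambda>x. D j x 0) 0 / (fact i * fact j) * x ^ i * y ^ j))
      \<le> (4 * k) * (norm x + norm y) ^ 3" if x: "x \<in> ball 0 (r / 2)" and y: "y \<in> ball 0 (r / 2)" for x y
  proof -
    define T where "T j = (\<Sum>i\<le>2 - j. (deriv ^^ i) (\<lambda>x. D j x 0) 0 * x ^ i / fact i)" for j
    define s where "s = norm x + norm y"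
    have s: "norm x \<le> s" "norm y \<le> s" by (simp_all add: s_def)
    have e: "norm (g x y - (\<Sum>j\<le>2. D j x 0 * y ^ j / fact j)) \<le> k * s ^ 3"
    proof -
      have "K 2 * norm y ^ 3 \<le> k * s ^ 3" using k s by (intro mult_mono power_mono) auto
      with yT[OF x y] show ?thesis by simp
    qed
    have le_fact: "norm (z / fact j) \<le> norm z" for z :: complex and j
      using fact_ge_1[of j, where ?'a = real] by (simp add: norm_divide divide_le_eq mult_le_cancel_left1)
    have ej: "norm ((D j x 0 - T j) * y ^ j / fact j) \<le> k * s ^ 3" if "j \<le> 2" for j
    proof -
      have "K (2 - j) \<le> k" using that k by (auto simp: le_Suc_eq numeral_2_eq_2)
      have "norm ((D j x 0 - T j) * y ^ j / fact j) \<le> norm ((D j x 0 - T j) * y ^ j)"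
        using le_fact .
      also have "\<dots> \<le> (K (2 - j) * norm x ^ Suc (2 - j)) * norm y ^ j"
        unfolding norm_mult norm_power T_def by (intro mult_right_mono xT that x) simp
      also have "\<dots> \<le> (k * s ^ Suc (2 - j)) * s ^ j"
        using \<open>K (2 - j) \<le> k\<close> k(4) s by (intro mult_mono power_mono) (auto simp: s_def)
      also have "\<dots> = k * s ^ (Suc (2 - j) + j)" by (simp add: power_add mult.assoc)
      also have "Suc (2 - j) + j = 3" using that by simp
      finally show ?thesis .
    qed
    have "(\<Sum>j\<le>2. \<Sum>i\<le>2 - j. (deriv ^^ i) (\<lambda>x. D j x 0) 0 / (fact i * fact j) * x ^ i * y ^ j)
        = (\<Sum>j\<le>2. T j * y ^ j / fact j)"
      unfolding T_def sum_distrib_right sum_divide_distrib by (intro sum.cong refl) simp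
    then have "g x y - (\<Sum>j\<le>2. \<Sum>i\<le>2 - j. (deriv ^^ i) (\<lambda>x. D j x 0) 0 / (fact i * fact j) * x ^ i * y ^ j)
        = (g x y - (\<Sum>j\<le>2. D j x 0 * y ^ j / fact j)) + (\<Sum>j\<le>2. (D j x 0 - T j) * y ^ j / fact j)"
      by (simp add: diff_divide_distrib left_diff_distrib sum_subtractf)
    \<comment> \<open>One remainder from the expansion in y and three from its coefficients j = 0,
      1, 2 add up to the factor 4.\<close>
    also have "norm \<dots> \<le> k * s ^ 3 + (\<Sum>j\<le>(2::nat). k * s ^ 3)"
      by (intro norm_triangle_mono e sum_norm_le ej) simp
    also have "\<dots> = (4 * k) * s ^ 3" by simp
    finally show ?thesis by (simp add: s_def)
  qed
  then show ?thesis unfolding D_def using k(4) r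
    by (intro exI[of _ "4 * k"] conjI exI[of _ "r / 2"]) auto
qed

section \<open>2-jets of holomorphic functions\<close>

lemma holomorphic_fun_partial:
  assumes "holomorphic_fun f U" "(x, y) \<in> U"
  shows "(\<lambda>x. f (x, y)) field_differentiable at x" "(\<lambda>y. f (x, y)) field_differentiable at y"
proof -
  obtain a b where f: "(f has_derivative (\<lambda>(u, v). a * u + b * v)) (at (x, y))"
    using assms by (auto simp: holomorphic_fun_def)
  have "((\<lambda>x. (x, y)) has_derivative (\<lambda>u. (u, 0))) (at x)" by (auto intro!: derivative_eq_intros)
  from has_derivative_compose[OF this f]
  have "((\<lambda>x. f (x, y)) has_field_derivative a) (at x)" by (simp add: has_field_derivative_def)
  then show "(\<lambda>x. f (x, y)) field_differentiable at x" by (auto simp: field_differentiable_def)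
  have "((\<lambda>y. (x, y)) has_derivative (\<lambda>v. (0, v))) (at y)" by (auto intro!: derivative_eq_intros)
  from has_derivative_compose[OF this f]
  have "((\<lambda>y. f (x, y)) has_field_derivative b) (at y)" by (simp add: has_field_derivative_def)
  then show "(\<lambda>y. f (x, y)) field_differentiable at y" by (auto simp: field_differentiable_def)
qed

text \<open>Complex differentiability gives holomorphy in each variable and continuity at 0 gives a
  local bound, so the two-variable Taylor estimate applies. This ties \<open>jet\<close> to
  \<open>has_2jet\<close>.\<close>

lemma holomorphic_fun_has_2jet:
  assumes f: "holomorphic_fun f U" and U: "0 \<in> U"
  shows "has_2jet f (\<lambda>(i, j). jet 2 f (i, j) / (fact i * fact j))"
proof -
  have "open U" using f by (simp add: holomorphic_fun_def)
  with U have "\<forall>\<^sub>F p in nhds 0. p \<in> U" by (metis eventually_nhds)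
  moreover have "isCont f 0"
    using f U unfolding holomorphic_fun_def by (meson has_derivative_continuous)
  then have "(f \<longlongrightarrow> f 0) (nhds 0)" by (metis isCont_def tendsto_at_iff_tendsto_nhds)
  then have "\<forall>\<^sub>F p in nhds 0. dist (f p) (f 0) < 1" by (rule tendstoD) simp
  ultimately have "\<forall>\<^sub>F p in nhds 0. p \<in> U \<and> dist (f p) (f 0) < 1"
    by (rule eventually_conj)
  then obtain \<rho> where \<rho>: "\<rho> > 0" "\<And>p. norm p < \<rho> \<Longrightarrow> p \<in> U \<and> dist (f p) (f 0) < 1"
    unfolding eventually_nhds_metric by auto
  have in_ball: "norm (x, y) < \<rho>" if "x \<in> ball 0 (\<rho> / 2)" "y \<in> ball 0 (\<rho> / 2)" for x y :: complex
    using norm_Pair_le[of x y] that by simp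
  have "separately_holomorphic (\<rho> / 2) (norm (f 0) + 1) (\<lambda>x y. f (x, y))"
    unfolding separately_holomorphic_def
  proof (intro conjI ballI)
    show "(\<lambda>y. f (x, y)) holomorphic_on ball 0 (\<rho> / 2)" if "x \<in> ball 0 (\<rho> / 2)" for x
      unfolding holomorphic_on_def
      using holomorphic_fun_partial(2)[OF f] \<rho>(2) in_ball that by (blast intro: field_differentiable_at_within)
    show "(\<lambda>x. f (x, y)) holomorphic_on ball 0 (\<rho> / 2)" if "y \<in> ball 0 (\<rho> / 2)" for y
      unfolding holomorphic_on_def
      using holomorphic_fun_partial(1)[OF f] \<rho>(2) in_ball that by (blast intro: field_differentiable_at_within)
    show "norm (f (x, y)) \<le> norm (f 0) + 1" if "x \<in> ball 0 (\<rho> / 2)" "y \<in> ball 0 (\<rho> / 2)" for x y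
      using \<rho>(2)[OF in_ball[OF that]] norm_triangle_ineq2[of "f (x, y)" "f 0"] by (simp add: dist_norm)
  qed
  from separately_holomorphic_Taylor2[OF this] \<rho>(1) obtain K r where K: "K \<ge> 0" "r > 0"
    "\<And>x y. x \<in> ball 0 r \<Longrightarrow> y \<in> ball 0 r \<Longrightarrow> norm (f (x, y) - (\<Sum>j\<le>2. \<Sum>i\<le>2 - j.
        (deriv ^^ i) (\<lambda>x. (deriv ^^ j) (\<lambda>y. f (x, y)) 0) 0 / (fact i * fact j) * x ^ i * y ^ j)) \<le> K * (norm x + norm y) ^ 3"
    by (auto simp del: norm_mult)
  define c where "c = (\<lambda>(i, j). jet 2 f (i, j) / (fact i * fact j))"
  have q: "quad_poly c (x, y) = (\<Sum>j\<le>2. \<Sum>i\<le>2 - j.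
        (deriv ^^ i) (\<lambda>x. (deriv ^^ j) (\<lambda>y. f (x, y)) 0) 0 / (fact i * fact j) * x ^ i * y ^ j)" for x y
    by (simp add: quad_poly_def c_def jet_def numeral_2_eq_2 algebra_simps)
  have "norm (f p - quad_poly c p) \<le> (8 * K) * norm p ^ 3" if "norm p < r" for p
  proof -
    obtain x y where p: "p = (x, y)" by (cases p)
    have n: "norm x \<le> norm p" "norm y \<le> norm p"
      using norm_fst_le[of x y] norm_snd_le[of y x] by (simp_all add: p)
    then have "norm (f p - quad_poly c p) \<le> K * (norm x + norm y) ^ 3"
      unfolding p q by (intro K(3)) (use that p in auto)
    also have "\<dots> \<le> K * (2 * norm p) ^ 3"
      using n K(1) by (intro mult_left_mono power_mono) auto
    finally show ?thesis by (simp add: power_mult_distrib)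
  qed
  then have "\<forall>\<^sub>F p in nhds 0. norm (f p - quad_poly c p) \<le> (8 * K) * norm p ^ 3"
    unfolding eventually_nhds_metric using K(2) by (auto intro!: exI[of _ r])
  then show ?thesis unfolding has_2jet_def c_def by blast
qed

subsection \<open>Resonant germs\<close>

lemma holomorphic_fun_const: "holomorphic_fun (\<lambda>_. k) UNIV"
  and holomorphic_fun_fst: "holomorphic_fun fst UNIV"
  and holomorphic_fun_snd: "holomorphic_fun snd UNIV"
proof -
  have "((\<lambda>_. k) has_derivative (\<lambda>(u, v). 0 * u + 0 * v)) (at p)" for p :: C2
    by (rule has_derivative_eq_rhs[OF has_derivative_const]) auto
  then show "holomorphic_fun (\<lambda>_. k) UNIV" unfolding holomorphic_fun_def by blast
  show "holomorphic_fun fst UNIV" "holomorphic_fun snd UNIV"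
    using biholomorphicD(5)[OF biholomorphic_id] by (simp_all add: holomorphic_map_def eta_contract_eq)
qed

lemma holomorphic_fun_add:
  assumes "holomorphic_fun f U" "holomorphic_fun g U"
  shows "holomorphic_fun (\<lambda>p. f p + g p) U"
  unfolding holomorphic_fun_def
proof (intro conjI ballI)
  show "open U" using assms by (simp add: holomorphic_fun_def)
  fix p assume "p \<in> U"
  then obtain a b a' b' where "(f has_derivative (\<lambda>(u, v). a * u + b * v)) (at p)"
    "(g has_derivative (\<lambda>(u, v). a' * u + b' * v)) (at p)"
    using assms unfolding holomorphic_fun_def by blast
  from has_derivative_add[OF this]
  have "((\<lambda>p. f p + g p) has_derivative (\<lambda>(u, v). (a + a') * u + (b + b') * v)) (at p)"
    by (rule has_derivative_eq_rhs) (auto simp: algebra_simps)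
  then show "\<exists>a b. ((\<lambda>p. f p + g p) has_derivative (\<lambda>(u, v). a * u + b * v)) (at p)" by blast
qed

lemma holomorphic_fun_mult:
  assumes "holomorphic_fun f U" "holomorphic_fun g U"
  shows "holomorphic_fun (\<lambda>p. f p * g p) U"
  unfolding holomorphic_fun_def
proof (intro conjI ballI)
  show "open U" using assms by (simp add: holomorphic_fun_def)
  fix p assume "p \<in> U"
  then obtain a b a' b' where "(f has_derivative (\<lambda>(u, v). a * u + b * v)) (at p)"
    "(g has_derivative (\<lambda>(u, v). a' * u + b' * v)) (at p)"
    using assms unfolding holomorphic_fun_def by blast
  from has_derivative_mult[OF this]
  have "((\<lambda>p. f p * g p) has_derivative (\<lambda>(u, v). (f p * a' + a * g p) * u + (f p * b' + b * g p) * v)) (at p)"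
    by (rule has_derivative_eq_rhs) (auto simp: algebra_simps)
  then show "\<exists>a b. ((\<lambda>p. f p * g p) has_derivative (\<lambda>(u, v). a * u + b * v)) (at p)" by blast
qed

text \<open>The members of a germ are arbitrary functions away from 0; this makes each member of a
  germ in \<open>Diff\<close> holomorphic near 0.\<close>

lemma holomorphic_fun_cong_nhds:
  assumes f: "holomorphic_fun f U" "0 \<in> U" and eq: "\<forall>\<^sub>F p in nhds 0. g p = f p"
  shows "\<exists>W. 0 \<in> W \<and> holomorphic_fun g W"
proof -
  obtain W where W: "open W" "0 \<in> W" "\<And>p. p \<in> W \<Longrightarrow> g p = f p"
    using eq by (auto simp: eventually_nhds)
  have "open U" using f by (simp add: holomorphic_fun_def)
  have "\<exists>a b. (g has_derivative (\<lambda>(u, v). a * u + b * v)) (at p)" if p: "p \<in> W \<inter> U" for p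
  proof -
    obtain a b where "(f has_derivative (\<lambda>(u, v). a * u + b * v)) (at p)"
      using f p unfolding holomorphic_fun_def by blast
    then have "(g has_derivative (\<lambda>(u, v). a * u + b * v)) (at p)"
      by (rule has_derivative_transform_within_open[OF _ W(1)]) (use W(3) p in auto)
    then show ?thesis by blast
  qed
  then have "holomorphic_fun g (W \<inter> U)"
    unfolding holomorphic_fun_def using \<open>open U\<close> W(1) by blast
  then show ?thesis using W(2) f(2) by blast
qed

text \<open>One representative with one pair of jets stands for all of them, by
  \<open>germ_has_2jet\<close> and \<open>has_2jet_unique\<close>.\<close>

definition resonant_germ :: "complex \<Rightarrow> complex \<Rightarrow> (C2 \<Rightarrow> C2) set \<Rightarrow> bool" where
  "resonant_germ \<alpha> \<beta> \<phi> \<longleftrightarrow> (\<exists>f\<in>\<phi>. \<exists>c d. has_2jet (\<lambda>p. fst (f p)) c \<and> has_2jet (\<lambda>p. snd (f p)) d \<and>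
     c (1, 0) = \<alpha> \<and> c (0, 1) = 0 \<and> d (1, 0) = 0 \<and> d (0, 1) = \<beta> \<and> c (0, 2) \<noteq> 0 \<and> d (2, 0) \<noteq> 0)"

lemma germ_has_2jet:
  assumes "f \<in> \<phi>" "g \<in> \<phi>" "\<phi> = germ h" "has_2jet (\<lambda>p. fst (f p)) c" "has_2jet (\<lambda>p. snd (f p)) d"
  shows "has_2jet (\<lambda>p. fst (g p)) c" "has_2jet (\<lambda>p. snd (g p)) d"
proof -
  have "\<forall>\<^sub>F p in nhds 0. f p = h p" "\<forall>\<^sub>F p in nhds 0. g p = h p"
    using assms(1-3) by (auto simp: germ_def)
  then have "\<forall>\<^sub>F p in nhds 0. f p = g p" by eventually_elim simp
  then have "\<forall>\<^sub>F p in nhds 0. fst (f p) = fst (g p)" "\<forall>\<^sub>F p in nhds 0. snd (f p) = snd (g p)"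
    by (eventually_elim, simp)+
  from has_2jet_cong[OF this(1) assms(4)] has_2jet_cong[OF this(2) assms(5)]
  show "has_2jet (\<lambda>p. fst (g p)) c" "has_2jet (\<lambda>p. snd (g p)) d" .
qed

lemma Diff_has_2jet:
  assumes \<phi>: "\<phi> \<in> carrier Diff" and f: "f \<in> \<phi>"
  shows "has_2jet (\<lambda>p. fst (f p)) (\<lambda>(i, j). jet 2 (\<lambda>p. fst (f p)) (i, j) / (fact i * fact j))"
    "has_2jet (\<lambda>p. snd (f p)) (\<lambda>(i, j). jet 2 (\<lambda>p. snd (f p)) (i, j) / (fact i * fact j))"
proof -
  obtain h U where h: "\<phi> = germ h" "biholomorphic_near_0 h U" using \<phi> by (rule DiffE)
  note hU = biholomorphicD[OF h(2)]
  have "\<forall>\<^sub>F p in nhds 0. f p = h p" using f by (simp add: h germ_def)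
  then have "\<forall>\<^sub>F p in nhds 0. fst (f p) = fst (h p)" "\<forall>\<^sub>F p in nhds 0. snd (f p) = snd (h p)"
    by (eventually_elim, simp)+
  note eq = this
  have hol: "holomorphic_fun (\<lambda>p. fst (h p)) U" "holomorphic_fun (\<lambda>p. snd (h p)) U"
    using hU(5) by (simp_all add: holomorphic_map_def)
  show "has_2jet (\<lambda>p. fst (f p)) (\<lambda>(i, j). jet 2 (\<lambda>p. fst (f p)) (i, j) / (fact i * fact j))"
    using holomorphic_fun_cong_nhds[OF hol(1) hU(1) eq(1)] holomorphic_fun_has_2jet by blast
  show "has_2jet (\<lambda>p. snd (f p)) (\<lambda>(i, j). jet 2 (\<lambda>p. snd (f p)) (i, j) / (fact i * fact j))"
    using holomorphic_fun_cong_nhds[OF hol(2) hU(1) eq(2)] holomorphic_fun_has_2jet by blast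
qed

text \<open>\<open>krull_basic\<close> compares jets of some representative \<open>f'\<close>,
  possibly not the one that witnesses resonance; uniqueness of 2-jets reconciles the two.\<close>

lemma resonant_germ_krull_basic:
  assumes P: "resonant_germ \<alpha> \<beta> \<phi>" and \<phi>: "\<phi> \<in> carrier Diff" and \<psi>: "\<psi> \<in> krull_basic 2 \<phi>"
  shows "resonant_germ \<alpha> \<beta> \<psi>"
proof -
  obtain f c d where f: "f \<in> \<phi>" "has_2jet (\<lambda>p. fst (f p)) c" "has_2jet (\<lambda>p. snd (f p)) d"
    "c (1, 0) = \<alpha>" "c (0, 1) = 0" "d (1, 0) = 0" "d (0, 1) = \<beta>" "c (0, 2) \<noteq> 0" "d (2, 0) \<noteq> 0"
    using P unfolding resonant_germ_def by blast
  obtain f' g where g: "\<psi> \<in> carrier Diff" "f' \<in> \<phi>" "g \<in> \<psi>" "same_jet 2 f' g"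
    using \<psi> unfolding krull_basic_def by blast
  obtain h where h: "\<phi> = germ h" using \<phi> by (rule DiffE)
  note cd = germ_has_2jet[OF f(1) g(2) h f(2,3)]
  define c' where "c' = (\<lambda>(i, j). jet 2 (\<lambda>p. fst (g p)) (i, j) / (fact i * fact j))"
  define d' where "d' = (\<lambda>(i, j). jet 2 (\<lambda>p. snd (g p)) (i, j) / (fact i * fact j))"
  have eq: "c' (i, j) = c (i, j)" "d' (i, j) = d (i, j)" if "i + j \<le> 2" for i j
    using has_2jet_unique[OF cd(1) Diff_has_2jet(1)[OF \<phi> g(2)] that]
      has_2jet_unique[OF cd(2) Diff_has_2jet(2)[OF \<phi> g(2)] that] g(4)
    by (simp_all add: same_jet_def c'_def d'_def)
  have "has_2jet (\<lambda>p. fst (g p)) c'" "has_2jet (\<lambda>p. snd (g p)) d'"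
    using Diff_has_2jet[OF g(1,3)] unfolding c'_def d'_def .
  moreover have "c' (1, 0) = \<alpha> \<and> c' (0, 1) = 0 \<and> d' (1, 0) = 0 \<and> d' (0, 1) = \<beta> \<and> c' (0, 2) \<noteq> 0 \<and> d' (2, 0) \<noteq> 0"
    using f(4-9) by (simp add: eq)
  ultimately show ?thesis
    unfolding resonant_germ_def using g(3) by blast
qed

text \<open>Makes resonance a property of the image branch. Comparing the two germs along the
  branch, instead of forming a stabilizer element, avoids following quadratic coefficients through
  an inverse and a composition.\<close>

lemma resonant_germ_same_image:
  assumes P: "resonant_germ \<alpha> \<beta> \<phi>" and nz: "\<alpha> \<noteq> 0" "\<beta> \<noteq> 0"
    and \<phi>: "\<phi> \<in> carrier Diff" and \<psi>: "\<psi> \<in> carrier Diff" and r: "0 < r"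
    and eq: "image_germ \<phi> (set_germ (curve ` ball 0 r)) = image_germ \<psi> (set_germ (curve ` ball 0 r))"
  shows "resonant_germ \<alpha> \<beta> \<psi>"
proof -
  obtain f U where f: "\<phi> = germ f" "biholomorphic_near_0 f U" using \<phi> by (rule DiffE)
  obtain g V where g: "\<psi> = germ g" "biholomorphic_near_0 g V" using \<psi> by (rule DiffE)
  obtain F a b where F: "F \<in> \<phi>" "has_2jet (\<lambda>p. fst (F p)) a" "has_2jet (\<lambda>p. snd (F p)) b"
    "a (1, 0) = \<alpha>" "a (0, 1) = 0" "b (1, 0) = 0" "b (0, 1) = \<beta>" "a (0, 2) \<noteq> 0" "b (2, 0) \<noteq> 0"
    using P unfolding resonant_germ_def by blast
  have jf: "has_2jet (\<lambda>p. fst (f p)) a" "has_2jet (\<lambda>p. snd (f p)) b"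
    using germ_has_2jet[OF F(1) _ f(1) F(2,3), of f] by (simp_all add: f)
  obtain c d where jg: "has_2jet (\<lambda>p. fst (g p)) c" "has_2jet (\<lambda>p. snd (g p)) d"
    using Diff_has_2jet[OF \<psi>, of g] by (auto simp: g)
  have z: "a (0, 0) = 0" "b (0, 0) = 0" "c (0, 0) = 0" "d (0, 0) = 0"
    using jf[THEN has_2jet_at_0] jg[THEN has_2jet_at_0] biholomorphicD(2)[OF f(2)] biholomorphicD(2)[OF g(2)]
    by simp_all
  obtain \<tau> where \<tau>: "\<tau> \<in> O[at 0](\<lambda>t. t)" "(\<lambda>t. t) \<in> O[at 0](\<tau>)" "\<forall>\<^sub>F t in at 0. f (curve (\<tau> t)) = g (curve t)"
    using reparametrization[OF f(2) g(2) r] eq by (auto simp: f g)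
  have ev: "\<forall>\<^sub>F t in at 0. fst (f (curve (\<tau> t))) = fst (g (curve t))"
    "\<forall>\<^sub>F t in at 0. snd (f (curve (\<tau> t))) = snd (g (curve t))"
    using \<tau>(3) by (eventually_elim, simp)+
  have nz': "a (1, 0) \<noteq> 0" "b (0, 1) \<noteq> 0" using nz F(4,7) by simp_all
  note curve_matching[OF jf jg z(1) F(5) z(2) F(6) nz' z(3,4) \<tau>(1,2) ev]
  then show ?thesis
    unfolding resonant_germ_def using F(4,7-9) jg by (intro bexI[of _ g] exI[of _ c] exI[of _ d]) (simp_all add: g)
qed

lemma resonant_germ_not_exp:
  assumes P: "resonant_germ \<alpha> \<beta> \<phi>" and \<phi>: "\<phi> \<in> carrier Diff"
    and res: "\<alpha> ^ 2 = \<beta>" "\<beta> ^ 2 = \<alpha>" and ne: "\<alpha> \<noteq> \<beta>" and X: "singular_vector_field X"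
  shows "\<not> is_exp X \<phi>"
proof
  assume "is_exp X \<phi>"
  then obtain f U where f: "f \<in> \<phi>" "0 \<in> U" "holomorphic_map X U" and
    flow: "\<forall>\<^sub>F p in nhds 0. \<exists>u :: real \<Rightarrow> C2. u 0 = p \<and> u 1 = f p \<and>
           (\<forall>s\<in>{0..1}. u s \<in> U \<and> (u has_vector_derivative X (u s)) (at s within {0..1}))"
    unfolding is_exp_def by blast
  obtain F c d where F: "F \<in> \<phi>" "has_2jet (\<lambda>p. fst (F p)) c" "has_2jet (\<lambda>p. snd (F p)) d"
    "c (1, 0) = \<alpha>" "c (0, 1) = 0" "d (1, 0) = 0" "d (0, 1) = \<beta>" "c (0, 2) \<noteq> 0" "d (2, 0) \<noteq> 0"
    using P unfolding resonant_germ_def by blast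
  obtain h V where h: "\<phi> = germ h" "biholomorphic_near_0 h V" using \<phi> by (rule DiffE)
  have "\<forall>\<^sub>F p in nhds 0. f p = h p" using f(1) by (simp add: h germ_def)
  from eventually_nhds_x_imp_x[OF this] have f0: "f 0 = 0" using biholomorphicD(2)[OF h(2)] by simp
  have X0: "X 0 = 0" using X by (simp add: singular_vector_field_def)
  obtain a b where ab: "has_2jet (\<lambda>p. fst (X p)) a" "has_2jet (\<lambda>p. snd (X p)) b"
    using f(2,3) holomorphic_fun_has_2jet unfolding holomorphic_map_def by blast
  have flow': "\<forall>\<^sub>F p in nhds 0. \<exists>u :: real \<Rightarrow> C2. u 0 = p \<and> u 1 = f p \<and>
      (\<forall>s\<in>{0..1}. (u has_vector_derivative X (u s)) (at s within {0..1}))"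
    using flow by eventually_elim blast
  interpret time_one_map X f U a b c d
    by unfold_locales (fact f(2,3) X0 ab flow' f0 germ_has_2jet[OF F(1) f(1) h(1) F(2,3)])+
  show False using resonance_obstruction[OF F(4-9) res ne] .
qed

lemma exists_resonant_germ:
  assumes nz: "\<alpha> \<noteq> 0" "\<beta> \<noteq> 0"
  shows "\<exists>\<phi>\<in>carrier Diff. resonant_germ \<alpha> \<beta> \<phi>"
proof -
  \<comment> \<open>A composition of two shears and a diagonal map, so that the inverse is a polynomial map too.\<close>
  define f :: "C2 \<Rightarrow> C2" where
    "f p = (\<alpha> * (fst p + (snd p + fst p * fst p) * (snd p + fst p * fst p)), \<beta> * (snd p + fst p * fst p))" for p
  define x :: "C2 \<Rightarrow> complex" where
    "x p = inverse \<alpha> * fst p + (- 1) * ((inverse \<beta> * snd p) * (inverse \<beta> * snd p))" for p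
  define g :: "C2 \<Rightarrow> C2" where "g p = (x p, inverse \<beta> * snd p + (- 1) * (x p * x p))" for p
  note hol = holomorphic_fun_const holomorphic_fun_fst holomorphic_fun_snd holomorphic_fun_add holomorphic_fun_mult
  have xf: "x (f p) = fst p" for p
    using nz by (simp add: x_def f_def field_simps)
  have gf: "g (f p) = p" for p
    unfolding g_def xf using nz by (simp add: f_def prod_eq_iff flip: mult.assoc)
  have fg: "f (g p) = p" for p
    unfolding f_def g_def x_def using nz by (simp add: prod_eq_iff field_simps)
  have "range f = UNIV" using fg by (metis surjI)
  have "holomorphic_map f UNIV" "holomorphic_map g UNIV"
    unfolding holomorphic_map_def f_def g_def x_def fst_conv snd_conv by (intro conjI hol)+
  then have f: "biholomorphic_near_0 f UNIV"
    unfolding biholomorphic_near_0_def \<open>range f = UNIV\<close> using gf by (auto simp: f_def zero_prod_def)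
  define c :: "nat \<times> nat \<Rightarrow> complex" where "c = (\<lambda>_. 0)((1, 0) := \<alpha>, (0, 2) := \<alpha>)"
  define d :: "nat \<times> nat \<Rightarrow> complex" where "d = (\<lambda>_. 0)((0, 1) := \<beta>, (2, 0) := \<beta>)"
  have "has_2jet (\<lambda>p. fst (f p)) c"
  proof -
    \<comment> \<open>The remainder is \<alpha> (2 y x^2 + x^4), and in the unit ball the quartic
      term is at most |p|^3, whence 3 = 2 + 1.\<close>
    have "norm (fst (f p) - quad_poly c p) \<le> (3 * norm \<alpha>) * norm p ^ 3" if p: "norm p < 1" for p
    proof -
      obtain u v where uv: "p = (u, v)" by (cases p)
      have n: "norm u \<le> norm p" "norm v \<le> norm p"
        using norm_fst_le[of u v] norm_snd_le[of v u] by (simp_all add: uv)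
      have "fst (f p) - quad_poly c p = \<alpha> * (2 * (v * u ^ 2) + u ^ 3 * u)"
        by (simp add: f_def quad_poly_def c_def uv algebra_simps power2_eq_square power3_eq_cube)
      moreover have "norm (v * u ^ 2) \<le> norm p * norm p ^ 2"
        unfolding norm_mult norm_power using n by (intro mult_mono power_mono) auto
      moreover have "norm (u ^ 3 * u) \<le> norm p ^ 3 * 1"
        unfolding norm_mult norm_power using n p by (intro mult_mono power_mono) auto
      ultimately have "norm (fst (f p) - quad_poly c p) \<le> norm \<alpha> * (2 * (norm p * norm p ^ 2) + norm p ^ 3 * 1)"
        using norm_triangle_ineq[of "2 * (v * u ^ 2)" "u ^ 3 * u"]
        by (auto simp: norm_mult intro!: mult_left_mono)
      then show ?thesis by (simp add: power3_eq_cube power2_eq_square algebra_simps)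
    qed
    then show ?thesis
      unfolding has_2jet_def eventually_nhds_metric by (intro exI[of _ "3 * norm \<alpha>"] exI[of _ 1]) auto
  qed
  moreover have "has_2jet (\<lambda>p. snd (f p)) d"
  proof -
    have "snd (f p) = quad_poly d p" for p
      by (simp add: f_def quad_poly_def d_def algebra_simps power2_eq_square)
    then show ?thesis unfolding has_2jet_def by (intro exI[of _ 0]) simp
  qed
  ultimately have "resonant_germ \<alpha> \<beta> (germ f)"
    unfolding resonant_germ_def using nz
    by (intro bexI[of _ f] exI[of _ c] exI[of _ d]) (simp_all add: c_def d_def)
  with germ_in_Diff[OF f] show ?thesis by blast
qed

text \<open>The topology is a quotient taken twice. Pulling V back through both maps gives the set S
  of germs that send the branch into V, and a k common to all of S writes it as a union of basic
  sets.\<close>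

lemma openin_krull_class:
  assumes \<Gamma>: "\<Gamma> = set_germ A" and V: "V \<subseteq> analytic_class \<Gamma>"
    and nbhd: "\<And>\<phi> \<psi>. \<phi> \<in> carrier Diff \<Longrightarrow> image_germ \<phi> \<Gamma> \<in> V \<Longrightarrow> \<psi> \<in> krull_basic k \<phi> \<Longrightarrow> image_germ \<psi> \<Gamma> \<in> V"
  shows "openin (krull_class \<Gamma>) V"
proof -
  define S where "S = {\<phi> \<in> carrier Diff. image_germ \<phi> \<Gamma> \<in> V}"
  have "S = \<Union> (krull_basic k ` S)"
  proof
    show "S \<subseteq> \<Union> (krull_basic k ` S)"
    proof
      fix \<phi> assume \<phi>: "\<phi> \<in> S"
      then obtain f where "\<phi> = germ f" by (auto simp: S_def elim: DiffE)
      then have "f \<in> \<phi>" by simp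
      then have "\<phi> \<in> krull_basic k \<phi>"
        using \<phi> unfolding krull_basic_def same_jet_def S_def by blast
      with \<phi> show "\<phi> \<in> \<Union> (krull_basic k ` S)" by blast
    qed
    show "\<Union> (krull_basic k ` S) \<subseteq> S"
      using nbhd by (auto simp: S_def krull_basic_def)
  qed
  moreover have "openin krull_Diff (\<Union> (krull_basic k ` S))"
    unfolding krull_Diff_def
    by (intro openin_Union) (auto intro!: topology_generated_by_Basis simp: S_def)
  ultimately have S: "openin krull_Diff S" by simp
  have "V \<subseteq> topspace (krull_class \<Gamma>)" using V topspace_krull_class[OF \<Gamma>] by simp
  moreover have "{\<phi> \<in> topspace krull_Diff. \<phi> <#\<^bsub>Diff\<^esub> Stab \<Gamma> \<in>
      {c \<in> topspace (krull_cosets \<Gamma>). coset_branch \<Gamma> c \<in> V}} = S"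
    by (auto simp: S_def topspace_krull_Diff krull_cosets_def topspace_quotient_topology coset_branch_eq[OF \<Gamma>])
  ultimately show ?thesis
    using S unfolding krull_class_def topspace_quotient_topology openin_quotient_topology
    by (auto simp: krull_cosets_def openin_quotient_topology topspace_quotient_topology)
qed

theorem proposition2:
  fixes \<Gamma> :: "C2 set set" and \<C> \<C>' :: "C2 set set set"
  assumes "plane_branch \<Gamma>"
    and "puiseux_parametrization 6 (\<lambda>t. t ^ 7 + t ^ 10 + t ^ 11) \<Gamma>"
    and "\<C> = analytic_class \<Gamma>"
    and "\<C>' = {\<Gamma>' \<in> \<C>. connected_by_geodesic \<Gamma> \<Gamma>'}"
  shows "(\<exists>V. openin (krull_class \<Gamma>) V \<and> V \<noteq> {} \<and> V \<subseteq> \<C> - \<C>') \<and>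
         krull_class \<Gamma> closure_of \<C>' \<noteq> topspace (krull_class \<Gamma>)"
proof -
  obtain r where r: "r > 0" "\<Gamma> = set_germ (curve ` ball 0 r)"
    using assms(2) unfolding puiseux_parametrization_def by blast
  define \<alpha> where "\<alpha> = cis (2 * pi / 3)"
  have \<alpha>3: "\<alpha> ^ 3 = 1" unfolding \<alpha>_def Complex.DeMoivre by simp
  have \<alpha>0: "\<alpha> \<noteq> 0" by (simp add: \<alpha>_def)
  have "Re \<alpha> \<noteq> 1" by (simp add: \<alpha>_def cos_120)
  then have \<alpha>1: "\<alpha> \<noteq> \<alpha> ^ 2" using \<alpha>0 by (auto simp: power2_eq_square)
  have \<alpha>4: "(\<alpha> ^ 2) ^ 2 = \<alpha>" using \<alpha>3 by (simp add: power_numeral_reduce)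
  define V where "V = {image_germ \<phi> \<Gamma> | \<phi>. \<phi> \<in> carrier Diff \<and> resonant_germ \<alpha> (\<alpha> ^ 2) \<phi>}"
  \<comment> \<open>By rigidity, membership in V can be tested on any germ producing the branch.
    Openness needs this for the preimage of V, and disjointness from \<C>' for a germ known only as
    an exponential.\<close>
  have V: "image_germ \<phi> \<Gamma> \<in> V \<longleftrightarrow> resonant_germ \<alpha> (\<alpha> ^ 2) \<phi>" if \<phi>: "\<phi> \<in> carrier Diff" for \<phi>
  proof
    assume "image_germ \<phi> \<Gamma> \<in> V"
    then obtain \<psi> where "\<psi> \<in> carrier Diff" "resonant_germ \<alpha> (\<alpha> ^ 2) \<psi>" "image_germ \<psi> \<Gamma> = image_germ \<phi> \<Gamma>"
      by (auto simp: V_def)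
    then show "resonant_germ \<alpha> (\<alpha> ^ 2) \<phi>"
      using resonant_germ_same_image[OF _ _ _ _ \<phi> r(1)] \<alpha>0 unfolding r(2) by simp
  qed (use \<phi> in \<open>auto simp: V_def\<close>)
  have VC: "V \<subseteq> \<C>" by (auto simp: V_def assms(3) analytic_class_def orbit_def)
  have "openin (krull_class \<Gamma>) V"
  proof (rule openin_krull_class[OF r(2)])
    show "V \<subseteq> analytic_class \<Gamma>" using VC assms(3) by simp
    show "image_germ \<psi> \<Gamma> \<in> V"
      if "\<phi> \<in> carrier Diff" "image_germ \<phi> \<Gamma> \<in> V" "\<psi> \<in> krull_basic 2 \<phi>" for \<phi> \<psi>
      using that V[of \<phi>] V[of \<psi>] resonant_germ_krull_basic by (simp add: krull_basic_def)
  qed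
  moreover have "V \<noteq> {}"
    using exists_resonant_germ[of \<alpha> "\<alpha> ^ 2"] \<alpha>0 by (auto simp: V_def)
  moreover have disj: "V \<inter> \<C>' = {}"
  proof (rule ccontr)
    assume "V \<inter> \<C>' \<noteq> {}"
    then obtain X \<phi> where "singular_vector_field X" "\<phi> \<in> carrier Diff" "is_exp X \<phi>" "image_germ \<phi> \<Gamma> \<in> V"
      by (auto simp: assms(4) connected_by_geodesic_def)
    then show False
      using V resonant_germ_not_exp[OF _ _ refl \<alpha>4 \<alpha>1] by blast
  qed
  moreover have "krull_class \<Gamma> closure_of \<C>' \<noteq> topspace (krull_class \<Gamma>)"
  proof
    assume *: "krull_class \<Gamma> closure_of \<C>' = topspace (krull_class \<Gamma>)"
    obtain v where "v \<in> V" using \<open>V \<noteq> {}\<close> by blast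
    then have "v \<in> krull_class \<Gamma> closure_of \<C>'"
      using * openin_subset[OF \<open>openin (krull_class \<Gamma>) V\<close>] by blast
    then show False
      using \<open>v \<in> V\<close> \<open>openin (krull_class \<Gamma>) V\<close> disj by (auto simp: in_closure_of)
  qed
  ultimately show ?thesis using VC by blast
qed

end
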